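(* Let $\Bbbk$ be a field, $A=\Bbbk[[x,y,u,v]]/(xy,uv)$ and $J=\bigl\langle(xu)^2,(xv)^2,(yu)^2,(yv)^2\bigr\rangle_A$. Let $M$ be a rank one object of $\mathsf{CM}^{\mathsf{lf}}(A)$. Then $M\cong M(\omega,\lambda)$, where $$M(\omega,\lambda):=\Bigl\langle J,\ x^{m_1+1}u+\lambda x^{m_2+1}v,\ u^{n_1+1}y+u^{n_2+1}x,\ y^{p_1+1}v+y^{p_2+1}u,\ v^{q_1+1}x+v^{q_2+1}y\Bigr\rangle_A^{\vee\vee}$$ (the bidual of an ideal of $A$), for some $\omega=\bigl((m_1,m_2),(n_1,n_2),(p_1,p_2),(q_1,q_2)\bigr)\in\mathbb Z^8$ and $\lambda\in\Bbbk^*$ with $$\min(m_1,m_2)=\min(n_1,n_2)=\min(p_1,p_2)=\min(q_1,q_2)=1.$$ Moreover, $M(\omega,\lambda)\cong M(\omega',\lambda')$ if and only if $\omega=\omega'$ and $\lambda=\lambda'$.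
   Context: $\mathsf{CM}^{\mathsf{lf}}(A)$ is the category of maximal Cohen--Macaulay $A$-modules $M$ such that $M_{\mathfrak p}$ is free over $A_{\mathfrak p}$ for every non-maximal prime ideal $\mathfrak p$; rank one means all these localizations are free of rank one. Since $A$ is Gorenstein, $N^\vee=\mathrm{Hom}_A(N,A)$. *)

theory Defs
  imports
    "HOL-Computational_Algebra.Formal_Power_Series"
    "HOL-Library.Extended_Nat"
    "HOL-Algebra.QuotRing"
    "HOL-Algebra.Module"
begin

section \<open>Modules over a commutative ring\<close>

text \<open>Only the additive and scalar structure of a \<^type>\<open>module\<close> record is meaningful; the fields
  \<^const>\<open>monoid.mult\<close> and \<^const>\<open>monoid.one\<close> that it inherits from the record of rings are left undefined below.\<close>

definition lin_maps :: "('a, 'r) ring_scheme \<Rightarrow> ('a, 'b, 'm) module_scheme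
    \<Rightarrow> ('a, 'c, 'n) module_scheme \<Rightarrow> ('b \<Rightarrow> 'c) set" where
  "lin_maps R M N = {f \<in> carrier M \<rightarrow>\<^sub>E carrier N.
     (\<forall>x\<in>carrier M. \<forall>y\<in>carrier M. f (x \<oplus>\<^bsub>M\<^esub> y) = f x \<oplus>\<^bsub>N\<^esub> f y) \<and>
     (\<forall>a\<in>carrier R. \<forall>x\<in>carrier M. f (a \<odot>\<^bsub>M\<^esub> x) = a \<odot>\<^bsub>N\<^esub> f x)}"

definition mod_iso :: "('a, 'r) ring_scheme \<Rightarrow> ('a, 'b, 'm) module_scheme
    \<Rightarrow> ('a, 'c, 'n) module_scheme \<Rightarrow> bool" where
  "mod_iso R M N \<longleftrightarrow> (\<exists>f\<in>lin_maps R M N. bij_betw f (carrier M) (carrier N))"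

definition ideal_mod :: "('a, 'r) ring_scheme \<Rightarrow> 'a set \<Rightarrow> ('a, 'a) module" where
  "ideal_mod R I = \<lparr>carrier = I, monoid.mult = undefined, one = undefined,
     zero = \<zero>\<^bsub>R\<^esub>, add = (\<oplus>\<^bsub>R\<^esub>), module.smult = (\<otimes>\<^bsub>R\<^esub>)\<rparr>"

definition regular_mod :: "('a, 'r) ring_scheme \<Rightarrow> ('a, 'a) module" where
  "regular_mod R = ideal_mod R (carrier R)"

definition hom_mod :: "('a, 'r) ring_scheme \<Rightarrow> ('a, 'b, 'm) module_scheme
    \<Rightarrow> ('a, 'c, 'n) module_scheme \<Rightarrow> ('a, 'b \<Rightarrow> 'c) module" where
  "hom_mod R M N = \<lparr>carrier = lin_maps R M N, monoid.mult = undefined, one = undefined,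
     zero = (\<lambda>x\<in>carrier M. \<zero>\<^bsub>N\<^esub>),
     add = (\<lambda>f g. \<lambda>x\<in>carrier M. f x \<oplus>\<^bsub>N\<^esub> g x),
     module.smult = (\<lambda>a f. \<lambda>x\<in>carrier M. a \<odot>\<^bsub>N\<^esub> f x)\<rparr>"

definition dual_mod :: "('a, 'r) ring_scheme \<Rightarrow> ('a, 'b, 'm) module_scheme
    \<Rightarrow> ('a, 'b \<Rightarrow> 'a) module" where
  "dual_mod R N = hom_mod R N (regular_mod R)"

definition mod_span :: "('a, 'r) ring_scheme \<Rightarrow> ('a, 'b, 'm) module_scheme \<Rightarrow> 'b set \<Rightarrow> 'b set" where
  "mod_span R M B = \<Inter>{N. submodule N R M \<and> B \<subseteq> N}"

definition fin_gen_mod :: "('a, 'r) ring_scheme \<Rightarrow> ('a, 'b, 'm) module_scheme \<Rightarrow> bool" where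
  "fin_gen_mod R M \<longleftrightarrow> (\<exists>B\<subseteq>carrier M. finite B \<and> mod_span R M B = carrier M)"

definition free_of_rank :: "('a, 'r) ring_scheme \<Rightarrow> ('a, 'b, 'm) module_scheme \<Rightarrow> nat \<Rightarrow> bool" where
  "free_of_rank R M n \<longleftrightarrow> (\<exists>b\<in>{..<n} \<rightarrow> carrier M. \<forall>z\<in>carrier M.
     \<exists>!a. a \<in> {..<n} \<rightarrow>\<^sub>E carrier R \<and> z = (\<Oplus>\<^bsub>M\<^esub>i\<in>{..<n}. a i \<odot>\<^bsub>M\<^esub> b i))"


section \<open>Localization\<close>

definition loc_rel :: "('a, 'r) ring_scheme \<Rightarrow> 'a set \<Rightarrow> ('a, 'b, 'm) module_scheme
    \<Rightarrow> (('b \<times> 'a) \<times> ('b \<times> 'a)) set" where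
  "loc_rel R S M = {((m, s), (n, t)). m \<in> carrier M \<and> n \<in> carrier M \<and> s \<in> S \<and> t \<in> S \<and>
     (\<exists>r\<in>S. r \<odot>\<^bsub>M\<^esub> (t \<odot>\<^bsub>M\<^esub> m) = r \<odot>\<^bsub>M\<^esub> (s \<odot>\<^bsub>M\<^esub> n))}"

definition loc_frac :: "('a, 'r) ring_scheme \<Rightarrow> 'a set \<Rightarrow> ('a, 'b, 'm) module_scheme
    \<Rightarrow> 'b \<Rightarrow> 'a \<Rightarrow> ('b \<times> 'a) set" where
  "loc_frac R S M m s = loc_rel R S M `` {(m, s)}"

text \<open>The unions over representatives are unions of copies of a single class, as in the library's
  \<^const>\<open>rcoset_mult\<close>.\<close>

definition loc_add :: "('a, 'r) ring_scheme \<Rightarrow> 'a set \<Rightarrow> ('a, 'b, 'm) module_scheme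
    \<Rightarrow> ('b \<times> 'a) set \<Rightarrow> ('b \<times> 'a) set \<Rightarrow> ('b \<times> 'a) set" where
  "loc_add R S M X Y = (\<Union>(m, s)\<in>X. \<Union>(n, t)\<in>Y.
     loc_frac R S M ((t \<odot>\<^bsub>M\<^esub> m) \<oplus>\<^bsub>M\<^esub> (s \<odot>\<^bsub>M\<^esub> n)) (s \<otimes>\<^bsub>R\<^esub> t))"

definition loc_smult :: "('a, 'r) ring_scheme \<Rightarrow> 'a set \<Rightarrow> ('a, 'b, 'm) module_scheme
    \<Rightarrow> ('a \<times> 'a) set \<Rightarrow> ('b \<times> 'a) set \<Rightarrow> ('b \<times> 'a) set" where
  "loc_smult R S M X Y = (\<Union>(a, s)\<in>X. \<Union>(n, t)\<in>Y. loc_frac R S M (a \<odot>\<^bsub>M\<^esub> n) (s \<otimes>\<^bsub>R\<^esub> t))"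

definition loc_mod :: "('a, 'r) ring_scheme \<Rightarrow> 'a set \<Rightarrow> ('a, 'b, 'm) module_scheme
    \<Rightarrow> (('a \<times> 'a) set, ('b \<times> 'a) set) module" where
  "loc_mod R S M = \<lparr>carrier = (carrier M \<times> S) // loc_rel R S M,
     monoid.mult = undefined, one = undefined,
     zero = loc_frac R S M \<zero>\<^bsub>M\<^esub> \<one>\<^bsub>R\<^esub>, add = loc_add R S M, module.smult = loc_smult R S M\<rparr>"

definition loc_ring :: "('a, 'r) ring_scheme \<Rightarrow> 'a set \<Rightarrow> ('a \<times> 'a) set ring" where
  "loc_ring R S = \<lparr>carrier = (carrier R \<times> S) // loc_rel R S (regular_mod R),
     monoid.mult = loc_smult R S (regular_mod R),
     one = loc_frac R S (regular_mod R) \<one>\<^bsub>R\<^esub> \<one>\<^bsub>R\<^esub>,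
     zero = loc_frac R S (regular_mod R) \<zero>\<^bsub>R\<^esub> \<one>\<^bsub>R\<^esub>,
     add = loc_add R S (regular_mod R)\<rparr>"

text \<open>The localizations \<open>R\<^sub>p\<close> and \<open>M\<^sub>p\<close> at a prime ideal \<open>p\<close>.\<close>

abbreviation ring_at :: "('a, 'r) ring_scheme \<Rightarrow> 'a set \<Rightarrow> ('a \<times> 'a) set ring" where
  "ring_at R p \<equiv> loc_ring R (carrier R - p)"

abbreviation mod_at :: "('a, 'r) ring_scheme \<Rightarrow> 'a set \<Rightarrow> ('a, 'b, 'm) module_scheme
    \<Rightarrow> (('a \<times> 'a) set, ('b \<times> 'a) set) module" where
  "mod_at R p M \<equiv> loc_mod R (carrier R - p) M"


section \<open>Maximal Cohen--Macaulay modules over a local ring\<close>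

definition krull_dim :: "('a, 'r) ring_scheme \<Rightarrow> enat" where
  "krull_dim R = Sup {enat n |n. \<exists>ps. length ps = Suc n \<and>
     (\<forall>p\<in>set ps. primeideal p R) \<and> sorted_wrt (\<subset>) ps}"

definition seq_mult :: "('a, 'r) ring_scheme \<Rightarrow> ('a, 'b, 'm) module_scheme \<Rightarrow> 'a list \<Rightarrow> 'b set" where
  "seq_mult R M rs = mod_span R M {r \<odot>\<^bsub>M\<^esub> z |r z. r \<in> set rs \<and> z \<in> carrier M}"

text \<open>\<open>rs ! i\<close> is a nonzerodivisor on the quotient of \<open>M\<close> by the submodule generated by the products
  with the preceding entries, and the quotient by all of \<open>rs\<close> is nonzero.\<close>

definition regular_seq :: "('a, 'r) ring_scheme \<Rightarrow> ('a, 'b, 'm) module_scheme \<Rightarrow> 'a list \<Rightarrow> bool" where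
  "regular_seq R M rs \<longleftrightarrow> set rs \<subseteq> carrier R \<and> seq_mult R M rs \<noteq> carrier M \<and>
     (\<forall>i<length rs. \<forall>z\<in>carrier M.
        (rs ! i) \<odot>\<^bsub>M\<^esub> z \<in> seq_mult R M (take i rs) \<longrightarrow> z \<in> seq_mult R M (take i rs))"

text \<open>In a local ring the nonunits \<open>carrier R - Units R\<close> form the maximal ideal.\<close>

definition depth_local :: "('a, 'r) ring_scheme \<Rightarrow> ('a, 'b, 'm) module_scheme \<Rightarrow> enat" where
  "depth_local R M = Sup {enat (length rs) |rs. regular_seq R M rs \<and> set rs \<subseteq> carrier R - Units R}"

text \<open>The zero module, whose depth is infinite by the usual convention, counts as maximal
  Cohen--Macaulay.\<close>

definition max_CM :: "('a, 'r) ring_scheme \<Rightarrow> ('a, 'b, 'm) module_scheme \<Rightarrow> bool" where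
  "max_CM R M \<longleftrightarrow> module R M \<and> fin_gen_mod R M \<and>
     (carrier M = {\<zero>\<^bsub>M\<^esub>} \<or> depth_local R M = krull_dim R)"

definition CM_lf :: "('a, 'r) ring_scheme \<Rightarrow> ('a, 'b, 'm) module_scheme \<Rightarrow> bool" where
  "CM_lf R M \<longleftrightarrow> max_CM R M \<and> (\<forall>p. primeideal p R \<and> \<not> maximalideal p R \<longrightarrow>
     (\<exists>n. free_of_rank (ring_at R p) (mod_at R p M) n))"

definition CM_lf_rank_one :: "('a, 'r) ring_scheme \<Rightarrow> ('a, 'b, 'm) module_scheme \<Rightarrow> bool" where
  "CM_lf_rank_one R M \<longleftrightarrow> CM_lf R M \<and> (\<forall>p. primeideal p R \<and> \<not> maximalideal p R \<longrightarrow>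
     free_of_rank (ring_at R p) (mod_at R p M) 1)"


section \<open>The ring A = k[[x,y,u,v]]/(xy,uv)\<close>

text \<open>\<open>k[[x,y,u,v]]\<close> is realized as the iterated power series ring \<open>k[[x]][[y]][[u]][[v]]\<close>.\<close>

type_synonym 'k ps4 = "'k fps fps fps fps"

definition ps_x :: "'k::field ps4" where "ps_x = fps_const (fps_const (fps_const fps_X))"
definition ps_y :: "'k::field ps4" where "ps_y = fps_const (fps_const fps_X)"
definition ps_u :: "'k::field ps4" where "ps_u = fps_const fps_X"
definition ps_v :: "'k::field ps4" where "ps_v = fps_X"

definition ps_const :: "'k::field \<Rightarrow> 'k ps4" where
  "ps_const c = fps_const (fps_const (fps_const (fps_const c)))"

definition ps_ring :: "'k::field ps4 ring" where
  "ps_ring = \<lparr>carrier = UNIV, monoid.mult = (*), one = 1, zero = 0, add = (+)\<rparr>"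

definition rel_ideal :: "'k::field ps4 set" where
  "rel_ideal = Idl\<^bsub>ps_ring\<^esub> {ps_x * ps_y, ps_u * ps_v}"

definition ringA :: "'k::field ps4 set ring" where
  "ringA = ps_ring Quot rel_ideal"

definition toA :: "'k::field ps4 \<Rightarrow> 'k ps4 set" where
  "toA f = rel_ideal +>\<^bsub>ps_ring\<^esub> f"

definition idealJ :: "'k::field ps4 set set" where
  "idealJ = Idl\<^bsub>ringA\<^esub> {toA ((ps_x * ps_u)^2), toA ((ps_x * ps_v)^2),
                      toA ((ps_y * ps_u)^2), toA ((ps_y * ps_v)^2)}"


section \<open>The modules M(omega, lambda)\<close>

type_synonym weights = "(int \<times> int) \<times> (int \<times> int) \<times> (int \<times> int) \<times> (int \<times> int)"

fun admissible_weights :: "weights \<Rightarrow> bool" where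
  "admissible_weights ((m1, m2), (n1, n2), (p1, p2), (q1, q2)) \<longleftrightarrow>
     min m1 m2 = 1 \<and> min n1 n2 = 1 \<and> min p1 p2 = 1 \<and> min q1 q2 = 1"

text \<open>For admissible weights all exponents \<open>m + 1\<close> are positive, so the truncation in \<^const>\<open>nat\<close> is
  harmless.\<close>

fun ideal_wl :: "weights \<Rightarrow> 'k::field \<Rightarrow> 'k ps4 set set" where
  "ideal_wl ((m1, m2), (n1, n2), (p1, p2), (q1, q2)) l = Idl\<^bsub>ringA\<^esub> (idealJ \<union>
     {toA (ps_x ^ nat (m1 + 1) * ps_u + ps_const l * ps_x ^ nat (m2 + 1) * ps_v),
      toA (ps_u ^ nat (n1 + 1) * ps_y + ps_u ^ nat (n2 + 1) * ps_x),
      toA (ps_y ^ nat (p1 + 1) * ps_v + ps_y ^ nat (p2 + 1) * ps_u),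
      toA (ps_v ^ nat (q1 + 1) * ps_x + ps_v ^ nat (q2 + 1) * ps_y)})"

definition mod_wl :: "weights \<Rightarrow> 'k::field
    \<Rightarrow> ('k ps4 set, ('k ps4 set \<Rightarrow> 'k ps4 set) \<Rightarrow> 'k ps4 set) module" where
  "mod_wl w l = dual_mod ringA (dual_mod ringA (ideal_mod ringA (ideal_wl w l)))"

end

theory Submission
  imports Defs "HOL-Library.Function_Algebras"
begin

text \<open>The ring \<open>A\<close> consists of the quadruples of power series on the four components
  \<open>k[[x,u]]\<close>, \<open>k[[y,u]]\<close>, \<open>k[[x,v]]\<close>, \<open>k[[y,v]]\<close> of its normalization that agree on the four
  axes. For a pair of nonzero weights on each axis, let \<open>glue w\<close> be the module of the quadruples
  whose restrictions to each axis are in the proportion prescribed by \<open>w\<close>. Linear maps between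
  such modules are multiplications by quadruples, hence dualizing \<open>glue w\<close> exchanges the two
  weights on each axis, the bidual of the ideal defining \<open>M(\<omega>,\<lambda>)\<close> is the module \<open>glue w\<close> with
  weights \<open>x\<^sup>m\<close>, and an isomorphism is a quadruple of units, whose values on the axes determine
  the weights up to the stated normalization.

  Conversely, a module \<open>M\<close> of rank one is torsion free and embeds into the normalization, where
  depth two makes its image \<open>G\<close> saturated with respect to the maximal ideal. The components of the
  saturation are principal ideals, so after rescaling they are trivial, and freeness at the
  generic points of the axes shows that \<open>G\<close> equals some \<open>glue w\<close>. Units on the components normalize
  all weights to powers of the variables, except for a single scalar that survives because the
  four components form a cycle.\<close>

text \<open>Let \<open>E\<close> be the quadruple whose entry on each component is the product of
  its two variables. On the four components \<open>(xu)^2\<close> is \<open>E\<close> times the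
  quadruple with the single entry \<open>xu\<close>, and
  \<open>x^(m1+1) u + \<lambda> x^(m2+1) v\<close> is \<open>E\<close> times the quadruple with the
  entries \<open>x^m1\<close> and \<open>\<lambda> x^m2\<close> on the components of the axis of
  \<open>x\<close>. Division by the nonzerodivisor \<open>E\<close> thus accounts for the squares in
  \<open>J\<close> and for the shift of the exponents by one. The smaller exponent is 1 and not 0
  because such a quadruple, zero on the other two components, glues along the transversal axes only
  if its entries vanish at the origin. The ideal itself is never determined. It suffices that it
  contains these eight generators and lies in \<open>E\<close> times \<open>glue w\<close>: a linear
  map is a multiplication whose factor can be computed and constrained at the eight elements alone.
  The count behind the surviving scalar: four component constants act on four axis constants, but a
  common factor acts trivially, so one parameter remains.\<close>

unbundle fps_syntax

section \<open>Power series in two variables\<close>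

type_synonym 'k ps2 = "'k fps fps"

text \<open>A series in two variables is a series in the outer variable with coefficients in the inner
  one. The index \<open>\<kappa>\<close> names a variable: \<^const>\<open>False\<close> the inner one, \<^const>\<open>True\<close> the outer one. \<open>res \<kappa>\<close>
  restricts to the axis on which the variable \<open>\<kappa>\<close> survives.\<close>

definition res :: "bool \<Rightarrow> 'a::comm_ring_1 fps fps \<Rightarrow> 'a fps" where
  "res \<kappa> g = (if \<kappa> then Abs_fps (\<lambda>n. g $ n $ 0) else g $ 0)"

definition emb :: "bool \<Rightarrow> 'k::field fps \<Rightarrow> 'k ps2" where
  "emb \<kappa> p = (if \<kappa> then Abs_fps (\<lambda>n. fps_const (p $ n)) else fps_const p)"

definition vr :: "bool \<Rightarrow> 'k::field ps2" where
  "vr \<kappa> = emb \<kappa> fps_X"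

lemma res_add [simp]: "res \<kappa> (f + g) = res \<kappa> f + res \<kappa> g"
  by (auto simp: res_def fps_eq_iff)

lemma res_diff [simp]: "res \<kappa> (f - g) = res \<kappa> f - res \<kappa> g"
  by (auto simp: res_def fps_eq_iff)

lemma res_0 [simp]: "res \<kappa> 0 = 0"
  by (auto simp: res_def fps_eq_iff)

lemma res_1 [simp]: "res \<kappa> 1 = 1"
  by (auto simp: res_def fps_eq_iff)

lemma res_mult [simp]: "res \<kappa> (f * g) = res \<kappa> f * res \<kappa> g"
  by (auto simp: res_def fps_eq_iff fps_mult_nth fps_sum_nth)

lemma res_power [simp]: "res \<kappa> (f ^ n) = res \<kappa> f ^ n"
  by (induction n) auto

lemma emb_0 [simp]: "emb \<kappa> 0 = 0"
  by (auto simp: emb_def fps_eq_iff)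

lemma emb_1 [simp]: "emb \<kappa> 1 = 1"
  by (auto simp: emb_def fps_eq_iff)

lemma emb_mult: "emb \<kappa> (f * g) = emb \<kappa> f * emb \<kappa> g"
  by (auto simp: emb_def fps_eq_iff fps_mult_nth fps_sum_nth intro!: sum.neutral)

lemma emb_power: "emb \<kappa> (f ^ n) = emb \<kappa> f ^ n"
  by (induction n) (auto simp: emb_mult)

lemma res_emb [simp]: "res \<kappa> (emb \<kappa>' p) = (if \<kappa> = \<kappa>' then p else fps_const (p $ 0))"
  by (auto simp: emb_def res_def fps_eq_iff)

lemma res_vr [simp]: "res \<kappa> (vr \<kappa>') = (if \<kappa> = \<kappa>' then fps_X else 0)"
  by (auto simp: vr_def)

lemma res_nth_0: "res \<kappa> f $ 0 = f $ 0 $ 0"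
  by (auto simp: res_def)

lemma vr_True: "vr True = fps_X"
  by (auto simp: vr_def emb_def fps_eq_iff fps_X_def)

lemma vr_False: "vr False = fps_const fps_X"
  by (auto simp: vr_def emb_def)

lemma emb_eq_0_iff [simp]: "emb \<kappa> p = 0 \<longleftrightarrow> p = 0"
  by (metis emb_0 res_emb)

lemma vr_neq_0 [simp]: "vr \<kappa> \<noteq> 0"
  by (simp add: vr_def)

lemma res_eq_0D:
  assumes "res \<kappa> g = 0"
  obtains q where "g = vr (\<not> \<kappa>) * q"
proof (cases \<kappa>)
  case True
  have "g = vr False * Abs_fps (\<lambda>n. fps_shift 1 (g $ n))"
  proof (rule fps_ext)
    fix n
    have "g $ n $ 0 = 0"
      using assms True by (auto simp: res_def fps_eq_iff)
    then have "g $ n = fps_X * fps_shift 1 (g $ n)"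
      by (auto simp: fps_eq_iff)
    then show "g $ n = (vr False * Abs_fps (\<lambda>n. fps_shift 1 (g $ n))) $ n"
      by (simp add: vr_False)
  qed
  then show ?thesis using that True by simp
next
  case False
  have "g = vr True * fps_shift 1 g"
    using assms False by (auto simp: vr_True fps_eq_iff res_def)
  then show ?thesis using that False by simp
qed

lemma unit_ps2:
  assumes "f $ 0 $ 0 \<noteq> (0::'k::field)"
  obtains g where "f * g = (1 :: 'k ps2)"
proof -
  have "f $ 0 * inverse (f $ 0) = 1"
    using assms by (simp add: inverse_mult_eq_1')
  then have "f * fps_right_inverse f (inverse (f $ 0)) = 1"
    by (rule fps_right_inverse)
  then show ?thesis using that by blast
qed

lemma fps_X_power_unit_factor:
  assumes "(p :: 'k::field fps) \<noteq> 0"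
  obtains a where "p = fps_X ^ subdegree p * a" "a $ 0 \<noteq> 0"
proof -
  have "p = fps_X ^ subdegree p * unit_factor p"
    by (metis fps_unit_factor_decompose mult.commute)
  moreover have "unit_factor p $ 0 \<noteq> 0"
    using assms by simp
  ultimately show ?thesis using that by blast
qed

text \<open>Rank-one reflexive modules over the regular local ring of dimension two are free. The
  generator is an element of least order in the outer variable \<open>X\<close> whose lowest coefficient has
  least order; saturation makes every other element a multiple of it modulo \<open>X\<close> times the ideal,
  and the quotients are assembled into a power series. This avoids unique factorization.\<close>

lemma saturated_ideal_principal:
  fixes L :: "'k::field ps2 set"
  assumes nz: "f0 \<in> L" "f0 \<noteq> 0"
    and add: "\<And>f g. f \<in> L \<Longrightarrow> g \<in> L \<Longrightarrow> f + g \<in> L"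
    and mult: "\<And>f g. f \<in> L \<Longrightarrow> g * f \<in> L"
    and sat: "\<And>f. vr False * f \<in> L \<Longrightarrow> vr True * f \<in> L \<Longrightarrow> f \<in> L"
  obtains h where "h \<noteq> 0" "L = range (\<lambda>a. h * a)"
proof -
  have minus: "f - g \<in> L" if "f \<in> L" "g \<in> L" for f g
    using add[OF that(1) mult[OF that(2), of "- 1"]] by simp
  obtain f1 where f1: "f1 \<in> L \<and> f1 \<noteq> 0" "\<And>g. g \<in> L \<and> g \<noteq> 0 \<Longrightarrow> subdegree f1 \<le> subdegree g"
    using ex_has_least_nat[of "\<lambda>f. f \<in> L \<and> f \<noteq> 0" f0 subdegree] nz by blast
  define d where "d = subdegree f1"
  have d: "\<exists>g'. g = fps_X ^ d * g'" if "g \<in> L" for g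
  proof (cases "g = 0")
    case False
    then have "d \<le> subdegree g" using f1(2) that d_def by blast
    then have "g = fps_X ^ d * fps_shift d g"
      by (metis fps_shift_times_fps_X_power mult.commute)
    then show ?thesis by blast
  qed (auto intro: exI[of _ 0])
  obtain f where f: "f \<in> L \<and> f $ d \<noteq> 0"
    "\<And>g. g \<in> L \<and> g $ d \<noteq> 0 \<Longrightarrow> subdegree (f $ d) \<le> subdegree (g $ d)"
    using ex_has_least_nat[of "\<lambda>f. f \<in> L \<and> f $ d \<noteq> 0" f1 "\<lambda>f. subdegree (f $ d)"] f1
    by (auto simp: d_def)
  define n where "n = subdegree (f $ d)"
  obtain f' where f': "f = fps_X ^ d * f'" using d f by blast
  have f'0: "f' $ 0 = f $ d" by (simp add: f' fps_X_power_mult_nth)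
  have step: "\<exists>q g1. g1 \<in> L \<and> g = fps_const q * f + fps_X * g1" if g: "g \<in> L" for g
  proof -
    obtain g' where g': "g = fps_X ^ d * g'" using d g by blast
    have g'0: "g' $ 0 = g $ d" by (simp add: g' fps_X_power_mult_nth)
    have "f $ d dvd g $ d"
    proof (cases "g $ d = 0")
      case False
      with f g have "n \<le> subdegree (g $ d)" by (simp add: n_def)
      then show ?thesis
        using f False unfolding n_def by (metis fps_dvd_iff)
    qed simp
    then obtain q where q: "g $ d = f $ d * q" by blast
    have "(g' - fps_const q * f') $ 0 = 0"
      by (simp add: g'0 f'0 q mult.commute)
    then have "g' - fps_const q * f' = fps_X * fps_shift 1 (g' - fps_const q * f')"
      by (auto simp: fps_eq_iff)
    then obtain g'' where g'': "g' - fps_const q * f' = fps_X * g''" by blast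
    define G where "G = fps_X ^ d * g''"
    have eq: "g - fps_const q * f = fps_X * G"
    proof -
      have "g - fps_const q * f = fps_X ^ d * (g' - fps_const q * f')"
        by (simp add: f' g' algebra_simps)
      then show ?thesis unfolding g'' G_def by (simp add: mult.left_commute)
    qed
    then have XG: "fps_X * G \<in> L"
      by (metis minus mult g f(1))
    \<comment> \<open>Both \<open>f\<close> and \<open>G\<close> carry the factor
      \<open>X^d\<close>, so \<open>f'\<close> can stand in for \<open>f\<close>. Reducing
      \<open>f'\<close> to its lowest coefficient costs only multiples of \<open>X G\<close>, and
      that coefficient is a unit times \<open>x^n\<close>, with \<open>x\<close> the inner variable.
      It remains to descend from \<open>x^n G\<close> to \<open>G\<close>.\<close>
    have "f' * G = g'' * f" by (simp add: G_def f' algebra_simps)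
    then have f'G: "f' * G \<in> L" using mult f by simp
    have "f' = fps_const (f' $ 0) + fps_X * fps_shift 1 f'"
      by (auto simp: fps_eq_iff)
    then have "f' * G = (fps_const (f' $ 0) + fps_X * fps_shift 1 f') * G"
      by (rule arg_cong)
    also have "\<dots> = fps_const (f' $ 0) * G + fps_shift 1 f' * (fps_X * G)"
      by (simp only: distrib_right mult.assoc mult.left_commute)
    finally have "fps_const (f' $ 0) * G = f' * G - fps_shift 1 f' * (fps_X * G)"
      by (simp only: add_diff_cancel_right')
    then have "fps_const (f $ d) * G \<in> L"
      using minus[OF f'G mult[OF XG], of "fps_shift 1 f'"] by (simp only: f'0)
    moreover obtain a where a: "f $ d = fps_X ^ n * a" "a $ 0 \<noteq> 0"
      using fps_X_power_unit_factor f n_def by metis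
    have "fps_X ^ n = inverse a * (f $ d)"
      using a by (simp add: inverse_mult_eq_1 mult.assoc mult.left_commute)
    then have "fps_const (fps_X ^ n) * G = fps_const (inverse a) * (fps_const (f $ d) * G)"
      by (simp add: mult.assoc[symmetric])
    ultimately have "fps_const (fps_X ^ n) * G \<in> L"
      using mult by metis
    then have "vr False ^ n * G \<in> L"
      by (simp add: vr_False)
    \<comment> \<open>Membership of \<open>X G\<close> in \<open>L\<close> supplies the second half
      of the saturation hypothesis at every stage, so the powers of the inner variable are stripped
      one at a time.\<close>
    moreover have "vr False ^ m * G \<in> L \<Longrightarrow> G \<in> L" for m
    proof (induction m)
      case (Suc m)
      have "vr True * (vr False ^ m * G) \<in> L"
        using mult[OF XG, of "vr False ^ m"] by (simp only: vr_True mult.left_commute)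
      moreover have "vr False * (vr False ^ m * G) \<in> L"
        using Suc.prems by (simp only: power_Suc mult.assoc)
      ultimately have "vr False ^ m * G \<in> L"
        using sat by blast
      then show ?case by (rule Suc.IH)
    qed simp
    ultimately have "G \<in> L" by blast
    then show ?thesis using eq by (metis add.commute diff_add_cancel)
  qed
  have "\<exists>a. g = f * a" if g: "g \<in> L" for g
  proof -
    from step obtain Q N where QN: "\<And>g. g \<in> L \<Longrightarrow> N g \<in> L \<and> g = fps_const (Q g) * f + fps_X * N g"
      by metis
    define s where "s i = (N ^^ i) g" for i
    have s: "s i \<in> L" for i by (induction i) (auto simp: s_def g QN)
    have ss: "s i = fps_const (Q (s i)) * f + fps_X * s (Suc i)" for i
      using QN[OF s[of i]] by (simp add: s_def)
    \<comment> \<open>The \<open>Q (s i)\<close> are the successive digits of the quotient, and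
      \<open>P i\<close> is the series of the digits from place \<open>i\<close> on. The remainder
      \<open>D i\<close> is divisible by every power of the outer variable, hence zero.\<close>
    define P where "P i = Abs_fps (\<lambda>k. Q (s (i + k)))" for i
    have P: "P i = fps_const (Q (s i)) + fps_X * P (Suc i)" for i
      by (rule fps_ext) (simp add: P_def)
    define D where "D i = s i - P i * f" for i
    have D: "D i = fps_X * D (Suc i)" for i
    proof -
      have "D i = fps_const (Q (s i)) * f + fps_X * s (Suc i) - (fps_const (Q (s i)) + fps_X * P (Suc i)) * f"
        unfolding D_def using ss[of i] P[of i] by (rule arg_cong2[where f = "\<lambda>a b. a - b * f"])
      also have "\<dots> = fps_X * (s (Suc i) - P (Suc i) * f)"
        by (simp add: algebra_simps)
      finally show ?thesis by (simp only: D_def)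
    qed
    have "D i $ k = 0" for i k
    proof (induction k arbitrary: i)
      case 0 show ?case by (metis D fps_X_mult_nth)
    next
      case (Suc k) show ?case by (metis D Suc fps_X_mult_nth diff_Suc_1 nat.distinct(1))
    qed
    then have "D 0 = 0" by (simp add: fps_eq_iff)
    then have "g = f * P 0" by (simp add: D_def s_def mult.commute)
    then show ?thesis by blast
  qed
  then have "L \<subseteq> range (\<lambda>a. f * a)" by blast
  moreover have "f * a \<in> L" for a
    by (subst mult.commute) (use mult f in blast)
  ultimately have "L = range (\<lambda>a. f * a)" by blast
  moreover have "f \<noteq> 0" using f by auto
  ultimately show ?thesis using that by blast
qed


section \<open>The ring as a gluing of four components\<close>

text \<open>A component \<open>(i, o)\<close> has the inner variable \<open>x\<close> or \<open>y\<close> (\<open>i\<close> false or true) and the outer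
  variable \<open>u\<close> or \<open>v\<close> (\<open>o\<close> false or true). An axis is a pair \<open>(\<kappa>, t)\<close>: the axes of \<open>x\<close>, \<open>y\<close> have
  \<open>\<kappa>\<close> false and those of \<open>u\<close>, \<open>v\<close> have \<open>\<kappa>\<close> true. It lies on the two components \<open>cmp \<kappa> t s\<close>.\<close>

definition ax :: "bool \<Rightarrow> bool \<times> bool \<Rightarrow> bool" where
  "ax \<kappa> c = (if \<kappa> then snd c else fst c)"

definition cmp :: "bool \<Rightarrow> bool \<Rightarrow> bool \<Rightarrow> bool \<times> bool" where
  "cmp \<kappa> t s = (if \<kappa> then (s, t) else (t, s))"

lemma ax_cmp [simp]: "ax \<kappa> (cmp \<kappa> t s) = t" "ax (\<not> \<kappa>) (cmp \<kappa> t s) = s"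
  "ax \<kappa> (cmp (\<not> \<kappa>) t s) = s"
  by (auto simp: ax_def cmp_def)

lemma cmp_ax [simp]: "cmp \<kappa> (ax \<kappa> c) (ax (\<not> \<kappa>) c) = c" "cmp \<kappa> t s = cmp \<kappa> t' s' \<longleftrightarrow> t = t' \<and> s = s'"
  by (auto simp: ax_def cmp_def)

lemma not_eq_cmp [simp]: "\<kappa>' \<noteq> \<kappa> \<Longrightarrow> ax \<kappa> (cmp \<kappa>' t s) = s"
  by (auto simp: ax_def cmp_def)

text \<open>Cross multiplication expresses the proportion without division, so a common nonzero
  factor of the two weights on an axis has no effect. With all weights 1 the set is the image of
  \<open>A\<close> in its normalization.\<close>

definition glue :: "(bool \<Rightarrow> bool \<Rightarrow> bool \<Rightarrow> 'k::field fps) \<Rightarrow> (bool \<times> bool \<Rightarrow> 'k ps2) set" where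
  "glue w = {f. \<forall>\<kappa> t. res \<kappa> (f (cmp \<kappa> t False)) * w \<kappa> t True = res \<kappa> (f (cmp \<kappa> t True)) * w \<kappa> t False}"

lemma glueD: "f \<in> glue w \<Longrightarrow> res \<kappa> (f (cmp \<kappa> t s)) * w \<kappa> t (\<not> s) = res \<kappa> (f (cmp \<kappa> t (\<not> s))) * w \<kappa> t s"
  by (cases s) (auto simp: glue_def)

lemma glue_1_iff: "f \<in> glue 1 \<longleftrightarrow> (\<forall>\<kappa> t s. res \<kappa> (f (cmp \<kappa> t s)) = res \<kappa> (f (cmp \<kappa> t False)))"
  unfolding glue_def by (simp add: all_bool_eq) metis

lemma glue_1D: "f \<in> glue 1 \<Longrightarrow> res \<kappa> (f (cmp \<kappa> t s)) = res \<kappa> (f (cmp \<kappa> t s'))"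
  by (metis glue_1_iff)

lemma glue_add: "f \<in> glue w \<Longrightarrow> g \<in> glue w \<Longrightarrow> f + g \<in> glue w"
  by (auto simp: glue_def algebra_simps)

lemma glue_diff: "f \<in> glue w \<Longrightarrow> g \<in> glue w \<Longrightarrow> f - g \<in> glue w"
  by (auto simp: glue_def algebra_simps fun_diff_def)

lemma glue_0: "0 \<in> glue w"
  by (auto simp: glue_def)

lemma glue_mult:
  assumes "a \<in> glue 1" "f \<in> glue w" shows "a * f \<in> glue w"
proof -
  have "res \<kappa> ((a * f) (cmp \<kappa> t False)) * w \<kappa> t True = res \<kappa> ((a * f) (cmp \<kappa> t True)) * w \<kappa> t False" for \<kappa> t
    using glue_1D[OF assms(1), of \<kappa> t False True] glueD[OF assms(2), of \<kappa> t False]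
    by (simp add: mult.assoc)
  then show ?thesis by (simp add: glue_def)
qed

section \<open>Quadruples supported on one component or along one axis\<close>

definition single :: "bool \<times> bool \<Rightarrow> 'k::field ps2 \<Rightarrow> bool \<times> bool \<Rightarrow> 'k ps2" where
  "single c g = (\<lambda>c'. if c' = c then g else 0)"

text \<open>Constant in the transversal variable, and zero on the two components that do not contain
  the axis. For the constant family \<open>fps_X\<close> this is the variable of the axis, viewed as
  an element of \<open>A\<close>.\<close>

definition axial :: "bool \<Rightarrow> bool \<Rightarrow> (bool \<Rightarrow> 'k::field fps) \<Rightarrow> bool \<times> bool \<Rightarrow> 'k ps2" where
  "axial \<kappa> t p = (\<lambda>c. if ax \<kappa> c = t then emb \<kappa> (p (ax (\<not> \<kappa>) c)) else 0)"

text \<open>It generates the ideal of the series vanishing on both axes of a component, which is the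
  conductor of \<open>A\<close> on that component: its multiples, extended by zero, satisfy every
  gluing condition.\<close>

abbreviation edge :: "'k::field ps2" where
  "edge \<equiv> vr False * vr True"

lemma res_edge [simp]: "res \<kappa> edge = 0"
  by (cases \<kappa>) auto

lemma edge_neq_0 [simp]: "edge \<noteq> (0::'k::field ps2)"
  by simp

lemma single_edge_glue: "single c (edge * g) \<in> glue w"
  by (auto simp: glue_def single_def)

text \<open>On a transversal axis the restriction is the constant \<open>p s $ 0\<close>, which has
  to match the zero on the neighbouring component. This is why weights are kept divisible by the
  variable.\<close>

lemma res_axial:
  assumes "\<And>s. p s $ 0 = 0"
  shows "res \<kappa>' (axial \<kappa> t p (cmp \<kappa>' t' s)) = (if \<kappa>' = \<kappa> \<and> t' = t then p s else 0)"
  using assms by (cases "\<kappa>' = \<kappa>") (auto simp: axial_def)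

lemma axial_glue:
  assumes "\<And>s. p s $ 0 = 0" "p False * w \<kappa> t True = p True * w \<kappa> t False"
  shows "axial \<kappa> t p \<in> glue w"
  using assms by (auto simp: glue_def res_axial)

text \<open>One variable of each pair is set to zero: \<open>res\<close> acts on the outer pair
  \<open>u\<close>, \<open>v\<close> and then coefficientwise on the inner pair \<open>x\<close>,
  \<open>y\<close>. The surviving inner variable is \<open>x\<close> or \<open>y\<close>, the outer
  one \<open>u\<close> or \<open>v\<close>.\<close>

definition comps :: "'k::field ps4 \<Rightarrow> bool \<times> bool \<Rightarrow> 'k ps2" where
  "comps f c = Abs_fps (\<lambda>n. res (fst c) (res (snd c) f $ n))"

lemma res_sum: "res \<kappa> (sum f S) = (\<Sum>i\<in>S. res \<kappa> (f i))"
  by (induction S rule: infinite_finite_induct) auto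

lemma comps_add: "comps (f + g) = comps f + comps g"
  by (rule ext) (auto simp: comps_def fps_eq_iff)

lemma comps_diff: "comps (f - g) = comps f - comps g"
  by (rule ext) (auto simp: comps_def fps_eq_iff fun_diff_def)

lemma comps_mult: "comps (f * g) = comps f * comps g"
  by (rule ext) (auto simp: comps_def fps_eq_iff fps_mult_nth[of "Abs_fps _"] fps_mult_nth[of "res (_::bool) (_::'a fps fps fps fps)"] res_sum)

lemma comps_0: "comps 0 = 0"
  by (rule ext) (auto simp: comps_def fps_eq_iff)

lemma comps_uminus: "comps (- f) = - comps f"
  by (metis comps_add comps_0 add_eq_0_iff2 add.left_inverse)

lemma comps_1: "comps 1 = 1"
  by (rule ext) (auto simp: comps_def fps_eq_iff)

lemma comps_power: "comps (f ^ n) = comps f ^ n"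
  by (induction n) (auto simp: comps_1 comps_mult)

lemma comps_var:
  "comps ps_x c = (if fst c then 0 else vr False)"
  "comps ps_y c = (if fst c then vr False else 0)"
  "comps ps_u c = (if snd c then 0 else vr True)"
  "comps ps_v c = (if snd c then vr True else 0)"
  by (auto simp: comps_def res_def ps_x_def ps_y_def ps_u_def ps_v_def vr_True vr_False fps_eq_iff fps_X_def)

lemma comps_const: "comps (ps_const l) c = fps_const (fps_const l)"
  by (auto simp: comps_def res_def ps_const_def fps_eq_iff)

lemma comps_nth: "comps f (False, False) $ n $ m = f $ 0 $ n $ 0 $ m"
  "comps f (True, False) $ n $ m = f $ 0 $ n $ m $ 0"
  "comps f (False, True) $ n $ m = f $ n $ 0 $ 0 $ m"
  "comps f (True, True) $ n $ m = f $ n $ 0 $ m $ 0"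
  by (auto simp: comps_def res_def)

lemma comps_in_glue: "comps f \<in> glue 1"
  by (auto simp: glue_def cmp_def all_bool_eq res_def fps_eq_iff comps_nth)

lemma comps_surj:
  assumes "h \<in> glue 1"
  obtains f where "comps f = h"
proof -
  \<comment> \<open>The indices \<open>l\<close>, \<open>k\<close>, \<open>j\<close>,
    \<open>i\<close> belong to \<open>v\<close>, \<open>u\<close>, \<open>y\<close>,
    \<open>x\<close>. Monomials on an axis are claimed by several branches, whose values agree by
    the gluing condition; monomials divisible by \<open>x y\<close> or \<open>u v\<close> get
    coefficient zero.\<close>
  define f :: "'a ps4" where "f = Abs_fps (\<lambda>l. Abs_fps (\<lambda>k. Abs_fps (\<lambda>j. Abs_fps (\<lambda>i.
     if l = 0 \<and> j = 0 then h (False, False) $ k $ i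
     else if l = 0 \<and> i = 0 then h (True, False) $ k $ j
     else if k = 0 \<and> j = 0 then h (False, True) $ l $ i
     else if k = 0 \<and> i = 0 then h (True, True) $ l $ j else 0))))"
  have *: "h (False, False) $ 0 $ m = h (False, True) $ 0 $ m" 
      "h (True, False) $ 0 $ m = h (True, True) $ 0 $ m"
      "h (False, False) $ m $ 0 = h (True, False) $ m $ 0" 
      "h (False, True) $ m $ 0 = h (True, True) $ m $ 0" for m
    using assms by (auto simp: glue_def cmp_def all_bool_eq res_def fps_eq_iff)
  have "comps f = h"
  proof (rule ext, rule fps_ext, rule fps_ext)
    fix c n m
    show "comps f c $ n $ m = h c $ n $ m"
      by (cases c; cases "fst c"; cases "snd c"; cases "n = 0"; cases "m = 0") (simp_all add: comps_nth f_def *)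
  qed
  then show ?thesis using that by blast
qed

lemma comps_eq_0D:
  assumes "comps f = 0"
  obtains g h where "f = (ps_x * ps_y) * g + (ps_u * ps_v) * h"
proof -
  have 0: "f $ 0 $ n $ 0 $ m = 0" "f $ 0 $ n $ m $ 0 = 0" "f $ n $ 0 $ 0 $ m = 0" "f $ n $ 0 $ m $ 0 = 0" for n m
    by (metis assms comps_nth zero_fun_apply fps_zero_nth)+
  \<comment> \<open>\<open>h\<close> absorbs all monomials divisible by \<open>u v\<close>. Of the
    others, those not divisible by \<open>x y\<close> survive on some component and therefore have
    coefficient zero; the rest go into \<open>g\<close>.\<close>
  define h where "h = Abs_fps (\<lambda>l. Abs_fps (\<lambda>k. f $ Suc l $ Suc k))"
  define g where "g = Abs_fps (\<lambda>l. Abs_fps (\<lambda>k. Abs_fps (\<lambda>j. Abs_fps (\<lambda>i.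
     if l = 0 \<or> k = 0 then f $ l $ k $ Suc j $ Suc i else 0))))"
  have "f = (ps_x * ps_y) * g + (ps_u * ps_v) * h"
  proof ((rule fps_ext)+)
    fix l k j i
    show "f $ l $ k $ j $ i = ((ps_x * ps_y) * g + (ps_u * ps_v) * h) $ l $ k $ j $ i"
      by (cases l; cases k; cases j; cases i)
        (simp_all add: ps_x_def ps_y_def ps_u_def ps_v_def g_def h_def 0 mult.assoc)
  qed
  then show ?thesis using that by blast
qed

section \<open>Units and the maximal ideal of the power series ring\<close>

lemma ps4_max_ideal:
  fixes f :: "'k::field ps4"
  assumes "f $ 0 $ 0 $ 0 $ 0 = 0"
  obtains a b c d where "f = ps_x * a + ps_y * b + ps_u * c + ps_v * d"
proof -
  have s: "g = fps_const (g $ 0) + fps_X * fps_shift 1 g" for g :: "'b::comm_ring_1 fps"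
    by (auto simp: fps_eq_iff)
  have "f $ 0 $ 0 $ 0 = fps_X * fps_shift 1 (f $ 0 $ 0 $ 0)"
    using s[of "f $ 0 $ 0 $ 0"] assms by simp
  then have "f = fps_const (fps_const (fps_const (fps_X * fps_shift 1 (f $ 0 $ 0 $ 0)) + fps_X * fps_shift 1 (f $ 0 $ 0))
     + fps_X * fps_shift 1 (f $ 0)) + fps_X * fps_shift 1 f"
    using s by metis
  also have "\<dots> = ps_x * fps_const (fps_const (fps_const (fps_shift 1 (f $ 0 $ 0 $ 0)))) + ps_y * fps_const (fps_const (fps_shift 1 (f $ 0 $ 0)))
      + ps_u * fps_const (fps_shift 1 (f $ 0)) + ps_v * fps_shift 1 f"
    by (simp add: ps_x_def ps_y_def ps_u_def ps_v_def flip: fps_const_add fps_const_mult)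
  finally show ?thesis using that by blast
qed

lemma ps4_unit:
  fixes f :: "'k::field ps4"
  assumes "f $ 0 $ 0 $ 0 $ 0 \<noteq> 0"
  obtains g where "f * g = 1"
proof -
  have "f $ 0 $ 0 $ 0 * inverse (f $ 0 $ 0 $ 0) = 1"
    using assms by (simp add: inverse_mult_eq_1')
  then obtain g where "f $ 0 $ 0 * g = 1"
    using fps_right_inverse by blast
  then obtain g where "f $ 0 * g = 1"
    using fps_right_inverse by blast
  then obtain g where "f * g = 1"
    using fps_right_inverse by blast
  then show ?thesis using that by blast
qed

section \<open>The quotient ring and its embedding into the normalization\<close>

interpretation psr: cring "ps_ring :: 'k::field ps4 ring"
  by (rule cringI; (rule abelian_groupI comm_monoidI)?)
    (auto simp: ps_ring_def algebra_simps intro: exI[of _ "- _"])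

lemma ps_ring_a_inv: "\<ominus>\<^bsub>ps_ring\<^esub> f = - (f :: 'k::field ps4)"
  by (rule psr.minus_equality) (auto simp: ps_ring_def)

lemma rel_ideal_eq: "rel_ideal = {f :: 'k::field ps4. comps f = 0}"
proof
  have "ideal {f :: 'k ps4. comps f = 0} ps_ring"
    by (rule idealI[OF psr.ring_axioms]; (rule psr.add.subgroupI)?)
      (auto simp: ps_ring_a_inv comps_uminus comps_0 simp flip: a_inv_def intro: exI[of _ 0],
       auto simp: ps_ring_def comps_add comps_mult)
  then show "rel_ideal \<subseteq> {f :: 'k ps4. comps f = 0}"
    unfolding rel_ideal_def
    by (rule psr.genideal_minimal) (auto simp: comps_mult comps_var fun_eq_iff)
  interpret I: ideal "rel_ideal :: 'k ps4 set" ps_ring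
    unfolding rel_ideal_def by (rule psr.genideal_ideal) (simp add: ps_ring_def)
  have "ps_x * ps_y \<in> (rel_ideal :: 'k ps4 set)" "ps_u * ps_v \<in> (rel_ideal :: 'k ps4 set)"
    using psr.genideal_self[of "{ps_x * ps_y, ps_u * ps_v}"] by (auto simp: rel_ideal_def ps_ring_def)
  then have "(ps_x * ps_y) * g + (ps_u * ps_v) * h \<in> (rel_ideal :: 'k ps4 set)" for g h
    using I.a_closed I.I_r_closed by (simp add: ps_ring_def)
  then show "{f :: 'k ps4. comps f = 0} \<subseteq> rel_ideal"
    using comps_eq_0D by (metis (mono_tags, lifting) mem_Collect_eq subsetI)
qed

lemma rel_ideal_ideal: "ideal (rel_ideal :: 'k::field ps4 set) ps_ring"
  unfolding rel_ideal_def by (rule psr.genideal_ideal) (simp add: ps_ring_def)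

interpretation A: cring "ringA :: 'k::field ps4 set ring"
  unfolding ringA_def by (rule ideal.quotient_is_cring[OF rel_ideal_ideal psr.cring_axioms])

lemma toA_eq: "toA f = {g. comps g = comps f}"
proof -
  have "toA f = {h + f |h. comps h = 0}"
    by (auto simp: toA_def a_r_coset_def r_coset_def rel_ideal_eq ps_ring_def)
  also have "\<dots> = {g. comps g = comps f}"
    by (auto simp: comps_add intro!: exI[of _ "_ - f"] simp: comps_diff)
  finally show ?thesis .
qed

lemma carrier_ringA: "carrier ringA = range toA"
  by (auto simp: ringA_def FactRing_def A_RCOSETS_def' toA_def ps_ring_def)

lemma toA_hom:
  "toA (f :: 'k::field ps4) \<otimes>\<^bsub>ringA\<^esub> toA g = toA (f * g)"
  "toA f \<oplus>\<^bsub>ringA\<^esub> toA g = toA (f + g)"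
  "\<one>\<^bsub>ringA\<^esub> = toA (1 :: 'k ps4)" "\<zero>\<^bsub>ringA\<^esub> = toA (0 :: 'k ps4)"
proof -
  interpret I: ideal "rel_ideal :: 'k ps4 set" ps_ring by (rule rel_ideal_ideal)
  interpret h: ring_hom_ring "ps_ring :: 'k ps4 ring" ringA "toA"
    unfolding ringA_def toA_def[abs_def] by (rule I.rcos_ring_hom_ring)
  fix f g :: "'k ps4"
  show "toA f \<otimes>\<^bsub>ringA\<^esub> toA g = toA (f * g)"
    using h.hom_mult[of f g] by (simp add: ps_ring_def)
  show "toA f \<oplus>\<^bsub>ringA\<^esub> toA g = toA (f + g)"
    using h.hom_add[of f g] by (simp add: ps_ring_def)
  show "\<one>\<^bsub>ringA\<^esub> = toA (1 :: 'k ps4)"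
    using h.hom_one by (simp add: ps_ring_def)
  show "\<zero>\<^bsub>ringA\<^esub> = toA (0 :: 'k ps4)"
    using h.hom_zero by (simp add: ps_ring_def)
qed

text \<open>An element of the quotient is a coset, on which \<open>comps\<close> is constant by
  \<open>toA_eq\<close>. The map is the inclusion of \<open>A\<close> into its
  normalization.\<close>

definition rho :: "'k::field ps4 set \<Rightarrow> bool \<times> bool \<Rightarrow> 'k ps2" where
  "rho a = the_elem (comps ` a)"

lemma rho_toA [simp]: "rho (toA f) = comps f"
proof -
  have "comps ` toA f = {comps f}" by (auto simp: toA_eq)
  then show ?thesis by (simp add: rho_def)
qed

lemma toA_closed [simp]: "toA f \<in> carrier ringA"
  by (simp add: carrier_ringA)

lemma rho_inj: "a \<in> carrier ringA \<Longrightarrow> b \<in> carrier ringA \<Longrightarrow> rho a = rho b \<Longrightarrow> a = b"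
  unfolding carrier_ringA by (elim imageE) (hypsubst, simp, simp add: toA_eq)

lemma rho_hom [simp]:
  "a \<in> carrier ringA \<Longrightarrow> b \<in> carrier ringA \<Longrightarrow> rho (a \<otimes>\<^bsub>ringA\<^esub> b) = rho a * rho b"
  "a \<in> carrier ringA \<Longrightarrow> b \<in> carrier ringA \<Longrightarrow> rho (a \<oplus>\<^bsub>ringA\<^esub> b) = rho a + rho b"
  "rho \<one>\<^bsub>ringA\<^esub> = 1" "rho \<zero>\<^bsub>ringA\<^esub> = 0"
  by (auto simp: carrier_ringA toA_hom comps_mult comps_add comps_0 comps_1)

lemma rho_minus [simp]: "a \<in> carrier ringA \<Longrightarrow> rho (\<ominus>\<^bsub>ringA\<^esub> a) = - rho a"
  by (metis A.a_inv_closed A.l_neg add_eq_0_iff2 rho_hom(2,4))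

lemma rho_glue: "a \<in> carrier ringA \<Longrightarrow> rho a \<in> glue 1"
  by (auto simp: carrier_ringA comps_in_glue)

lemma rho_surj:
  assumes "h \<in> glue 1"
  obtains a where "a \<in> carrier ringA" "rho a = h"
  using comps_surj[OF assms] rho_toA toA_closed by metis

text \<open>Depth supplies arbitrary nonunits, whereas saturation is tested on the four variables;
  the second clause mediates by writing a nonunit as a combination of the variables. Both clauses
  rest on the constant term of a representative, which would make it invertible if it were
  nonzero.\<close>

lemma nonunit_ringA:
  assumes "a \<in> carrier ringA - Units ringA"
  shows "rho a c $ 0 $ 0 = 0"
    "\<exists>b. (\<forall>\<kappa> t. b \<kappa> t \<in> glue 1) \<and> rho a = (\<Sum>\<kappa>\<in>UNIV. \<Sum>t\<in>UNIV. axial \<kappa> t (\<lambda>_. fps_X) * b \<kappa> t)"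
proof -
  obtain f where f: "a = toA f" using assms by (auto simp: carrier_ringA)
  have f0: "f $ 0 $ 0 $ 0 $ 0 = 0"
  proof (rule ccontr)
    assume "\<not> ?thesis"
    then obtain g where "f * g = 1" by (rule ps4_unit)
    then have "a \<in> Units ringA"
      unfolding f Units_def by (auto simp: toA_hom mult.commute intro!: bexI[of _ "toA g"])
    with assms show False by blast
  qed
  show "rho a c $ 0 $ 0 = 0"
    by (cases c; cases "fst c"; cases "snd c") (simp_all add: f comps_nth f0)
  obtain p q r s where f': "f = ps_x * p + ps_y * q + ps_u * r + ps_v * s"
    using ps4_max_ideal[OF f0] .
  define b where "b \<kappa> t = comps (if \<kappa> then (if t then s else r) else (if t then q else p))" for \<kappa> t
  have "rho a = (\<Sum>\<kappa>\<in>UNIV. \<Sum>t\<in>UNIV. axial \<kappa> t (\<lambda>_. fps_X) * b \<kappa> t)"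
  proof
    fix c
    have e: "emb \<kappa> fps_X = (vr \<kappa> :: 'a ps2)" for \<kappa> by (simp add: vr_def)
    show "rho a c = (\<Sum>\<kappa>\<in>UNIV. \<Sum>t\<in>UNIV. axial \<kappa> t (\<lambda>_. fps_X) * b \<kappa> t) c"
      unfolding f f' rho_toA
      by (cases "fst c"; cases "snd c")
        (simp_all add: comps_add comps_mult comps_var UNIV_bool b_def axial_def ax_def e)
  qed
  then show "\<exists>b. (\<forall>\<kappa> t. b \<kappa> t \<in> glue 1) \<and> rho a = (\<Sum>\<kappa>\<in>UNIV. \<Sum>t\<in>UNIV. axial \<kappa> t (\<lambda>_. fps_X) * b \<kappa> t)"
  proof (intro exI conjI allI)
    show "b \<kappa> t \<in> glue 1" for \<kappa> t by (simp add: b_def comps_in_glue)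
  qed
qed


section \<open>Duals of glued modules\<close>

text \<open>Nonzero weights can be cancelled, and the zero constant terms place
  \<open>axial \<kappa> t (w \<kappa> t)\<close> in \<open>glue w\<close>.\<close>

definition good_weight :: "(bool \<Rightarrow> bool \<Rightarrow> bool \<Rightarrow> 'k::field fps) \<Rightarrow> bool" where
  "good_weight w \<longleftrightarrow> (\<forall>\<kappa> t s. w \<kappa> t s \<noteq> 0 \<and> w \<kappa> t s $ 0 = 0)"

definition swap_weight :: "(bool \<Rightarrow> bool \<Rightarrow> bool \<Rightarrow> 'k::field fps) \<Rightarrow> bool \<Rightarrow> bool \<Rightarrow> bool \<Rightarrow> 'k fps" where
  "swap_weight w = (\<lambda>\<kappa> t s. w \<kappa> t (\<not> s))"

lemma swap_swap [simp]: "swap_weight (swap_weight w) = w"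
  by (simp add: swap_weight_def)

lemma good_weight_swap: "good_weight w \<Longrightarrow> good_weight (swap_weight w)"
  by (simp add: good_weight_def swap_weight_def)

lemma single_times [simp]: "single c g * f = single c (g * f c)" "f * single c g = single c (f c * g)"
  by (auto simp: single_def)

lemma single_same [simp]: "single c g c = g"
  by (simp add: single_def)

lemma single_in_A: obtains a where "a \<in> carrier ringA" "rho a = single c edge"
  using rho_surj[of "single c edge"] single_edge_glue[of c 1 1] by (metis mult.right_neutral)

text \<open>The projection of \<open>A\<close> to a component is onto: \<open>g\<close> is continued
  constantly across each of its two axes, and by its constant term to the opposite
  component.\<close>

lemma rho_lift:
  obtains a where "a \<in> carrier ringA" "rho a c = g"
proof -
  define h where "h c' = (if c' = c then g else if fst c' = fst c then emb False (res False g)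
     else if snd c' = snd c then emb True (res True g) else fps_const (fps_const (g $ 0 $ 0)))" for c'
  have "res \<kappa> (h (cmp \<kappa> t False)) = res \<kappa> (h (cmp \<kappa> t True))" for \<kappa> t
    by (cases c; cases \<kappa>; cases t; cases "fst c"; cases "snd c")
      (auto simp: h_def cmp_def res_nth_0 res_def fps_eq_iff emb_def)
  then have "h \<in> glue 1" by (simp add: glue_def)
  from rho_surj[OF this] obtain a where "a \<in> carrier ringA" "rho a = h" .
  then show ?thesis using that by (simp add: h_def)
qed

lemma edge_dvd:
  assumes "\<And>\<kappa>. res \<kappa> g = 0"
  obtains q where "g = edge * q"
proof -
  obtain r where r: "g = vr True * r" using res_eq_0D[of False g] assms by auto
  then have "res True r = 0" using assms[of True] by simp
  then obtain q where "r = vr False * q" using res_eq_0D[of True r] by auto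
  then show ?thesis using that[of q] r by (simp add: mult_ac)
qed

text \<open>The product of the two proportions is the claimed equality up to the factor
  \<open>w \<kappa> t False * w \<kappa> t True\<close>, which cancels.\<close>

lemma glue_dual_mult:
  assumes "good_weight w" "p \<in> glue (swap_weight w)" "f \<in> glue w"
  shows "p * f \<in> glue 1"
proof -
  have "res \<kappa> (p (cmp \<kappa> t False)) * res \<kappa> (f (cmp \<kappa> t False)) = res \<kappa> (p (cmp \<kappa> t True)) * res \<kappa> (f (cmp \<kappa> t True))" for \<kappa> t
  proof -
    let ?p = "\<lambda>s. res \<kappa> (p (cmp \<kappa> t s))" and ?f = "\<lambda>s. res \<kappa> (f (cmp \<kappa> t s))"
    have p: "?p False * w \<kappa> t False = ?p True * w \<kappa> t True"
      using glueD[OF assms(2), of \<kappa> t False] by (simp add: swap_weight_def)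
    have f: "?f False * w \<kappa> t True = ?f True * w \<kappa> t False"
      using glueD[OF assms(3), of \<kappa> t False] by simp
    have "?p False * ?f False * (w \<kappa> t False * w \<kappa> t True) = (?p False * w \<kappa> t False) * (?f False * w \<kappa> t True)"
      by (simp add: mult_ac)
    also have "\<dots> = ?p True * ?f True * (w \<kappa> t False * w \<kappa> t True)"
      unfolding p f by (simp add: mult_ac)
    finally show ?thesis using assms(1) by (simp add: good_weight_def)
  qed
  then show ?thesis by (simp add: glue_def)
qed

text \<open>The map \<open>j\<close> identifies \<open>M\<close> with a submodule of the normalization of \<open>A\<close> lying between a
  small submodule and the module \<open>glue w\<close>; this forces the bidual of \<open>M\<close> to be \<open>glue w\<close>.\<close>

definition frac_rep :: "('k::field ps4 set, 'm, 'z) module_scheme \<Rightarrow> ('m \<Rightarrow> bool \<times> bool \<Rightarrow> 'k ps2)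
    \<Rightarrow> (bool \<Rightarrow> bool \<Rightarrow> bool \<Rightarrow> 'k fps) \<Rightarrow> bool" where
  "frac_rep M j w \<longleftrightarrow>
     (\<forall>x\<in>carrier M. \<forall>y\<in>carrier M. x \<oplus>\<^bsub>M\<^esub> y \<in> carrier M \<and> j (x \<oplus>\<^bsub>M\<^esub> y) = j x + j y) \<and>
     (\<forall>a\<in>carrier ringA. \<forall>x\<in>carrier M. a \<odot>\<^bsub>M\<^esub> x \<in> carrier M \<and> j (a \<odot>\<^bsub>M\<^esub> x) = rho a * j x) \<and>
     inj_on j (carrier M) \<and> j ` carrier M \<subseteq> glue w \<and>
     (\<forall>c. single c edge \<in> j ` carrier M) \<and> (\<forall>\<kappa> t. axial \<kappa> t (w \<kappa> t) \<in> j ` carrier M)"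

lemma frac_rep_single:
  assumes "frac_rep M j w" obtains e where "e \<in> carrier M" "j e = single c edge"
proof -
  have "single c edge \<in> j ` carrier M" using assms unfolding frac_rep_def by blast
  then obtain e where "single c edge = j e" "e \<in> carrier M" by (rule imageE)
  then show ?thesis using that by simp
qed

lemma frac_rep_axial:
  assumes "frac_rep M j w" obtains e where "e \<in> carrier M" "j e = axial \<kappa> t (w \<kappa> t)"
proof -
  have "axial \<kappa> t (w \<kappa> t) \<in> j ` carrier M" using assms unfolding frac_rep_def by blast
  then obtain e where "axial \<kappa> t (w \<kappa> t) = j e" "e \<in> carrier M" by (rule imageE)
  then show ?thesis using that by simp
qed

lemma frac_rep_add:
  assumes "frac_rep M j w" "x \<in> carrier M" "y \<in> carrier M"
  shows "x \<oplus>\<^bsub>M\<^esub> y \<in> carrier M" "j (x \<oplus>\<^bsub>M\<^esub> y) = j x + j y"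
  using assms by (simp_all add: frac_rep_def)

lemma frac_rep_smult:
  assumes "frac_rep M j w" "a \<in> carrier ringA" "x \<in> carrier M"
  shows "a \<odot>\<^bsub>M\<^esub> x \<in> carrier M" "j (a \<odot>\<^bsub>M\<^esub> x) = rho a * j x"
  using assms by (simp_all add: frac_rep_def)

lemma frac_rep_inj:
  assumes "frac_rep M j w" "j x = j y" "x \<in> carrier M" "y \<in> carrier M"
  shows "x = y"
  using assms by (simp add: frac_rep_def inj_on_def)

lemma frac_rep_glue:
  assumes "frac_rep M j w" "x \<in> carrier M"
  shows "j x \<in> glue w"
  using assms by (auto simp: frac_rep_def)

text \<open>On a component \<open>c\<close> the multiplier is \<open>\<phi> e c\<close> divided by
  \<open>edge\<close>, where \<open>e\<close> is the element represented by
  \<open>single c edge\<close>. Comparing \<open>\<phi> m\<close> with \<open>\<phi> e\<close> shows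
  that it works for every \<open>m\<close>; the axial elements show that the quotient
  exists.\<close>

lemma frac_rep_hom:
  fixes M :: "('k::field ps4 set, 'm, 'z) module_scheme"
  assumes w: "good_weight w" and M: "frac_rep M j w"
    and add: "\<And>x y. x \<in> carrier M \<Longrightarrow> y \<in> carrier M \<Longrightarrow> \<phi> (x \<oplus>\<^bsub>M\<^esub> y) = \<phi> x + \<phi> y"
    and smult: "\<And>a x. a \<in> carrier ringA \<Longrightarrow> x \<in> carrier M \<Longrightarrow> \<phi> (a \<odot>\<^bsub>M\<^esub> x) = rho a * \<phi> x"
  obtains p where "\<And>m. m \<in> carrier M \<Longrightarrow> \<phi> m = p * j m"
proof -
  have "\<exists>q. \<forall>m\<in>carrier M. \<phi> m c = q * j m c" for c
  proof -
    obtain e where e: "e \<in> carrier M" "j e = single c edge"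
      using M by (rule frac_rep_single)
    obtain \<epsilon> :: "'k ps4 set" where \<epsilon>: "\<epsilon> \<in> carrier ringA" "rho \<epsilon> = single c edge"
      by (rule single_in_A)
    \<comment> \<open>With \<open>a\<close> equal to \<open>j m c\<close> on the component
      \<open>c\<close>, both \<open>\<epsilon> m\<close> and \<open>a e\<close> are represented by
      \<open>single c (edge * j m c)\<close>, so linearity evaluates \<open>\<phi>\<close> at one
      element in two ways.\<close>
    have key: "edge * \<phi> m c = j m c * \<phi> e c" if m: "m \<in> carrier M" for m
    proof -
      obtain a where a: "a \<in> carrier ringA" "rho a c = j m c" by (rule rho_lift)
      have "j (\<epsilon> \<odot>\<^bsub>M\<^esub> m) = j (a \<odot>\<^bsub>M\<^esub> e)"
        using m e \<epsilon> a by (simp add: frac_rep_smult[OF M] mult.commute)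
      then have "\<epsilon> \<odot>\<^bsub>M\<^esub> m = a \<odot>\<^bsub>M\<^esub> e"
        using m e \<epsilon> a by (intro frac_rep_inj[OF M]) (simp_all add: frac_rep_smult[OF M])
      then have "rho \<epsilon> * \<phi> m = rho a * \<phi> e"
        using smult m e \<epsilon> a by metis
      then have "(rho \<epsilon> * \<phi> m) c = (rho a * \<phi> e) c" by simp
      then show ?thesis using \<epsilon> a by simp
    qed
    \<comment> \<open>Restricted to the axis, \<open>key\<close> for the axial element has a left
      side killed by \<open>edge\<close>, while the axial element restricts to a nonzero
      weight.\<close>
    have "res \<kappa> (\<phi> e c) = 0" for \<kappa>
    proof -
      obtain g where g: "g \<in> carrier M" "j g = axial \<kappa> (ax \<kappa> c) (w \<kappa> (ax \<kappa> c))"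
        using M by (rule frac_rep_axial)
      have "res \<kappa> (edge * \<phi> g c) = res \<kappa> (j g c * \<phi> e c)" using key[OF g(1)] by simp
      then have "w \<kappa> (ax \<kappa> c) (ax (\<not> \<kappa>) c) * res \<kappa> (\<phi> e c) = 0"
        by (cases \<kappa>) (simp_all add: g axial_def)
      then show ?thesis using w by (simp add: good_weight_def)
    qed
    then obtain q where q: "\<phi> e c = edge * q" using edge_dvd by blast
    have "\<phi> m c = q * j m c" if m: "m \<in> carrier M" for m
    proof -
      have "edge * \<phi> m c = edge * (q * j m c)"
        unfolding key[OF m] q by (simp only: mult_ac)
      then show ?thesis using edge_neq_0 mult_left_cancel by blast
    qed
    then show ?thesis by blast
  qed
  then obtain p where "\<And>c. \<forall>m\<in>carrier M. \<phi> m c = p c * j m c" by metis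
  then have "\<phi> m = p * j m" if "m \<in> carrier M" for m
    using that by auto
  then show ?thesis using that by blast
qed

definition rho_inv :: "(bool \<times> bool \<Rightarrow> 'k ps2) \<Rightarrow> 'k::field ps4 set" where
  "rho_inv h = (SOME a. a \<in> carrier ringA \<and> rho a = h)"

lemma rho_inv:
  assumes "h \<in> glue 1"
  shows "rho_inv h \<in> carrier ringA" "rho (rho_inv h) = h"
proof -
  have "\<exists>a. a \<in> carrier ringA \<and> rho a = h"
    using rho_surj[OF assms] by blast
  from someI_ex[OF this] show "rho_inv h \<in> carrier ringA" "rho (rho_inv h) = h"
    by (simp_all add: rho_inv_def)
qed

text \<open>A functional is multiplication by some \<open>p\<close>. That its values at the axial
  elements lie in \<open>A\<close> forces the swapped proportions on \<open>p\<close>, and any such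
  \<open>p\<close> maps all of \<open>glue w\<close> into \<open>A\<close>. The dual is therefore
  all of \<open>glue (swap_weight w)\<close> even when \<open>M\<close> is smaller than
  \<open>glue w\<close>, and a second dual fills the gap.\<close>

lemma frac_rep_dual:
  fixes M :: "('k::field ps4 set, 'm, 'z) module_scheme"
  assumes w: "good_weight w" and M: "frac_rep M j w"
  obtains j' where "frac_rep (dual_mod ringA M) j' (swap_weight w)"
    "j' ` carrier (dual_mod ringA M) = glue (swap_weight w)"
proof -
  define \<Phi> where "\<Phi> p = (\<lambda>m\<in>carrier M. rho_inv (p * j m))" for p
  let ?w = "swap_weight w" and ?D = "dual_mod ringA M"
  have Mcl: "x \<oplus>\<^bsub>M\<^esub> y \<in> carrier M" "j (x \<oplus>\<^bsub>M\<^esub> y) = j x + j y" if "x \<in> carrier M" "y \<in> carrier M" for x y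
    using frac_rep_add[OF M that] by blast+
  have Msm: "a \<odot>\<^bsub>M\<^esub> x \<in> carrier M" "j (a \<odot>\<^bsub>M\<^esub> x) = rho a * j x" if "a \<in> carrier ringA" "x \<in> carrier M" for a x
    using frac_rep_smult[OF M that] by blast+
  have pj: "p * j m \<in> glue 1" if "p \<in> glue ?w" "m \<in> carrier M" for p m
    using glue_dual_mult[OF w that(1)] frac_rep_glue[OF M that(2)] .
  have \<Phi>_app: "rho (\<Phi> p m) = p * j m" "\<Phi> p m \<in> carrier ringA" if "p \<in> glue ?w" "m \<in> carrier M" for p m
    using rho_inv pj that by (auto simp: \<Phi>_def)
  have \<Phi>_out: "\<Phi> p m = undefined" if "m \<notin> carrier M" for p m
    using that by (simp add: \<Phi>_def)
  have carr: "carrier ?D = lin_maps ringA M (regular_mod ringA)"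
    by (simp add: dual_mod_def hom_mod_def)
  have \<Phi>_lin: "\<Phi> p \<in> carrier ?D" if p: "p \<in> glue ?w" for p
    unfolding carr lin_maps_def regular_mod_def ideal_mod_def
  proof (simp, intro conjI ballI)
    show "\<Phi> p \<in> carrier M \<rightarrow>\<^sub>E carrier ringA"
      using \<Phi>_app p by (auto simp: \<Phi>_def)
    show "\<Phi> p (x \<oplus>\<^bsub>M\<^esub> y) = \<Phi> p x \<oplus>\<^bsub>ringA\<^esub> \<Phi> p y" if "x \<in> carrier M" "y \<in> carrier M" for x y
      using p that by (intro rho_inj) (simp_all add: \<Phi>_app Mcl distrib_left)
    show "\<Phi> p (a \<odot>\<^bsub>M\<^esub> x) = a \<otimes>\<^bsub>ringA\<^esub> \<Phi> p x" if "a \<in> carrier ringA" "x \<in> carrier M" for a x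
      using p that by (intro rho_inj) (simp_all add: \<Phi>_app Msm mult_ac)
  qed
  have \<Phi>_inj: "inj_on \<Phi> (glue ?w)"
  proof (rule inj_onI, rule ext)
    fix p q c assume pq: "p \<in> glue ?w" "q \<in> glue ?w" "\<Phi> p = \<Phi> q"
    obtain e where e: "e \<in> carrier M" "j e = single c edge"
      using M by (rule frac_rep_single)
    have "p * j e = q * j e" using \<Phi>_app(1) pq e by metis
    then have "(p * j e) c = (q * j e) c" by simp
    then show "p c = q c" by (simp add: e)
  qed
  have \<Phi>_surj: "\<exists>p\<in>glue ?w. \<phi> = \<Phi> p" if "\<phi> \<in> carrier ?D" for \<phi>
  proof -
    have \<phi>: "\<phi> \<in> carrier M \<rightarrow>\<^sub>E carrier ringA"
      "\<And>x y. x \<in> carrier M \<Longrightarrow> y \<in> carrier M \<Longrightarrow> \<phi> (x \<oplus>\<^bsub>M\<^esub> y) = \<phi> x \<oplus>\<^bsub>ringA\<^esub> \<phi> y"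
      "\<And>a x. a \<in> carrier ringA \<Longrightarrow> x \<in> carrier M \<Longrightarrow> \<phi> (a \<odot>\<^bsub>M\<^esub> x) = a \<otimes>\<^bsub>ringA\<^esub> \<phi> x"
      using that by (auto simp: carr lin_maps_def regular_mod_def ideal_mod_def)
    have \<phi>c: "\<phi> m \<in> carrier ringA" if "m \<in> carrier M" for m using \<phi>(1) that by blast
    obtain p where p: "\<And>m. m \<in> carrier M \<Longrightarrow> rho (\<phi> m) = p * j m"
      by (rule frac_rep_hom[OF w M, of "\<lambda>m. rho (\<phi> m)"]) (simp_all add: \<phi> \<phi>c)
    have "res \<kappa> (p (cmp \<kappa> t False)) * w \<kappa> t False = res \<kappa> (p (cmp \<kappa> t True)) * w \<kappa> t True" for \<kappa> t
    proof -
      obtain g where g: "g \<in> carrier M" "j g = axial \<kappa> t (w \<kappa> t)"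
        using M by (rule frac_rep_axial)
      have "p * j g \<in> glue 1" using p[OF g(1)] rho_glue[OF \<phi>c[OF g(1)]] by simp
      from glue_1D[OF this, of \<kappa> t False True] show ?thesis by (simp add: g axial_def)
    qed
    then have pg: "p \<in> glue ?w" by (simp add: glue_def swap_weight_def)
    have "\<phi> = \<Phi> p"
    proof
      fix m show "\<phi> m = \<Phi> p m"
      proof (cases "m \<in> carrier M")
        case True
        then show ?thesis by (intro rho_inj) (simp_all add: \<phi>c p \<Phi>_app pg)
      next
        case False
        then show ?thesis using \<phi>(1) by (auto simp: \<Phi>_def PiE_def extensional_def)
      qed
    qed
    with pg show ?thesis by blast
  qed
  have \<Phi>_add: "\<Phi> (p + q) = \<Phi> p \<oplus>\<^bsub>?D\<^esub> \<Phi> q" if "p \<in> glue ?w" "q \<in> glue ?w" for p q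
  proof
    fix m
    have "\<Phi> (p + q) m = \<Phi> p m \<oplus>\<^bsub>ringA\<^esub> \<Phi> q m" if "m \<in> carrier M"
      using that \<open>p \<in> glue ?w\<close> \<open>q \<in> glue ?w\<close>
      by (intro rho_inj) (simp_all add: \<Phi>_app glue_add distrib_right)
    then show "\<Phi> (p + q) m = (\<Phi> p \<oplus>\<^bsub>?D\<^esub> \<Phi> q) m"
      by (cases "m \<in> carrier M") (simp_all add: dual_mod_def hom_mod_def regular_mod_def ideal_mod_def \<Phi>_out)
  qed
  have \<Phi>_smult: "\<Phi> (rho a * p) = a \<odot>\<^bsub>?D\<^esub> \<Phi> p" if "a \<in> carrier ringA" "p \<in> glue ?w" for a p
  proof
    fix m
    have "\<Phi> (rho a * p) m = a \<otimes>\<^bsub>ringA\<^esub> \<Phi> p m" if "m \<in> carrier M"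
      using that \<open>a \<in> carrier ringA\<close> \<open>p \<in> glue ?w\<close>
      by (intro rho_inj) (simp_all add: \<Phi>_app glue_mult rho_glue mult.assoc)
    then show "\<Phi> (rho a * p) m = (a \<odot>\<^bsub>?D\<^esub> \<Phi> p) m"
      by (cases "m \<in> carrier M") (simp_all add: dual_mod_def hom_mod_def regular_mod_def ideal_mod_def \<Phi>_out)
  qed
  define j' where "j' = the_inv_into (glue ?w) \<Phi>"
  have j'\<Phi>: "j' (\<Phi> p) = p" if "p \<in> glue ?w" for p
    unfolding j'_def using \<Phi>_inj that by (rule the_inv_into_f_f)
  have carr': "carrier ?D = \<Phi> ` glue ?w"
    using \<Phi>_surj \<Phi>_lin by blast
  have img: "j' ` carrier ?D = glue ?w"
    unfolding carr' by (force simp: j'\<Phi> image_iff)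
  have "frac_rep ?D j' ?w"
    unfolding frac_rep_def img
  proof (intro conjI ballI allI)
    show "inj_on j' (carrier ?D)" unfolding carr' by (auto simp: inj_on_def j'\<Phi>)
    show "single c edge \<in> glue ?w" for c using single_edge_glue[of c 1] by simp
    show "axial \<kappa> t (?w \<kappa> t) \<in> glue ?w" for \<kappa> t
      using good_weight_swap[OF w] by (intro axial_glue) (auto simp: good_weight_def)
  qed (auto simp: carr' j'\<Phi> glue_add glue_mult rho_glue simp flip: \<Phi>_add \<Phi>_smult)
  then show ?thesis using that img by blast
qed

lemma frac_rep_iso:
  assumes M: "frac_rep M j w" "j ` carrier M = glue w" and N: "frac_rep N j' w" "j' ` carrier N = glue w"
  shows "mod_iso ringA M N"
proof -
  define f where "f = (\<lambda>m\<in>carrier M. the_inv_into (carrier N) j' (j m))"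
  have injN: "inj_on j' (carrier N)" and injM: "inj_on j (carrier M)"
    using M N by (auto simp: frac_rep_def)
  have f: "f m \<in> carrier N" "j' (f m) = j m" if "m \<in> carrier M" for m
  proof -
    have "j m \<in> j' ` carrier N" using that M N by auto
    then show "f m \<in> carrier N" "j' (f m) = j m"
      using the_inv_into_into[OF injN] f_the_inv_into_f[OF injN] that by (auto simp: f_def)
  qed
  have eqN: "x = y" if "x \<in> carrier N" "y \<in> carrier N" "j' x = j' y" for x y
    using injN that by (auto simp: inj_on_def)
  have "f \<in> lin_maps ringA M N"
    unfolding lin_maps_def
  proof (simp, intro conjI ballI)
    show "f \<in> carrier M \<rightarrow>\<^sub>E carrier N" using f by (auto simp: f_def)
    show "f (x \<oplus>\<^bsub>M\<^esub> y) = f x \<oplus>\<^bsub>N\<^esub> f y" if "x \<in> carrier M" "y \<in> carrier M" for x y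
      using that by (intro eqN) (simp_all add: f frac_rep_add[OF M(1)] frac_rep_add[OF N(1)]
        frac_rep_smult[OF M(1)] frac_rep_smult[OF N(1)])
    show "f (a \<odot>\<^bsub>M\<^esub> x) = a \<odot>\<^bsub>N\<^esub> f x" if "a \<in> carrier ringA" "x \<in> carrier M" for a x
      using that by (intro eqN) (simp_all add: f frac_rep_add[OF M(1)] frac_rep_add[OF N(1)]
        frac_rep_smult[OF M(1)] frac_rep_smult[OF N(1)])
  qed
  moreover have "bij_betw f (carrier M) (carrier N)"
    unfolding bij_betw_def
  proof
    show "inj_on f (carrier M)"
      by (rule inj_onI) (metis f(2) injM inj_onD)
    have "y \<in> f ` carrier M" if "y \<in> carrier N" for y
    proof -
      from that M N obtain m where "m \<in> carrier M" "j' y = j m" by (metis imageE imageI)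
      then have "y = f m" using that by (intro eqN) (simp_all add: f)
      then show ?thesis using \<open>m \<in> carrier M\<close> by blast
    qed
    then show "f ` carrier M = carrier N" using f by blast
  qed
  ultimately show ?thesis unfolding mod_iso_def by blast
qed

text \<open>The isomorphism and its inverse are multiplications by quadruples \<open>p\<close> and
  \<open>q\<close>, and \<open>q p = 1\<close> is read off at \<open>single c edge\<close>. The
  relation between the weights is the gluing condition of \<open>w'\<close> for the image of the
  axial element of \<open>w\<close>.\<close>

lemma frac_rep_iso_unit:
  assumes w: "good_weight w" "good_weight w'"
    and M: "frac_rep M j w" and N: "frac_rep N j' w'"
    and iso: "mod_iso ringA M N"
  obtains p where "\<And>c. p c $ 0 $ 0 \<noteq> 0"
    "\<And>\<kappa> t. res \<kappa> (p (cmp \<kappa> t False)) * (w \<kappa> t False * w' \<kappa> t True) = res \<kappa> (p (cmp \<kappa> t True)) * (w \<kappa> t True * w' \<kappa> t False)"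
proof -
  obtain f where f: "f \<in> lin_maps ringA M N" "bij_betw f (carrier M) (carrier N)"
    using iso by (auto simp: mod_iso_def)
  have fl: "\<And>x. x \<in> carrier M \<Longrightarrow> f x \<in> carrier N"
      "\<And>x y. x \<in> carrier M \<Longrightarrow> y \<in> carrier M \<Longrightarrow> f (x \<oplus>\<^bsub>M\<^esub> y) = f x \<oplus>\<^bsub>N\<^esub> f y"
      "\<And>a x. a \<in> carrier ringA \<Longrightarrow> x \<in> carrier M \<Longrightarrow> f (a \<odot>\<^bsub>M\<^esub> x) = a \<odot>\<^bsub>N\<^esub> f x"
    using f(1) by (auto simp: lin_maps_def)
  define g where "g = the_inv_into (carrier M) f"
  have inj: "inj_on f (carrier M)" using f(2) by (rule bij_betw_imp_inj_on)
  have im: "f ` carrier M = carrier N" using f(2) by (rule bij_betw_imp_surj_on)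
  have gf: "g (f x) = x" if "x \<in> carrier M" for x
    unfolding g_def using inj that by (rule the_inv_into_f_f)
  note M' = frac_rep_add[OF M] frac_rep_smult[OF M]
  note N' = frac_rep_add[OF N] frac_rep_smult[OF N]
  obtain p where p: "\<And>m. m \<in> carrier M \<Longrightarrow> j' (f m) = p * j m"
    by (rule frac_rep_hom[OF w(1) M, of "\<lambda>m. j' (f m)"]) (simp_all add: fl N')
  have gc: "g x \<in> carrier M" if "x \<in> carrier N" for x
    using that gf unfolding im[symmetric] by auto
  have fg: "f (g x) = x" if "x \<in> carrier N" for x
    using that gf unfolding im[symmetric] by auto
  have eqf: "x = y" if "x \<in> carrier M" "y \<in> carrier M" "f x = f y" for x y
    using inj that by (auto simp: inj_on_def)
  have gadd: "g (x \<oplus>\<^bsub>N\<^esub> y) = g x \<oplus>\<^bsub>M\<^esub> g y" if "x \<in> carrier N" "y \<in> carrier N" for x y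
    using that by (intro eqf) (simp_all add: fl fg gc M' N')
  have gsm: "g (a \<odot>\<^bsub>N\<^esub> x) = a \<odot>\<^bsub>M\<^esub> g x" if "a \<in> carrier ringA" "x \<in> carrier N" for a x
    using that by (intro eqf) (simp_all add: fl fg gc M' N')
  obtain q where q: "\<And>n. n \<in> carrier N \<Longrightarrow> j (g n) = q * j' n"
    by (rule frac_rep_hom[OF w(2) N, of "\<lambda>n. j (g n)"]) (simp_all add: gadd gsm gc M')
  have "p c $ 0 $ 0 \<noteq> 0" for c
  proof -
    obtain e where e: "e \<in> carrier M" "j e = single c edge"
      using M by (rule frac_rep_single)
    have "j e = q * (p * j e)" using q[OF fl(1)[OF e(1)]] by (simp only: p[OF e(1)] gf[OF e(1)])
    then have "j e c = (q * (p * j e)) c" by simp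
    then have "(q c * p c) * edge = 1 * edge" by (simp add: e mult_ac)
    then have "q c * p c = 1" using mult_right_cancel[OF edge_neq_0] by blast
    then have "(q c * p c) $ 0 $ 0 = 1" by simp
    then show ?thesis by auto
  qed
  moreover have "res \<kappa> (p (cmp \<kappa> t False)) * (w \<kappa> t False * w' \<kappa> t True) = res \<kappa> (p (cmp \<kappa> t True)) * (w \<kappa> t True * w' \<kappa> t False)" for \<kappa> t
  proof -
    obtain g where g: "g \<in> carrier M" "j g = axial \<kappa> t (w \<kappa> t)"
      using M by (rule frac_rep_axial)
    have "p * j g \<in> glue w'" using p[OF g(1)] frac_rep_glue[OF N fl(1)[OF g(1)]] by simp
    from glueD[OF this, of \<kappa> t False] show ?thesis by (simp add: g axial_def mult_ac)
  qed
  ultimately show ?thesis using that by blast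
qed


section \<open>Localization and prime ideals\<close>

text \<open>The sum in \<open>free_of_rank\<close> is taken in a localization whose additive laws
  are not developed, so a sum with one term is evaluated from the fold itself, with membership in
  the carrier as the only condition.\<close>

lemma foldD_singleton:
  assumes "e \<in> D" "f x e \<in> D"
  shows "foldD D f e {x} = f x e"
  unfolding foldD_def
proof (rule the_equality)
  have "({}, e) \<in> foldSetD D f e" using assms(1) by (rule foldSetD.emptyI)
  then show "({x}, f x e) \<in> foldSetD D f e"
    using foldSetD.insertI[of x "{}" f e D e] assms(2) by simp
next
  fix y assume "({x}, y) \<in> foldSetD D f e"
  then show "y = f x e"
  proof (cases rule: foldSetD.cases)
    case (insertI z A y')
    then have "A = {}" "z = x" by auto
    with insertI show ?thesis by (metis empty_foldSetDE)
  qed simp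
qed

section \<open>Calculus of fractions\<close>

lemma (in cring) regular_module: "module R (regular_mod R)"
proof (rule moduleI)
  show "abelian_group (regular_mod R)"
    by (rule abelian_groupI) (auto simp: regular_mod_def ideal_mod_def a_ac intro: l_neg)
qed (auto simp: regular_mod_def ideal_mod_def l_distr r_distr m_assoc is_cring)

context module
begin

lemma loc_rel_equiv:
  assumes S: "S \<subseteq> carrier R" "\<one> \<in> S" "\<And>s t. s \<in> S \<Longrightarrow> t \<in> S \<Longrightarrow> s \<otimes> t \<in> S"
  shows "equiv (carrier M \<times> S) (loc_rel R S M)"
proof (rule equivI)
  show "loc_rel R S M \<subseteq> (carrier M \<times> S) \<times> (carrier M \<times> S)"
    by (auto simp: loc_rel_def)
  show "refl_on (carrier M \<times> S) (loc_rel R S M)"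
    using S(2) by (auto simp: loc_rel_def refl_on_def)
  show "sym (loc_rel R S M)"
    by (auto simp: loc_rel_def sym_def) metis
  show "trans (loc_rel R S M)"
  proof (rule transI)
    fix X Y Z assume "(X, Y) \<in> loc_rel R S M" "(Y, Z) \<in> loc_rel R S M"
    moreover obtain m s n t k u where XYZ: "X = (m, s)" "Y = (n, t)" "Z = (k, u)"
      by (metis surj_pair)
    ultimately obtain r r' where *: "m \<in> carrier M" "n \<in> carrier M" "k \<in> carrier M"
        "s \<in> S" "t \<in> S" "u \<in> S" "r \<in> S" "r' \<in> S"
      "r \<odot>\<^bsub>M\<^esub> (t \<odot>\<^bsub>M\<^esub> m) = r \<odot>\<^bsub>M\<^esub> (s \<odot>\<^bsub>M\<^esub> n)" "r' \<odot>\<^bsub>M\<^esub> (u \<odot>\<^bsub>M\<^esub> n) = r' \<odot>\<^bsub>M\<^esub> (t \<odot>\<^bsub>M\<^esub> k)"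
      by (auto simp: loc_rel_def)
    have "s \<in> carrier R" "t \<in> carrier R" "u \<in> carrier R" "r \<in> carrier R" "r' \<in> carrier R"
      using * S(1) by auto
    note c = this *(1-3)
    \<comment> \<open>The middle denominator \<open>t\<close> becomes part of the witness: the first
      relation is scaled by \<open>r' u\<close>, the second by \<open>r s\<close>.\<close>
    have "(r \<otimes> r' \<otimes> t) \<odot>\<^bsub>M\<^esub> (u \<odot>\<^bsub>M\<^esub> m) = (r' \<otimes> u) \<odot>\<^bsub>M\<^esub> (r \<odot>\<^bsub>M\<^esub> (t \<odot>\<^bsub>M\<^esub> m))"
      using c by (simp add: smult_assoc1[symmetric] R.m_ac)
    also have "\<dots> = (r \<otimes> s) \<odot>\<^bsub>M\<^esub> (r' \<odot>\<^bsub>M\<^esub> (u \<odot>\<^bsub>M\<^esub> n))"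
      unfolding *(9) using c by (simp add: smult_assoc1[symmetric] R.m_ac)
    also have "\<dots> = (r \<otimes> r' \<otimes> t) \<odot>\<^bsub>M\<^esub> (s \<odot>\<^bsub>M\<^esub> k)"
      unfolding *(10) using c by (simp add: smult_assoc1[symmetric] R.m_ac)
    finally show "(X, Z) \<in> loc_rel R S M"
      using * S(3) unfolding XYZ loc_rel_def by auto
  qed
qed

lemma loc_frac_eq_iff:
  assumes S: "S \<subseteq> carrier R" "\<one> \<in> S" "\<And>s t. s \<in> S \<Longrightarrow> t \<in> S \<Longrightarrow> s \<otimes> t \<in> S"
    and "m \<in> carrier M" "n \<in> carrier M" "s \<in> S" "t \<in> S"
  shows "loc_frac R S M m s = loc_frac R S M n t \<longleftrightarrow>
    (\<exists>r\<in>S. r \<odot>\<^bsub>M\<^esub> (t \<odot>\<^bsub>M\<^esub> m) = r \<odot>\<^bsub>M\<^esub> (s \<odot>\<^bsub>M\<^esub> n))"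
proof -
  have "loc_frac R S M m s = loc_frac R S M n t \<longleftrightarrow> ((m, s), (n, t)) \<in> loc_rel R S M"
    unfolding loc_frac_def by (rule eq_equiv_class_iff[OF loc_rel_equiv[OF S]]) (use assms in auto)
  then show ?thesis using assms by (simp add: loc_rel_def)
qed

lemma mem_loc_frac:
  "(n, t) \<in> loc_frac R S M m s \<longleftrightarrow> m \<in> carrier M \<and> n \<in> carrier M \<and> s \<in> S \<and> t \<in> S \<and>
     (\<exists>r\<in>S. r \<odot>\<^bsub>M\<^esub> (t \<odot>\<^bsub>M\<^esub> m) = r \<odot>\<^bsub>M\<^esub> (s \<odot>\<^bsub>M\<^esub> n))"
  by (auto simp: loc_frac_def loc_rel_def)

lemma loc_smult_frac:
  assumes S: "S \<subseteq> carrier R" "\<one> \<in> S" "\<And>s t. s \<in> S \<Longrightarrow> t \<in> S \<Longrightarrow> s \<otimes> t \<in> S"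
    and a: "a \<in> carrier R" "s \<in> S" and n: "n \<in> carrier M" "t \<in> S"
  shows "loc_smult R S M (loc_frac R S (regular_mod R) a s) (loc_frac R S M n t) =
    loc_frac R S M (a \<odot>\<^bsub>M\<^esub> n) (s \<otimes> t)"
proof -
  interpret RM: module R "regular_mod R" by (rule R.regular_module)
  have 1: "loc_frac R S M (a' \<odot>\<^bsub>M\<^esub> n') (s' \<otimes> t') = loc_frac R S M (a \<odot>\<^bsub>M\<^esub> n) (s \<otimes> t)"
    if "(a', s') \<in> loc_frac R S (regular_mod R) a s" "(n', t') \<in> loc_frac R S M n t" for a' s' n' t'
  proof -
    from that(1) obtain r where r: "a' \<in> carrier R" "s' \<in> S" "r \<in> S" "r \<otimes> (s' \<otimes> a) = r \<otimes> (s \<otimes> a')"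
      unfolding RM.mem_loc_frac by (auto simp: regular_mod_def ideal_mod_def)
    from that(2) obtain q where q: "n' \<in> carrier M" "t' \<in> S" "q \<in> S" "q \<odot>\<^bsub>M\<^esub> (t' \<odot>\<^bsub>M\<^esub> n) = q \<odot>\<^bsub>M\<^esub> (t \<odot>\<^bsub>M\<^esub> n')"
      unfolding mem_loc_frac by auto
    have c: "s \<in> carrier R" "s' \<in> carrier R" "t \<in> carrier R" "t' \<in> carrier R" "r \<in> carrier R" "q \<in> carrier R"
      using assms r q by auto
    have "(r \<otimes> q) \<odot>\<^bsub>M\<^esub> ((s \<otimes> t) \<odot>\<^bsub>M\<^esub> (a' \<odot>\<^bsub>M\<^esub> n')) = (r \<otimes> (s \<otimes> a')) \<odot>\<^bsub>M\<^esub> (q \<odot>\<^bsub>M\<^esub> (t \<odot>\<^bsub>M\<^esub> n'))"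
      using assms r(1) q(1) c by (simp add: smult_assoc1[symmetric] R.m_ac)
    also have "\<dots> = (r \<otimes> q) \<odot>\<^bsub>M\<^esub> ((s' \<otimes> t') \<odot>\<^bsub>M\<^esub> (a \<odot>\<^bsub>M\<^esub> n))"
      unfolding r(4)[symmetric] q(4)[symmetric]
      using assms r(1) q(1) c by (simp add: smult_assoc1[symmetric] R.m_ac)
    finally show ?thesis
      using assms r q by (subst loc_frac_eq_iff[OF S]) (auto intro!: bexI[of _ "r \<otimes> q"])
  qed
  have "(a, s) \<in> loc_frac R S (regular_mod R) a s" "(n, t) \<in> loc_frac R S M n t"
    using assms by (auto simp: mem_loc_frac RM.mem_loc_frac) (auto simp: regular_mod_def ideal_mod_def)
  then show ?thesis unfolding loc_smult_def using 1 by fast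
qed

text \<open>Evaluating a sum with one term ends in adding the zero fraction. All representatives of
  the two classes give the same class, so the union in \<open>loc_add\<close> collapses.\<close>

lemma loc_add_zero:
  assumes S: "S \<subseteq> carrier R" "\<one> \<in> S" "\<And>s t. s \<in> S \<Longrightarrow> t \<in> S \<Longrightarrow> s \<otimes> t \<in> S"
    and m: "m \<in> carrier M" "s \<in> S"
  shows "loc_add R S M (loc_frac R S M m s) (loc_frac R S M \<zero>\<^bsub>M\<^esub> \<one>) = loc_frac R S M m s"
proof -
  have 1: "loc_frac R S M ((t' \<odot>\<^bsub>M\<^esub> m') \<oplus>\<^bsub>M\<^esub> (s' \<odot>\<^bsub>M\<^esub> n')) (s' \<otimes> t') = loc_frac R S M m s"
    if "(m', s') \<in> loc_frac R S M m s" "(n', t') \<in> loc_frac R S M \<zero>\<^bsub>M\<^esub> \<one>" for m' s' n' t'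
  proof -
    from that(1) obtain r where r: "m' \<in> carrier M" "s' \<in> S" "r \<in> S" "r \<odot>\<^bsub>M\<^esub> (s' \<odot>\<^bsub>M\<^esub> m) = r \<odot>\<^bsub>M\<^esub> (s \<odot>\<^bsub>M\<^esub> m')"
      unfolding mem_loc_frac by auto
    from that(2) obtain q where q: "n' \<in> carrier M" "t' \<in> S" "q \<in> S" "q \<odot>\<^bsub>M\<^esub> (t' \<odot>\<^bsub>M\<^esub> \<zero>\<^bsub>M\<^esub>) = q \<odot>\<^bsub>M\<^esub> (\<one> \<odot>\<^bsub>M\<^esub> n')"
      unfolding mem_loc_frac by auto
    have c: "s \<in> carrier R" "s' \<in> carrier R" "t' \<in> carrier R" "r \<in> carrier R" "q \<in> carrier R"
      using assms r q by auto
    have q0: "q \<odot>\<^bsub>M\<^esub> n' = \<zero>\<^bsub>M\<^esub>" using q c by simp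
    have "(r \<otimes> q) \<odot>\<^bsub>M\<^esub> (s \<odot>\<^bsub>M\<^esub> (t' \<odot>\<^bsub>M\<^esub> m' \<oplus>\<^bsub>M\<^esub> s' \<odot>\<^bsub>M\<^esub> n')) =
       (q \<otimes> t') \<odot>\<^bsub>M\<^esub> (r \<odot>\<^bsub>M\<^esub> (s \<odot>\<^bsub>M\<^esub> m')) \<oplus>\<^bsub>M\<^esub> (r \<otimes> s \<otimes> s') \<odot>\<^bsub>M\<^esub> (q \<odot>\<^bsub>M\<^esub> n')"
      using r(1) q(1) m c by (simp add: smult_r_distr smult_assoc1[symmetric] R.m_ac)
    also have "\<dots> = (r \<otimes> q) \<odot>\<^bsub>M\<^esub> ((s' \<otimes> t') \<odot>\<^bsub>M\<^esub> m)"
      unfolding q0 r(4)[symmetric] using r(1) q(1) m c by (simp add: smult_assoc1[symmetric] R.m_ac)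
    finally show ?thesis
      using assms r q c by (subst loc_frac_eq_iff[OF S]) (auto intro!: bexI[of _ "r \<otimes> q"])
  qed
  have "(m, s) \<in> loc_frac R S M m s" "(\<zero>\<^bsub>M\<^esub>, \<one>) \<in> loc_frac R S M \<zero>\<^bsub>M\<^esub> \<one>"
    using assms by (auto simp: mem_loc_frac)
  then show ?thesis unfolding loc_add_def using 1 by fast
qed

text \<open>The basis element is a fraction \<open>m0 / s0\<close>, whose numerator serves as
  \<open>b\<close>. Existence of coordinates, with denominators cleared, gives the second property;
  uniqueness of the coordinate of zero gives the third.\<close>

lemma free_rank_one_at:
  assumes p: "primeideal p R" and free: "free_of_rank (ring_at R p) (mod_at R p M) 1"
  obtains b where "b \<in> carrier M"
    "\<And>z. z \<in> carrier M \<Longrightarrow> \<exists>s\<in>carrier R - p. \<exists>a\<in>carrier R. s \<odot>\<^bsub>M\<^esub> z = a \<odot>\<^bsub>M\<^esub> b"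
    "\<And>a. a \<in> carrier R \<Longrightarrow> a \<odot>\<^bsub>M\<^esub> b = \<zero>\<^bsub>M\<^esub> \<Longrightarrow> \<exists>t\<in>carrier R - p. t \<otimes> a = \<zero>"
proof -
  interpret p: primeideal p R by (rule p)
  interpret RM: module R "regular_mod R" by (rule R.regular_module)
  define S where "S = carrier R - p"
  have S: "S \<subseteq> carrier R" "\<one> \<in> S" "\<And>s t. s \<in> S \<Longrightarrow> t \<in> S \<Longrightarrow> s \<otimes> t \<in> S"
    using p.I_prime p.one_imp_carrier p.I_notcarr by (auto simp: S_def)
  let ?L = "loc_mod R S M" and ?F = "loc_frac R S (regular_mod R)" and ?G = "loc_frac R S M"
  have cL: "X \<in> carrier ?L \<longleftrightarrow> (\<exists>m\<in>carrier M. \<exists>s\<in>S. X = ?G m s)" for X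
    by (auto simp: loc_mod_def quotient_def loc_frac_def)
  have cR: "X \<in> carrier (loc_ring R S) \<longleftrightarrow> (\<exists>a\<in>carrier R. \<exists>s\<in>S. X = ?F a s)" for X
    by (auto simp: loc_ring_def quotient_def loc_frac_def regular_mod_def ideal_mod_def)
  have zero: "\<zero>\<^bsub>?L\<^esub> = ?G \<zero>\<^bsub>M\<^esub> \<one>" by (simp add: loc_mod_def)
  have "\<exists>b\<in>{..<1::nat} \<rightarrow> carrier ?L. \<forall>z\<in>carrier ?L.
      \<exists>!a. a \<in> {..<1} \<rightarrow>\<^sub>E carrier (loc_ring R S) \<and> z = (\<Oplus>\<^bsub>?L\<^esub>i\<in>{..<1}. a i \<odot>\<^bsub>?L\<^esub> b i)"
    using free unfolding free_of_rank_def S_def .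
  then obtain b where b: "b \<in> {..<1::nat} \<rightarrow> carrier ?L" and ex: "\<forall>z\<in>carrier ?L.
      \<exists>!a. a \<in> {..<1} \<rightarrow>\<^sub>E carrier (loc_ring R S) \<and> z = (\<Oplus>\<^bsub>?L\<^esub>i\<in>{..<1}. a i \<odot>\<^bsub>?L\<^esub> b i)"
    by (elim bexE) (rule that)
  from b have "b 0 \<in> carrier ?L" by auto
  then obtain m0 s0 where b0: "m0 \<in> carrier M" "s0 \<in> S" "b 0 = ?G m0 s0"
    unfolding cL by blast
  have sm: "a \<odot>\<^bsub>M\<^esub> m0 \<in> carrier M" "s \<otimes> s0 \<in> S" if "a \<in> carrier R" "s \<in> S" for a s
    using that b0 S by auto
  have sum: "(\<Oplus>\<^bsub>?L\<^esub>i\<in>{..<1}. c i \<odot>\<^bsub>?L\<^esub> b i) = ?G (a \<odot>\<^bsub>M\<^esub> m0) (s \<otimes> s0)"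
    if c: "c 0 = ?F a s" "a \<in> carrier R" "s \<in> S" for c :: "nat \<Rightarrow> _" and a s
  proof -
    have "c 0 \<odot>\<^bsub>?L\<^esub> b 0 = ?G (a \<odot>\<^bsub>M\<^esub> m0) (s \<otimes> s0)"
      using loc_smult_frac[OF S c(2,3) b0(1,2)] by (simp add: loc_mod_def c b0)
    moreover have "?G (a \<odot>\<^bsub>M\<^esub> m0) (s \<otimes> s0) \<oplus>\<^bsub>?L\<^esub> \<zero>\<^bsub>?L\<^esub> = ?G (a \<odot>\<^bsub>M\<^esub> m0) (s \<otimes> s0)"
      using loc_add_zero[OF S sm[OF c(2,3)]] by (simp add: loc_mod_def)
    moreover have "\<zero>\<^bsub>?L\<^esub> \<in> carrier ?L" "?G (a \<odot>\<^bsub>M\<^esub> m0) (s \<otimes> s0) \<in> carrier ?L"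
      unfolding cL zero using sm[OF c(2,3)] S(2) by blast+
    moreover have "{..<1::nat} = {0}" by auto
    ultimately show ?thesis
      by (simp add: finsum_def finprod_def foldD_singleton)
  qed
  have 1: "\<exists>s\<in>carrier R - p. \<exists>a\<in>carrier R. s \<odot>\<^bsub>M\<^esub> z = a \<odot>\<^bsub>M\<^esub> m0" if z: "z \<in> carrier M" for z
  proof -
    have "?G z \<one> \<in> carrier ?L" unfolding cL using z S(2) by blast
    then obtain c where c: "c \<in> {..<1} \<rightarrow>\<^sub>E carrier (loc_ring R S)" "?G z \<one> = (\<Oplus>\<^bsub>?L\<^esub>i\<in>{..<1}. c i \<odot>\<^bsub>?L\<^esub> b i)"
      using ex[rule_format, THEN ex1_implies_ex, of "?G z \<one>"] by (auto intro: that)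
    then have "c 0 \<in> carrier (loc_ring R S)" by auto
    then obtain a s where a: "a \<in> carrier R" "s \<in> S" "c 0 = ?F a s" unfolding cR by blast
    have "?G z \<one> = ?G (a \<odot>\<^bsub>M\<^esub> m0) (s \<otimes> s0)"
      using c(2) sum[of c a s, OF a(3,1,2)] by simp
    then obtain r where r: "r \<in> S" "r \<odot>\<^bsub>M\<^esub> ((s \<otimes> s0) \<odot>\<^bsub>M\<^esub> z) = r \<odot>\<^bsub>M\<^esub> (\<one> \<odot>\<^bsub>M\<^esub> (a \<odot>\<^bsub>M\<^esub> m0))"
      using loc_frac_eq_iff[OF S z sm(1)[OF a(1,2)] S(2) sm(2)[OF a(1,2)]] by blast
    have "r \<in> carrier R" "s \<otimes> s0 \<in> carrier R" using r sm(2)[OF a(1,2)] S by auto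
    then have "(r \<otimes> (s \<otimes> s0)) \<odot>\<^bsub>M\<^esub> z = (r \<otimes> a) \<odot>\<^bsub>M\<^esub> m0" "r \<otimes> a \<in> carrier R"
      using r(2) z a b0 sm(1)[OF a(1,2)] by (simp_all add: smult_assoc1)
    moreover have "r \<otimes> (s \<otimes> s0) \<in> carrier R - p"
      using S(3)[OF r(1) sm(2)[OF a(1,2)]] by (simp add: S_def)
    ultimately show ?thesis by blast
  qed
  have 2: "\<exists>t\<in>carrier R - p. t \<otimes> a = \<zero>" if a: "a \<in> carrier R" "a \<odot>\<^bsub>M\<^esub> m0 = \<zero>\<^bsub>M\<^esub>" for a
  proof -
    define c where "c d = (\<lambda>i\<in>{..<1::nat}. ?F d \<one>)" for d
    have c: "c d \<in> {..<1} \<rightarrow>\<^sub>E carrier (loc_ring R S)" if "d \<in> carrier R" for d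
    proof -
      have "?F d \<one> \<in> carrier (loc_ring R S)" unfolding cR using that S(2) by blast
      then show ?thesis unfolding c_def by auto
    qed
    \<comment> \<open>The zero fraction is written with the denominator that \<open>sum\<close>
      produces. Both \<open>a / 1\<close> and \<open>0 / 1\<close> are coordinates of it, so they
      coincide.\<close>
    have z: "?G \<zero>\<^bsub>M\<^esub> (\<one> \<otimes> s0) \<in> carrier ?L"
      unfolding cL using S b0 by (intro bexI[of _ "\<zero>\<^bsub>M\<^esub>"] bexI[of _ "\<one> \<otimes> s0"]) auto
    have sa: "?G \<zero>\<^bsub>M\<^esub> (\<one> \<otimes> s0) = (\<Oplus>\<^bsub>?L\<^esub>i\<in>{..<1}. c a i \<odot>\<^bsub>?L\<^esub> b i)"
      using sum[of "c a" a \<one>] a S(2) by (simp add: c_def)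
    have s0: "?G \<zero>\<^bsub>M\<^esub> (\<one> \<otimes> s0) = (\<Oplus>\<^bsub>?L\<^esub>i\<in>{..<1}. c \<zero> i \<odot>\<^bsub>?L\<^esub> b i)"
      using sum[of "c \<zero>" \<zero> \<one>] S(2) b0(1) by (simp add: c_def)
    have uq: "x = y" if "\<exists>!a. P a" "P x" "P y" for P and x y :: "nat \<Rightarrow> ('a \<times> 'a) set"
      using that by blast
    have "c a = c \<zero>"
      by (rule uq[OF ex[rule_format, OF z]]) (intro conjI c a(1) R.zero_closed sa s0)+
    then have "c a 0 = c \<zero> 0" by simp
    then have "?F a \<one> = ?F \<zero> \<one>" by (simp add: c_def)
    then obtain r where "r \<in> S" "r \<otimes> a = \<zero>"
      using RM.loc_frac_eq_iff[OF S, of a \<zero> \<one> \<one>] a(1) S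
      by (auto simp: regular_mod_def ideal_mod_def)
    then show ?thesis unfolding S_def by blast
  qed
  show ?thesis using that b0(1) 1 2 by blast
qed

end

text \<open>An ideal maximal among those containing \<open>I\<close> and missing all powers of
  \<open>r\<close> is prime: enlarging it by \<open>a\<close> or by \<open>b\<close> outside it
  produces a power of \<open>r\<close>, and the product of these two powers would lie in the ideal
  if \<open>a b\<close> did.\<close>

lemma (in cring) exists_prime_avoiding_powers:
  assumes I: "ideal I R" and r: "r \<in> carrier R" "\<And>n::nat. r [^] n \<notin> I"
  obtains P where "primeideal P R" "I \<subseteq> P" "r \<notin> P"
proof -
  define \<A> where "\<A> = {J. ideal J R \<and> I \<subseteq> J \<and> (\<forall>n::nat. r [^] n \<notin> J)}"
  have "\<exists>P\<in>\<A>. \<forall>X\<in>\<A>. P \<subseteq> X \<longrightarrow> X = P"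
  proof (rule subset_Zorn_nonempty)
    show "\<A> \<noteq> {}" using I r by (auto simp: \<A>_def)
  next
    fix \<C> assume ne: "\<C> \<noteq> {}" and ch: "subset.chain \<A> \<C>"
    have mem: "\<And>J. J \<in> \<C> \<Longrightarrow> ideal J R \<and> I \<subseteq> J \<and> (\<forall>n::nat. r [^] n \<notin> J)"
      using ch unfolding subset.chain_def \<A>_def by auto
    have ip: "\<And>J. J \<in> \<C> \<Longrightarrow> additive_subgroup J R" using mem ideal.axioms(1) by blast
    have "ideal (\<Union>\<C>) R"
    proof (rule idealI[OF ring_axioms])
      show "subgroup (\<Union>\<C>) (add_monoid R)"
      proof (rule add.subgroupI)
        show "\<Union>\<C> \<subseteq> carrier R" using additive_subgroup.a_Hcarr[OF ip] by blast
        show "\<Union>\<C> \<noteq> {}" using ne additive_subgroup.zero_closed[OF ip] by blast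
        show "\<And>a. a \<in> \<Union>\<C> \<Longrightarrow> \<ominus> a \<in> \<Union>\<C>"
          using additive_subgroup.a_inv_closed[OF ip] by blast
        fix a b assume "a \<in> \<Union>\<C>" "b \<in> \<Union>\<C>"
        then obtain J K where JK: "J \<in> \<C>" "a \<in> J" "K \<in> \<C>" "b \<in> K" by blast
        then have "J \<subseteq> K \<or> K \<subseteq> J" using ch unfolding subset.chain_def by auto
        then have "a \<oplus> b \<in> J \<or> a \<oplus> b \<in> K"
          using JK additive_subgroup.a_closed[OF ip] by blast
        then show "a \<oplus> b \<in> \<Union>\<C>" using JK by blast
      qed
    next
      fix a x assume "a \<in> \<Union>\<C>" and x: "x \<in> carrier R"
      then obtain J where J: "J \<in> \<C>" "a \<in> J" by blast
      with mem have "ideal J R" by blast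
      then have "x \<otimes> a \<in> J" "a \<otimes> x \<in> J"
        using J(2) x by (simp_all add: ideal.I_l_closed ideal.I_r_closed)
      then show "x \<otimes> a \<in> \<Union>\<C>" "a \<otimes> x \<in> \<Union>\<C>" using J(1) by blast+
    qed
    then show "\<Union>\<C> \<in> \<A>" using mem ne by (auto simp: \<A>_def)
  qed
  then obtain P where P: "ideal P R" "I \<subseteq> P" "\<And>n::nat. r [^] n \<notin> P"
    and max: "\<And>X. ideal X R \<Longrightarrow> I \<subseteq> X \<Longrightarrow> (\<And>n::nat. r [^] n \<notin> X) \<Longrightarrow> P \<subseteq> X \<Longrightarrow> X = P"
    unfolding \<A>_def by auto
  interpret P: ideal P R by (rule P)
  have big: "\<exists>n::nat. \<exists>q\<in>P. \<exists>y\<in>carrier R. r [^] n = q \<oplus> y \<otimes> a"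
    if a: "a \<in> carrier R" "a \<notin> P" for a
  proof (rule ccontr)
    assume no: "\<not> ?thesis"
    let ?X = "P <+>\<^bsub>R\<^esub> PIdl a"
    have X: "ideal ?X R" by (rule add_ideals[OF P(1) cgenideal_ideal[OF a(1)]])
    have mem: "x \<in> ?X \<longleftrightarrow> (\<exists>q\<in>P. \<exists>y\<in>carrier R. x = q \<oplus> y \<otimes> a)" for x
      by (auto simp: set_add_def set_mult_def cgenideal_def)
    have PX: "P \<subseteq> ?X"
    proof
      fix q assume "q \<in> P"
      then have "q = q \<oplus> \<zero> \<otimes> a" using a by simp
      then show "q \<in> ?X" unfolding mem using \<open>q \<in> P\<close> by blast
    qed
    have "?X = P"
    proof (rule max[OF X])
      show "I \<subseteq> ?X" "P \<subseteq> ?X" using PX P(2) by auto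
      show "r [^] n \<notin> ?X" for n :: nat using no unfolding mem by blast
    qed
    moreover have "a \<in> ?X"
      unfolding mem using a by (intro bexI[of _ \<zero>] bexI[of _ \<one>]) auto
    ultimately show False using a by blast
  qed
  have "primeideal P R"
  proof (rule primeidealI[OF P(1) is_cring])
    show "carrier R \<noteq> P" using P(3)[of 0] one_closed by auto
    fix a b assume ab: "a \<in> carrier R" "b \<in> carrier R" "a \<otimes> b \<in> P"
    show "a \<in> P \<or> b \<in> P"
    proof (rule ccontr)
      assume "\<not> ?thesis"
      then have na: "a \<notin> P" and nb: "b \<notin> P" by auto
      from big[OF ab(1) na] obtain n :: nat and q y where
        n: "q \<in> P" "y \<in> carrier R" "r [^] n = q \<oplus> y \<otimes> a" by (elim exE bexE) rule
      from big[OF ab(2) nb] obtain k :: nat and q' y' where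
        k: "q' \<in> P" "y' \<in> carrier R" "r [^] k = q' \<oplus> y' \<otimes> b" by (elim exE bexE) rule
      have c: "q \<in> carrier R" "q' \<in> carrier R" using n(1) k(1) P.a_Hcarr by blast+
      have "r [^] (n + k) = (q \<oplus> y \<otimes> a) \<otimes> (q' \<oplus> y' \<otimes> b)"
        using r by (simp add: nat_pow_mult[symmetric] n k)
      also have "\<dots> = q \<otimes> (q' \<oplus> y' \<otimes> b) \<oplus> (y \<otimes> a \<otimes> q' \<oplus> (y \<otimes> y') \<otimes> (a \<otimes> b))"
        using c n(2) k(2) ab(1,2) by (simp add: l_distr r_distr m_ac a_ac)
      also have "\<dots> \<in> P"
        using P.I_r_closed[OF n(1), of "q' \<oplus> y' \<otimes> b"] P.I_l_closed[OF k(1), of "y \<otimes> a"]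
          P.I_l_closed[OF ab(3), of "y \<otimes> y'"] c n(2) k(2) ab(1,2) by (intro P.a_closed) auto
      finally show False using P(3) by blast
    qed
  qed
  moreover have "r \<notin> P" using P(3)[of 1] r by simp
  ultimately show ?thesis using that P(2) by blast
qed


section \<open>Saturated submodules of the normalization\<close>

text \<open>\<open>sat\<close> is saturation with respect to the maximal ideal, tested on the four
  variables. \<open>line\<close> is generation by one element at the generic point of an axis, with
  denominators cleared; one component suffices to test \<open>s\<close>, since elements of
  \<open>glue 1\<close> have a single restriction to the axis.\<close>

locale saturated_submodule =
  fixes G :: "(bool \<times> bool \<Rightarrow> 'k::field ps2) set"
  assumes add: "f \<in> G \<Longrightarrow> g \<in> G \<Longrightarrow> f + g \<in> G"
    and mult: "a \<in> glue 1 \<Longrightarrow> f \<in> G \<Longrightarrow> a * f \<in> G"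
    and sat: "(\<And>\<kappa> t. axial \<kappa> t (\<lambda>_. fps_X) * f \<in> G) \<Longrightarrow> f \<in> G"
    and line: "\<exists>b\<in>G. \<forall>z\<in>G. \<exists>s\<in>glue 1. \<exists>a\<in>glue 1. res \<kappa> (s (cmp \<kappa> t False)) \<noteq> 0 \<and> s * z = a * b"

text \<open>The normalized case: the projection of \<open>G\<close> to each component contains a
  power of each variable, so its saturation is the whole power series ring.\<close>

locale full_submodule = saturated_submodule +
  assumes pow: "\<exists>n. \<exists>f\<in>G. f c = vr \<kappa> ^ n"
begin

text \<open>Induction on the sum of the four exponents. If one of them is zero, the hypothesis is
  the claim; otherwise each variable times \<open>f\<close> satisfies the hypothesis with one
  exponent lowered, and \<open>sat\<close> applies.\<close>

lemma sat_power:
  assumes "\<And>\<kappa> t. axial \<kappa> t (\<lambda>_. fps_X) ^ n (\<kappa>, t) * f \<in> G"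
  shows "f \<in> G"
  using assms
proof (induction "sum n UNIV" arbitrary: n f rule: less_induct)
  case less
  show ?case
  proof (cases "\<exists>\<kappa> t. n (\<kappa>, t) = 0")
    case True
    then show ?thesis using less.prems by (metis power_0 mult_1)
  next
    case False
    show ?thesis
    proof (rule sat)
      fix \<kappa> t
      define n' where "n' = n((\<kappa>, t) := n (\<kappa>, t) - 1)"
      have pos: "n (\<kappa>, t) > 0" using False by simp
      have lt: "sum n' UNIV < sum n UNIV"
        by (rule sum_strict_mono_ex1) (use pos in \<open>auto simp: n'_def\<close>)
      show "axial \<kappa> t (\<lambda>_. fps_X) * f \<in> G"
      proof (rule less.hyps[OF lt])
        fix \<kappa>' t'
        show "axial \<kappa>' t' (\<lambda>_. fps_X) ^ n' (\<kappa>', t') * (axial \<kappa> t (\<lambda>_. fps_X) * f) \<in> G"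
        proof (cases "(\<kappa>', t') = (\<kappa>, t)")
          case True
          then have "axial \<kappa>' t' (\<lambda>_. fps_X) ^ n' (\<kappa>', t') * (axial \<kappa> t (\<lambda>_. fps_X) * f) =
             axial \<kappa> t (\<lambda>_. fps_X) ^ Suc (n (\<kappa>, t) - 1) * f"
            by (simp only: n'_def power_Suc2 mult.assoc prod.inject fun_upd_same)
          also have "\<dots> \<in> G" using less.prems[of \<kappa> t] pos by simp
          finally show ?thesis .
        next
          case False
          then have "n' (\<kappa>', t') = n (\<kappa>', t')" unfolding n'_def by (rule fun_upd_other)
          moreover have "axial \<kappa> t (\<lambda>_. fps_X) \<in> glue 1"
            by (rule axial_glue) auto
          ultimately show ?thesis
            using mult[OF _ less.prems[of \<kappa>' t'], of "axial \<kappa> t (\<lambda>_. fps_X)"] by (simp only: mult.left_commute)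
        qed
      qed
    qed
  qed
qed

text \<open>An element of \<open>G\<close> that is a power of the variable on \<open>c\<close> is
  multiplied by an element of \<open>A\<close> supported on \<open>c\<close>, which removes the
  other components.\<close>

lemma single_power: "\<exists>n. \<forall>m\<ge>n. \<forall>g. single c (edge * vr \<kappa> ^ m * g) \<in> G"
proof -
  obtain n f where f: "f \<in> G" "f c = vr \<kappa> ^ n" using pow by blast
  have "single c (edge * vr \<kappa> ^ m * g) \<in> G" if "m \<ge> n" for m g
  proof -
    have "single c (edge * (vr \<kappa> ^ (m - n) * g)) * f \<in> G"
      by (rule mult[OF single_edge_glue f(1)])
    moreover have m: "vr \<kappa> ^ m = vr \<kappa> ^ (m - n) * vr \<kappa> ^ n"
      using that by (simp flip: power_add)
    have "edge * vr \<kappa> ^ m * g = edge * (vr \<kappa> ^ (m - n) * g) * vr \<kappa> ^ n"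
      unfolding m by (simp only: mult_ac)
    ultimately show ?thesis by (simp only: single_times f(2))
  qed
  then show ?thesis by blast
qed

text \<open>The weights are read off from a local generator \<open>b\<close>. On both components
  \<open>z\<close> is related to \<open>b\<close> by the same two factors, because elements of
  \<open>A\<close> have one restriction to the axis; eliminating these factors gives the proportion.
  A zero restriction of \<open>b\<close> would contradict \<open>pow\<close>.\<close>

lemma line_weight:
  obtains b where "b \<in> G" "\<And>s. res \<kappa> (b (cmp \<kappa> t s)) \<noteq> 0"
    "\<And>z. z \<in> G \<Longrightarrow> res \<kappa> (z (cmp \<kappa> t False)) * res \<kappa> (b (cmp \<kappa> t True)) =
        res \<kappa> (z (cmp \<kappa> t True)) * res \<kappa> (b (cmp \<kappa> t False))"
proof -
  obtain b where b: "b \<in> G" and ex: "\<forall>z\<in>G. \<exists>s\<in>glue 1. \<exists>a\<in>glue 1.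
      res \<kappa> (s (cmp \<kappa> t False)) \<noteq> 0 \<and> s * z = a * b"
    using line by blast
  have ex': "\<exists>\<sigma> \<alpha>. \<sigma> \<noteq> 0 \<and> (\<forall>s. \<sigma> * res \<kappa> (z (cmp \<kappa> t s)) = \<alpha> * res \<kappa> (b (cmp \<kappa> t s)))"
    if "z \<in> G" for z
  proof -
    obtain \<sigma> \<alpha> where sa: "\<sigma> \<in> glue 1" "\<alpha> \<in> glue 1" "res \<kappa> (\<sigma> (cmp \<kappa> t False)) \<noteq> 0" "\<sigma> * z = \<alpha> * b"
      using ex \<open>z \<in> G\<close> by blast
    have "res \<kappa> (\<sigma> (cmp \<kappa> t False)) * res \<kappa> (z (cmp \<kappa> t s)) = res \<kappa> (\<alpha> (cmp \<kappa> t False)) * res \<kappa> (b (cmp \<kappa> t s))" for s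
    proof -
      have "res \<kappa> ((\<sigma> * z) (cmp \<kappa> t s)) = res \<kappa> ((\<alpha> * b) (cmp \<kappa> t s))"
        unfolding sa(4) ..
      then show ?thesis
        using glue_1D[OF sa(1), of \<kappa> t s False] glue_1D[OF sa(2), of \<kappa> t s False] by simp
    qed
    then show ?thesis using sa(3) by blast
  qed
  have "res \<kappa> (b (cmp \<kappa> t s)) \<noteq> 0" for s
  proof
    assume 0: "res \<kappa> (b (cmp \<kappa> t s)) = 0"
    obtain n f where f: "f \<in> G" "f (cmp \<kappa> t s) = vr \<kappa> ^ n" using pow by blast
    obtain \<sigma> \<alpha> where sa: "\<sigma> \<noteq> 0" "\<sigma> * res \<kappa> (f (cmp \<kappa> t s)) = \<alpha> * res \<kappa> (b (cmp \<kappa> t s))"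
      using ex'[OF f(1)] by blast
    then show False by (simp add: 0 f(2))
  qed
  moreover have "res \<kappa> (z (cmp \<kappa> t False)) * res \<kappa> (b (cmp \<kappa> t True)) =
        res \<kappa> (z (cmp \<kappa> t True)) * res \<kappa> (b (cmp \<kappa> t False))" if z: "z \<in> G" for z
  proof -
    obtain \<sigma> \<alpha> where sa: "\<sigma> \<noteq> 0" "\<And>s. \<sigma> * res \<kappa> (z (cmp \<kappa> t s)) = \<alpha> * res \<kappa> (b (cmp \<kappa> t s))"
      using ex'[OF z] by blast
    have "\<sigma> * (res \<kappa> (z (cmp \<kappa> t False)) * res \<kappa> (b (cmp \<kappa> t True))) =
      \<alpha> * res \<kappa> (b (cmp \<kappa> t False)) * res \<kappa> (b (cmp \<kappa> t True))"
      by (simp only: mult.assoc[symmetric] sa(2))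
    also have "\<dots> = \<sigma> * res \<kappa> (z (cmp \<kappa> t True)) * res \<kappa> (b (cmp \<kappa> t False))"
      by (simp only: sa(2) mult_ac)
    finally show ?thesis using sa(1) by (simp only: mult.assoc mult_left_cancel[OF sa(1)])
  qed
  ultimately show ?thesis using that b by blast
qed

text \<open>A converse of \<open>line_weight\<close> up to a power of the axis variable. After
  scaling, \<open>f\<close> agrees along the axis with a multiple of \<open>b\<close>; the
  difference is divisible by the transversal variable, so another factor of the axis variable makes
  it a multiple of \<open>edge\<close>, and \<open>single_power\<close> takes over. On the
  components away from the axis its variable is zero.\<close>

lemma axial_power_in:
  assumes b: "b \<in> G" "\<And>s. res \<kappa> (b (cmp \<kappa> t s)) \<noteq> 0"
    and f: "res \<kappa> (f (cmp \<kappa> t False)) * res \<kappa> (b (cmp \<kappa> t True)) =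
        res \<kappa> (f (cmp \<kappa> t True)) * res \<kappa> (b (cmp \<kappa> t False))"
  shows "\<exists>n. axial \<kappa> t (\<lambda>_. fps_X) ^ n * f \<in> G"
proof -
  let ?f = "\<lambda>s. res \<kappa> (f (cmp \<kappa> t s))" and ?b = "\<lambda>s. res \<kappa> (b (cmp \<kappa> t s))"
  obtain n1 n2 where "\<forall>m\<ge>n1. \<forall>g. single (cmp \<kappa> t False) (edge * vr \<kappa> ^ m * g) \<in> G"
      "\<forall>m\<ge>n2. \<forall>g. single (cmp \<kappa> t True) (edge * vr \<kappa> ^ m * g) \<in> G"
    using single_power by metis
  then have n: "single (cmp \<kappa> t s) (edge * vr \<kappa> ^ max n1 n2 * g) \<in> G" for s g
    by (cases s) auto
  define n where "n = max n1 n2"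
  obtain i a where a: "?b False = fps_X ^ i * a" "a $ 0 \<noteq> 0"
    using fps_X_power_unit_factor[OF b(2)] by metis
  \<comment> \<open>The quotient of \<open>?f False\<close> by \<open>?b False\<close> exists up to
    \<open>X^i\<close>. The same \<open>g\<close> works on the other component by the proportion
    assumed of \<open>f\<close>, once \<open>?b False\<close> is cancelled.\<close>
  define g where "g = ?f False * inverse a"
  have gF: "fps_X ^ i * ?f False = g * ?b False"
    using a by (simp add: g_def inverse_mult_eq_1' mult_ac)
  have "?b False * (fps_X ^ i * ?f True) = fps_X ^ i * (?f False * ?b True)"
    unfolding f by (simp only: mult_ac)
  also have "\<dots> = fps_X ^ i * ?f False * ?b True" by (simp only: mult.assoc)
  also have "\<dots> = ?b False * (g * ?b True)" unfolding gF by (simp only: mult_ac)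
  finally have gT: "fps_X ^ i * ?f True = g * ?b True" by (simp only: mult_left_cancel[OF b(2)])
  have "\<exists>q. vr \<kappa> ^ i * f (cmp \<kappa> t s) - emb \<kappa> g * b (cmp \<kappa> t s) = vr (\<not> \<kappa>) * q" for s
  proof -
    have "res \<kappa> (vr \<kappa> ^ i * f (cmp \<kappa> t s) - emb \<kappa> g * b (cmp \<kappa> t s)) = 0"
      using gF gT by (cases s) simp_all
    then show ?thesis by (metis res_eq_0D)
  qed
  then obtain q where q: "\<And>s. vr \<kappa> ^ i * f (cmp \<kappa> t s) = emb \<kappa> g * b (cmp \<kappa> t s) + vr (\<not> \<kappa>) * q s"
    by (metis diff_eq_eq add.commute)
  have edge: "vr \<kappa> * vr (\<not> \<kappa>) = edge" by (cases \<kappa>) (simp_all add: mult.commute)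
  let ?p = "axial \<kappa> t (\<lambda>_. fps_X ^ Suc n * g)"
  have axp: "axial \<kappa> t (\<lambda>_. fps_X) ^ Suc m = axial \<kappa> t (\<lambda>_. fps_X ^ Suc m)" for m
    by (induction m) (auto simp: axial_def fun_eq_iff emb_mult)
  \<comment> \<open>The exponent splits into \<open>i\<close> for the denominator, \<open>n\<close>
    for \<open>single_power\<close>, and one factor that completes the transversal variable to
    \<open>edge\<close>.\<close>
  have key: "vr \<kappa> ^ Suc (n + i) * f (cmp \<kappa> t s) = emb \<kappa> (fps_X ^ Suc n * g) * b (cmp \<kappa> t s) + edge * vr \<kappa> ^ n * q s" for s
  proof -
    have "vr \<kappa> ^ Suc (n + i) * f (cmp \<kappa> t s) = vr \<kappa> ^ Suc n * (vr \<kappa> ^ i * f (cmp \<kappa> t s))"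
      by (simp only: power_add mult.assoc power_Suc)
    also have "\<dots> = vr \<kappa> ^ Suc n * emb \<kappa> g * b (cmp \<kappa> t s) + (vr \<kappa> * vr (\<not> \<kappa>)) * vr \<kappa> ^ n * q s"
      unfolding q by (simp add: algebra_simps)
    finally show ?thesis unfolding edge by (simp only: emb_mult emb_power vr_def)
  qed
  have "axial \<kappa> t (\<lambda>_. fps_X) ^ Suc (n + i) * f = ?p * b +
     (single (cmp \<kappa> t False) (edge * vr \<kappa> ^ n * q False) + single (cmp \<kappa> t True) (edge * vr \<kappa> ^ n * q True))"
    (is "?L = ?R")
  proof
    fix c
    show "?L c = ?R c"
    proof (cases "ax \<kappa> c = t")
      case True
      obtain s where c: "c = cmp \<kappa> t s"
        using that[of "ax (\<not> \<kappa>) c"] unfolding True[symmetric] by simp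
      have "?L c = vr \<kappa> ^ Suc (n + i) * f c"
        unfolding axp using True by (simp only: axial_def times_fun_apply emb_power vr_def simp_thms if_True)
      also have "\<dots> = emb \<kappa> (fps_X ^ Suc n * g) * b c + edge * vr \<kappa> ^ n * q s"
        unfolding c by (rule key)
      also have "emb \<kappa> (fps_X ^ Suc n * g) * b c = (?p * b) c"
        using True by (simp only: axial_def times_fun_apply simp_thms if_True)
      also have "edge * vr \<kappa> ^ n * q s = (single (cmp \<kappa> t False) (edge * vr \<kappa> ^ n * q False) + single (cmp \<kappa> t True) (edge * vr \<kappa> ^ n * q True)) c"
        unfolding c by (cases s) (simp_all add: single_def)
      finally show ?thesis by (simp only: plus_fun_apply)
    next
      case False
      then have "c \<noteq> cmp \<kappa> t s" for s by auto
      then show ?thesis unfolding axp using False by (auto simp: axial_def single_def)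
    qed
  qed
  also have "\<dots> \<in> G"
  proof (intro add mult b(1))
    show "?p \<in> glue 1" by (rule axial_glue) auto
  qed (use n in \<open>auto simp: n_def\<close>)
  finally show ?thesis by blast
qed

text \<open>The inclusion of \<open>glue w\<close> in \<open>G\<close> passes from local to global:
  right proportions put a quadruple into \<open>G\<close> after multiplication by a power of each
  axis variable, with its own exponent on every axis, and \<open>sat_power\<close> removes these
  powers.\<close>

lemma eq_glue: obtains w where "\<And>\<kappa> t s. w \<kappa> t s \<noteq> 0" "G = glue w"
proof -
  have "\<exists>b. b \<in> G \<and> (\<forall>s. res \<kappa> (b (cmp \<kappa> t s)) \<noteq> 0) \<and>
    (\<forall>z\<in>G. res \<kappa> (z (cmp \<kappa> t False)) * res \<kappa> (b (cmp \<kappa> t True)) =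
        res \<kappa> (z (cmp \<kappa> t True)) * res \<kappa> (b (cmp \<kappa> t False)))" for \<kappa> t
    by (rule line_weight[of \<kappa> t]) blast
  then obtain b where b: "\<And>\<kappa> t. b \<kappa> t \<in> G" "\<And>\<kappa> t s. res \<kappa> (b \<kappa> t (cmp \<kappa> t s)) \<noteq> 0"
    "\<And>\<kappa> t z. z \<in> G \<Longrightarrow> res \<kappa> (z (cmp \<kappa> t False)) * res \<kappa> (b \<kappa> t (cmp \<kappa> t True)) =
        res \<kappa> (z (cmp \<kappa> t True)) * res \<kappa> (b \<kappa> t (cmp \<kappa> t False))"
    by metis
  define w where "w \<kappa> t s = res \<kappa> (b \<kappa> t (cmp \<kappa> t s))" for \<kappa> t s
  have "G \<subseteq> glue w" using b(3) by (auto simp: glue_def w_def)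
  moreover have "glue w \<subseteq> G"
  proof
    fix f assume f: "f \<in> glue w"
    have ex: "\<exists>n. axial \<kappa> t (\<lambda>_. fps_X) ^ n * f \<in> G" for \<kappa> t
      by (rule axial_power_in[OF b(1,2)]) (use f in \<open>simp add: glue_def w_def\<close>)
    define n where "n p = (SOME n. axial (fst p) (snd p) (\<lambda>_. fps_X) ^ n * f \<in> G)" for p
    have "axial \<kappa> t (\<lambda>_. fps_X) ^ n (\<kappa>, t) * f \<in> G" for \<kappa> t
      unfolding n_def fst_conv snd_conv by (rule someI_ex[OF ex])
    then show "f \<in> G" by (rule sat_power)
  qed
  ultimately show ?thesis using that[of w] b(2) by (simp add: w_def)
qed

end

context saturated_submodule
begin

text \<open>In the proof, \<open>L\<close> is the saturation of the projection of \<open>G\<close>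
  to the component: for each variable, some power of it carries the series into the projection. It
  is an ideal because \<open>A\<close> maps onto the component, and being saturated it is
  principal.\<close>

lemma component_ideal:
  assumes "\<exists>f\<in>G. f c \<noteq> 0"
  obtains h where "h \<noteq> 0" "\<And>f. f \<in> G \<Longrightarrow> h dvd f c" "\<And>\<kappa>. \<exists>n. \<exists>f\<in>G. f c = vr \<kappa> ^ n * h"
proof -
  define L where "L = {g. \<forall>\<kappa>. \<exists>n. \<exists>f\<in>G. f c = vr \<kappa> ^ n * g}"
  have scale: "\<exists>f'\<in>G. f' c = g * f c" if "f \<in> G" for f g
  proof -
    obtain a where "a \<in> carrier ringA" "rho a c = g" by (rule rho_lift)
    then have "rho a * f \<in> G" "(rho a * f) c = g * f c" using mult rho_glue that by auto
    then show ?thesis by blast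
  qed
  have sub: "f c \<in> L" if "f \<in> G" for f
    unfolding L_def using that by (auto intro!: exI[of _ 0])
  obtain f0 where f0: "f0 \<in> G" "f0 c \<noteq> 0" using assms by blast
  have Ladd: "f + g \<in> L" if fg: "f \<in> L" "g \<in> L" for f g
    unfolding L_def
  proof (rule, rule)
    fix \<kappa>
    obtain n f' where f': "f' \<in> G" "f' c = vr \<kappa> ^ n * f"
      using fg(1) unfolding L_def by blast
    obtain m g' where g': "g' \<in> G" "g' c = vr \<kappa> ^ m * g"
      using fg(2) unfolding L_def by blast
    obtain f'' where f'': "f'' \<in> G" "f'' c = vr \<kappa> ^ m * (vr \<kappa> ^ n * f)"
      using scale[OF f'(1), of "vr \<kappa> ^ m"] f'(2) by auto
    obtain g'' where g'': "g'' \<in> G" "g'' c = vr \<kappa> ^ n * (vr \<kappa> ^ m * g)"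
      using scale[OF g'(1), of "vr \<kappa> ^ n"] g'(2) by auto
    have "(f'' + g'') c = vr \<kappa> ^ (n + m) * (f + g)"
      by (simp add: f'' g'' power_add algebra_simps)
    then show "\<exists>n. \<exists>h\<in>G. h c = vr \<kappa> ^ n * (f + g)" using add[OF f''(1) g''(1)] by blast
  qed
  have Lmult: "g * f \<in> L" if f: "f \<in> L" for f g
    unfolding L_def
  proof (rule, rule)
    fix \<kappa>
    obtain n f' where *: "f' \<in> G" "f' c = vr \<kappa> ^ n * f" using f unfolding L_def by blast
    obtain f'' where f'': "f'' \<in> G" "f'' c = g * (vr \<kappa> ^ n * f)"
      using scale[OF *(1), of g] *(2) by auto
    then have "f'' c = vr \<kappa> ^ n * (g * f)" by (simp only: mult.left_commute)
    then show "\<exists>n. \<exists>h\<in>G. h c = vr \<kappa> ^ n * (g * f)" using f''(1) by blast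
  qed
  have Lsat: "f \<in> L" if "vr False * f \<in> L" "vr True * f \<in> L" for f
    unfolding L_def
  proof (rule, rule)
    fix \<kappa>
    have "vr \<kappa> * f \<in> L" using that by (cases \<kappa>) simp_all
    then obtain n f' where *: "f' \<in> G" "f' c = vr \<kappa> ^ n * (vr \<kappa> * f)" unfolding L_def by blast
    then have "f' c = vr \<kappa> ^ Suc n * f" by (simp only: power_Suc2 mult.assoc)
    then show "\<exists>n. \<exists>h\<in>G. h c = vr \<kappa> ^ n * f" using *(1) by blast
  qed
  obtain h where h: "h \<noteq> 0" "L = range (\<lambda>a. h * a)"
    using saturated_ideal_principal[OF sub[OF f0(1)] f0(2) Ladd Lmult Lsat] by blast
  have "h * 1 \<in> L" unfolding h(2) by (rule rangeI)
  then have "\<exists>n. \<exists>f\<in>G. f c = vr \<kappa> ^ n * h" for \<kappa> unfolding L_def by simp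
  moreover have "h dvd f c" if "f \<in> G" for f
    using sub[OF that] unfolding h(2) by auto
  ultimately show ?thesis using that h(1) by blast
qed

text \<open>Dividing each component by the generator \<open>h\<close> of its saturated ideal yields
  a \<open>full_submodule\<close>; the closure properties survive because \<open>h\<close> is
  nonzero on every component.\<close>

lemma scaled_glue:
  assumes "\<And>c. \<exists>f\<in>G. f c \<noteq> 0"
  obtains h w where "\<And>c. h c \<noteq> 0" "\<And>\<kappa> t s. w \<kappa> t s \<noteq> 0" "G = (\<lambda>f. h * f) ` glue w"
proof -
  have "\<exists>h. h \<noteq> 0 \<and> (\<forall>f\<in>G. h dvd f c) \<and> (\<forall>\<kappa>. \<exists>n. \<exists>f\<in>G. f c = vr \<kappa> ^ n * h)" for c
    by (rule component_ideal[OF assms[of c]]) blast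
  then obtain h where h: "\<And>c. h c \<noteq> 0" "\<And>c f. f \<in> G \<Longrightarrow> h c dvd f c"
    "\<And>c \<kappa>. \<exists>n. \<exists>f\<in>G. f c = vr \<kappa> ^ n * h c"
    by metis
  define G' where "G' = {f. h * f \<in> G}"
  have div: "\<exists>f'\<in>G'. f = h * f'" if "f \<in> G" for f
  proof -
    have "\<forall>c. \<exists>q. f c = h c * q" using h(2)[OF that] unfolding dvd_def by simp
    then obtain f' where "\<And>c. f c = h c * f' c" by metis
    then have "f = h * f'" by auto
    then show ?thesis using that unfolding G'_def by blast
  qed
  have cancel: "f = g" if "h * f = h * g" for f g :: "bool \<times> bool \<Rightarrow> 'k ps2"
  proof
    fix c
    have "(h * f) c = (h * g) c" using that by simp
    then show "f c = g c" using h(1)[of c] by simp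
  qed
  interpret G': full_submodule G'
  proof
    show "f + g \<in> G'" if "f \<in> G'" "g \<in> G'" for f g
      using that add by (simp add: G'_def distrib_left)
    show "a * f \<in> G'" if "a \<in> glue 1" "f \<in> G'" for a f
      using that mult[of a "h * f"] by (simp add: G'_def mult.left_commute)
    show "f \<in> G'" if "\<And>\<kappa> t. axial \<kappa> t (\<lambda>_. fps_X) * f \<in> G'" for f
      using that sat[of "h * f"] by (simp add: G'_def mult.left_commute)
    show "\<exists>b\<in>G'. \<forall>z\<in>G'. \<exists>s\<in>glue 1. \<exists>a\<in>glue 1. res \<kappa> (s (cmp \<kappa> t False)) \<noteq> 0 \<and> s * z = a * b" for \<kappa> t
    proof -
      obtain b where b: "b \<in> G" "\<forall>z\<in>G. \<exists>s\<in>glue 1. \<exists>a\<in>glue 1. res \<kappa> (s (cmp \<kappa> t False)) \<noteq> 0 \<and> s * z = a * b"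
        using line by blast
      obtain b' where b': "b' \<in> G'" "b = h * b'" using div[OF b(1)] by blast
      have "\<exists>s\<in>glue 1. \<exists>a\<in>glue 1. res \<kappa> (s (cmp \<kappa> t False)) \<noteq> 0 \<and> s * z = a * b'" if "z \<in> G'" for z
      proof -
        have "h * z \<in> G" using that by (simp add: G'_def)
        then obtain s a where sa: "s \<in> glue 1" "a \<in> glue 1" "res \<kappa> (s (cmp \<kappa> t False)) \<noteq> 0" "s * (h * z) = a * (h * b')"
          using b(2) unfolding b'(2) by blast
        have "s * z = a * b'"
          by (rule cancel) (use sa(4) in \<open>simp only: mult.left_commute\<close>)
        then show ?thesis using sa by blast
      qed
      then show ?thesis using b'(1) by blast
    qed
    show "\<exists>n. \<exists>f\<in>G'. f c = vr \<kappa> ^ n" for c \<kappa>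
    proof -
      obtain n f where f: "f \<in> G" "f c = vr \<kappa> ^ n * h c" using h(3) by blast
      obtain f' where f': "f' \<in> G'" "f = h * f'" using div[OF f(1)] by blast
      have "h c * f' c = h c * vr \<kappa> ^ n" using f(2) f'(2) by (simp add: mult.commute)
      then have "f' c = vr \<kappa> ^ n" using h(1)[of c] by simp
      then show ?thesis using f'(1) by blast
    qed
  qed
  obtain w where w: "\<And>\<kappa> t s. w \<kappa> t s \<noteq> 0" "G' = glue w" by (rule G'.eq_glue, rule that)
  have "G = (\<lambda>f. h * f) ` G'"
    using div by (auto simp: G'_def)
  then show ?thesis by (intro that[of h w] h(1) w(1)) (simp only: w(2))
qed

end


section \<open>The modules in the family\<close>

text \<open>In the generators the first exponent goes with the next variable in the cycle x, u, y,
  v, whereas \<open>s\<close> always counts \<open>x\<close> before \<open>y\<close> and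
  \<open>u\<close> before \<open>v\<close>. Hence the exchanged indices on the axes of
  \<open>u\<close> and \<open>y\<close>.\<close>

fun expo :: "weights \<Rightarrow> bool \<Rightarrow> bool \<Rightarrow> bool \<Rightarrow> int" where
  "expo ((m1, m2), (n1, n2), (p1, p2), (q1, q2)) \<kappa> t s =
     (if \<kappa> then if t then if s then q2 else q1 else if s then n1 else n2
      else if t then if s then p1 else p2 else if s then m2 else m1)"

definition unit_part :: "'k::field \<Rightarrow> bool \<Rightarrow> bool \<Rightarrow> bool \<Rightarrow> 'k" where
  "unit_part l \<kappa> t s = (if \<not> \<kappa> \<and> \<not> t \<and> s then l else 1)"

text \<open>The exponent is one less than in the generator of the ideal: the remaining factor
  belongs to \<open>edge\<close>.\<close>

definition weight :: "weights \<Rightarrow> 'k::field \<Rightarrow> bool \<Rightarrow> bool \<Rightarrow> bool \<Rightarrow> 'k fps" where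
  "weight w l \<kappa> t s = fps_const (unit_part l \<kappa> t s) * fps_X ^ nat (expo w \<kappa> t s)"

lemma admissible_iff: "admissible_weights w \<longleftrightarrow> (\<forall>\<kappa> t. min (expo w \<kappa> t False) (expo w \<kappa> t True) = 1)"
  by (cases w rule: admissible_weights.cases) (auto simp: all_bool_eq min_def)

lemma expo_inj: "expo w = expo w' \<longleftrightarrow> w = w'"
  by (cases w rule: admissible_weights.cases; cases w' rule: admissible_weights.cases) (auto simp: fun_eq_iff all_bool_eq)

lemma expo_surj: obtains w where "expo w = e"
proof -
  have "expo ((e False False False, e False False True), (e True False True, e True False False),
      (e False True True, e False True False), (e True True False, e True True True)) = e"
    by (simp add: fun_eq_iff all_bool_eq)
  then show ?thesis using that by blast
qed

lemma good_weight_weight: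
  assumes "admissible_weights w" "l \<noteq> 0"
  shows "good_weight (weight w l)"
proof -
  have "expo w \<kappa> t s \<ge> 1" for \<kappa> t s
  proof -
    have "min (expo w \<kappa> t False) (expo w \<kappa> t True) = 1" using assms(1) admissible_iff by blast
    then show ?thesis by (cases s) (auto simp: min_def split: if_splits)
  qed
  then have "\<not> expo w \<kappa> t s \<le> 0" for \<kappa> t s
    by (metis int_one_le_iff_zero_less not_le)
  then show ?thesis
    using assms(2) by (simp add: good_weight_def weight_def unit_part_def)
qed

text \<open>A unit quadruple \<open>\<epsilon>\<close> absorbs the unit parts of the weights up to
  constants, a common shift of the two orders on an axis leaves their ratio unchanged, and constants
  on the components absorb all remaining constants but one.\<close>

lemma normalize_weight:
  fixes \<beta> :: "bool \<Rightarrow> bool \<Rightarrow> bool \<Rightarrow> 'k::field fps"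
  assumes nz: "\<And>\<kappa> t s. \<beta> \<kappa> t s \<noteq> 0"
  obtains w l \<epsilon> where "admissible_weights w" "l \<noteq> 0" "\<And>c. \<epsilon> c $ 0 $ 0 \<noteq> 0"
    "\<And>f. \<epsilon> * f \<in> glue \<beta> \<longleftrightarrow> f \<in> glue (weight w l)"
proof -
  define i where "i \<kappa> t s = subdegree (\<beta> \<kappa> t s)" for \<kappa> t s
  have "\<exists>a. \<beta> \<kappa> t s = fps_X ^ i \<kappa> t s * a \<and> a $ 0 \<noteq> 0" for \<kappa> t s
    unfolding i_def by (rule fps_X_power_unit_factor[OF nz]) blast
  then obtain \<alpha> where \<alpha>: "\<And>\<kappa> t s. \<beta> \<kappa> t s = fps_X ^ i \<kappa> t s * \<alpha> \<kappa> t s" "\<And>\<kappa> t s. \<alpha> \<kappa> t s $ 0 \<noteq> 0"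
    by metis
  define \<delta> where "\<delta> \<kappa> t s = \<alpha> \<kappa> t s $ 0" for \<kappa> t s
  have \<delta>: "\<delta> \<kappa> t s \<noteq> 0" for \<kappa> t s by (simp add: \<delta>_def \<alpha>)
  have \<alpha>0: "\<alpha> \<kappa> t s \<noteq> 0" for \<kappa> t s using \<alpha>(2)[of \<kappa> t s] by auto
  \<comment> \<open>Only the difference of the two orders matters; the summand 1 makes the smaller
    exponent 1, as admissibility demands.\<close>
  define e where "e \<kappa> t s = int (i \<kappa> t s) - int (min (i \<kappa> t False) (i \<kappa> t True)) + 1" for \<kappa> t s
  obtain w where w: "expo w = e" by (rule expo_surj)
  have adm: "admissible_weights w"
    unfolding admissible_iff w by (auto simp: e_def min_def)
  have ie: "fps_X ^ Suc (i \<kappa> t s) = (fps_X :: 'k fps) ^ min (i \<kappa> t False) (i \<kappa> t True) * fps_X ^ nat (e \<kappa> t s)" for \<kappa> t s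
  proof -
    have "Suc (i \<kappa> t s) = min (i \<kappa> t False) (i \<kappa> t True) + nat (e \<kappa> t s)"
      by (cases s) (auto simp: e_def)
    then show ?thesis by (simp only: power_add)
  qed
  text \<open>Constants on the components are propagated along the chain of axes \<open>u\<close>, \<open>y\<close>, \<open>v\<close>;
    the mismatch on the remaining axis \<open>x\<close> is \<open>l\<close>.\<close>
  define \<gamma>1 where "\<gamma>1 = \<delta> True False True / \<delta> True False False"
  define \<gamma>2 where "\<gamma>2 = \<gamma>1 * \<delta> False True True / \<delta> False True False"
  define \<gamma>3 where "\<gamma>3 = \<gamma>2 * \<delta> True True False / \<delta> True True True"
  define l where "l = \<delta> False False True / (\<gamma>3 * \<delta> False False False)"
  define \<gamma> where "\<gamma> c = (if fst c then if snd c then \<gamma>2 else \<gamma>1 else if snd c then \<gamma>3 else 1)" for c :: "bool \<times> bool"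
  have \<gamma>123: "\<gamma>1 \<noteq> 0" "\<gamma>2 \<noteq> 0" "\<gamma>3 \<noteq> 0" by (simp_all add: \<gamma>1_def \<gamma>2_def \<gamma>3_def \<delta>)
  have l: "l \<noteq> 0" by (simp add: l_def \<gamma>123 \<delta>)
  have \<gamma>0: "\<gamma> c \<noteq> 0" for c by (simp add: \<gamma>_def \<gamma>123)
  have \<gamma>: "\<gamma> (cmp \<kappa> t False) * \<delta> \<kappa> t True = \<gamma> (cmp \<kappa> t True) * \<delta> \<kappa> t False * unit_part l \<kappa> t True" for \<kappa> t
    using \<delta> \<gamma>123 by (cases \<kappa>; cases t) (simp_all add: \<gamma>_def cmp_def unit_part_def l_def, simp_all add: \<gamma>1_def \<gamma>2_def \<gamma>3_def)
  \<comment> \<open>Scaled to constant term 1, so that in \<open>\<epsilon>\<close> the factor for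
    one axis restricts to 1 on the other and both axes of a component are adjusted
    independently.\<close>
  define a where "a \<kappa> c = fps_const (inverse (\<delta> \<kappa> (ax \<kappa> c) (ax (\<not> \<kappa>) c))) * \<alpha> \<kappa> (ax \<kappa> c) (ax (\<not> \<kappa>) c)" for \<kappa> c
  have a0: "a \<kappa> c $ 0 = 1" for \<kappa> c using \<delta> by (simp add: a_def \<delta>_def \<alpha>(2))
  define \<epsilon> where "\<epsilon> c = fps_const (fps_const (\<gamma> c)) * (emb False (a False c) * emb True (a True c))" for c
  have res\<epsilon>: "res \<kappa> (\<epsilon> c) = fps_const (\<gamma> c) * a \<kappa> c" for \<kappa> c
  proof -
    have "res \<kappa> (fps_const (fps_const (\<gamma> c))) = fps_const (\<gamma> c)"
      by (auto simp: res_def fps_eq_iff)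
    then show ?thesis by (cases \<kappa>) (simp_all add: \<epsilon>_def a0)
  qed
  have \<epsilon>0: "\<epsilon> c $ 0 $ 0 \<noteq> 0" for c
    using res_nth_0[of False "\<epsilon> c"] \<gamma>0[of c] by (simp add: res\<epsilon> a0)
  have "res \<kappa> ((\<epsilon> * f) (cmp \<kappa> t False)) * \<beta> \<kappa> t True = res \<kappa> ((\<epsilon> * f) (cmp \<kappa> t True)) * \<beta> \<kappa> t False
    \<longleftrightarrow> res \<kappa> (f (cmp \<kappa> t False)) * weight w l \<kappa> t True = res \<kappa> (f (cmp \<kappa> t True)) * weight w l \<kappa> t False"
    (is "?P \<longleftrightarrow> ?Q") for f \<kappa> t
  proof -
    let ?f = "\<lambda>s. res \<kappa> (f (cmp \<kappa> t s))" and ?C = "fps_const :: 'k \<Rightarrow> 'k fps"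
    let ?g = "\<lambda>s. \<gamma> (cmp \<kappa> t s)" and ?d = "\<delta> \<kappa> t" and ?m = "min (i \<kappa> t False) (i \<kappa> t True)"
    let ?U = "?C (inverse (?d False)) * ?C (inverse (?d True)) * \<alpha> \<kappa> t False * \<alpha> \<kappa> t True"
    let ?u = "?C (?g True * ?d False)"
    have d: "?C (inverse (?d s)) * ?C (?d s) = 1" for s by (simp add: \<delta>)
    have L: "res \<kappa> ((\<epsilon> * f) (cmp \<kappa> t s)) * \<beta> \<kappa> t (\<not> s) = ?U * (?f s * fps_X ^ i \<kappa> t (\<not> s) * ?C (?g s * ?d (\<not> s)))" for s
    proof -
      have "res \<kappa> ((\<epsilon> * f) (cmp \<kappa> t s)) * \<beta> \<kappa> t (\<not> s) =
         ?C (?g s) * (?C (inverse (?d s)) * \<alpha> \<kappa> t s) * ?f s * (fps_X ^ i \<kappa> t (\<not> s) * \<alpha> \<kappa> t (\<not> s))"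
        by (simp add: res\<epsilon> a_def \<alpha>(1))
      also have "\<dots> = ?C (?g s) * (?C (inverse (?d s)) * \<alpha> \<kappa> t s) * ?f s * (fps_X ^ i \<kappa> t (\<not> s) * \<alpha> \<kappa> t (\<not> s))
          * (?C (inverse (?d (\<not> s))) * ?C (?d (\<not> s)))"
        unfolding d by simp
      also have "\<dots> = (?C (inverse (?d s)) * ?C (inverse (?d (\<not> s))) * \<alpha> \<kappa> t s * \<alpha> \<kappa> t (\<not> s)) *
          (?f s * fps_X ^ i \<kappa> t (\<not> s) * (?C (?g s) * ?C (?d (\<not> s))))"
        by (simp only: mult_ac)
      also have "?C (inverse (?d s)) * ?C (inverse (?d (\<not> s))) * \<alpha> \<kappa> t s * \<alpha> \<kappa> t (\<not> s) = ?U"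
        by (cases s) (simp_all only: simp_thms mult_ac)
      finally show ?thesis by simp
    qed
    have U: "?U \<noteq> 0" using \<alpha>0 \<delta> by simp
    have u: "?u \<noteq> 0" using \<gamma>0 \<delta> by simp
    have "?P \<longleftrightarrow> ?U * (?f False * fps_X ^ i \<kappa> t True * ?C (?g False * ?d True)) = ?U * (?f True * fps_X ^ i \<kappa> t False * ?u)"
      by (simp only: L[of False, unfolded not_False_eq_True] L[of True, unfolded not_True_eq_False])
    also have "\<dots> \<longleftrightarrow> ?f False * fps_X ^ i \<kappa> t True * ?C (?g False * ?d True) = ?f True * fps_X ^ i \<kappa> t False * ?u"
      using U mult_left_cancel by blast
    \<comment> \<open>The extra \<open>X\<close> matches the shift by one in \<open>e\<close>: it is
      \<open>X^(i+1)\<close>, not \<open>X^i\<close>, that \<open>ie\<close> factors.\<close>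
    also have "\<dots> \<longleftrightarrow> fps_X * (?f False * fps_X ^ i \<kappa> t True * ?C (?g False * ?d True)) = fps_X * (?f True * fps_X ^ i \<kappa> t False * ?u)"
      by simp
    also have "fps_X * (?f False * fps_X ^ i \<kappa> t True * ?C (?g False * ?d True)) =
       ?f False * (fps_X ^ Suc (i \<kappa> t True)) * (?u * ?C (unit_part l \<kappa> t True))"
      unfolding \<gamma> by (simp add: mult_ac)
    also have "\<dots> = (fps_X ^ ?m * ?u) * (?f False * weight w l \<kappa> t True)"
      unfolding ie weight_def w by (simp only: mult_ac)
    also have "fps_X * (?f True * fps_X ^ i \<kappa> t False * ?u) = ?f True * fps_X ^ Suc (i \<kappa> t False) * ?u"
      by (simp add: mult_ac)
    also have "\<dots> = (fps_X ^ ?m * ?u) * (?f True * weight w l \<kappa> t False)"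
      unfolding ie weight_def w by (simp add: unit_part_def mult_ac)
    also have "(fps_X ^ ?m * ?u) * (?f False * weight w l \<kappa> t True) = (fps_X ^ ?m * ?u) * (?f True * weight w l \<kappa> t False) \<longleftrightarrow> ?Q"
      using u by simp
    finally show ?thesis .
  qed
  then have "\<epsilon> * f \<in> glue \<beta> \<longleftrightarrow> f \<in> glue (weight w l)" for f
    by (simp add: glue_def)
  then show ?thesis using that[of w l \<epsilon>] adm l \<epsilon>0 by blast
qed

lemma power_fun_apply: "(f ^ n) x = (f x ^ n :: 'b::monoid_mult)"
  by (induction n) auto

text \<open>In the proof, \<open>K\<close> collects the elements of \<open>A\<close> that are
  \<open>E\<close> times a member of \<open>glue (weight w l)\<close>. It is an ideal containing the
  generators, so division by \<open>E\<close> is defined on the whole ideal and turns the generators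
  into the eight elements that \<open>frac_rep\<close> asks for.\<close>

lemma ideal_wl_frac_rep:
  fixes l :: "'k::field"
  assumes w: "admissible_weights w" "l \<noteq> 0"
  obtains j where "frac_rep (ideal_mod ringA (ideal_wl w l)) j (weight w l)"
proof -
  define E :: "bool \<times> bool \<Rightarrow> 'k ps2" where "E = (\<lambda>_. edge)"
  define K where "K = {a \<in> carrier (ringA :: 'k ps4 set ring). \<exists>f\<in>glue (weight w l). rho a = E * f}"
  obtain m1 m2 n1 n2 p1 p2 q1 q2 where wd: "w = ((m1, m2), (n1, n2), (p1, p2), (q1, q2))"
    by (cases w rule: admissible_weights.cases)
  have ge: "m1 \<ge> 1" "m2 \<ge> 1" "n1 \<ge> 1" "n2 \<ge> 1" "p1 \<ge> 1" "p2 \<ge> 1" "q1 \<ge> 1" "q2 \<ge> 1"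
    using w(1) unfolding wd by (auto simp: min_def split: if_splits)
  have nat1: "nat (z + 1) = Suc (nat z)" if "z \<ge> 1" for z using that by simp
  let ?gx = "toA (ps_x ^ nat (m1 + 1) * ps_u + ps_const l * ps_x ^ nat (m2 + 1) * ps_v)"
  let ?gu = "toA (ps_u ^ nat (n1 + 1) * ps_y + ps_u ^ nat (n2 + 1) * ps_x) :: 'k ps4 set"
  let ?gy = "toA (ps_y ^ nat (p1 + 1) * ps_v + ps_y ^ nat (p2 + 1) * ps_u) :: 'k ps4 set"
  let ?gv = "toA (ps_v ^ nat (q1 + 1) * ps_x + ps_v ^ nat (q2 + 1) * ps_y) :: 'k ps4 set"
  define j0 :: "bool \<times> bool \<Rightarrow> 'k ps4 set" where "j0 c = toA (((if fst c then ps_y else ps_x) * (if snd c then ps_v else ps_u)) ^ 2)" for c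
  define g where "g \<kappa> t = (if \<kappa> then if t then ?gv else ?gu else if t then ?gy else ?gx)" for \<kappa> t
  have J: "idealJ = Idl\<^bsub>ringA\<^esub> (range j0)"
  proof -
    have "range j0 = j0 ` {(False, False), (False, True), (True, False), (True, True)}"
      by (rule arg_cong[where f = "image j0"]) auto
    then show ?thesis by (simp add: idealJ_def j0_def)
  qed
  have I: "ideal_wl w l = Idl\<^bsub>ringA\<^esub> (idealJ \<union> range (\<lambda>(\<kappa>, t). g \<kappa> t))"
  proof -
    have "range (\<lambda>(\<kappa>, t). g \<kappa> t) = (\<lambda>(\<kappa>, t). g \<kappa> t) ` {(False, False), (True, False), (False, True), (True, True)}"
      by (rule arg_cong[where f = "image _"]) auto
    then show ?thesis by (simp add: wd g_def)
  qed
  have rj0: "rho (j0 c) = E * single c edge" for c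
    by (rule ext; cases c; cases "fst c"; cases "snd c")
      (auto simp: j0_def comps_mult comps_var E_def single_def power2_eq_square mult_ac)
  have rg: "rho (g \<kappa> t) = E * axial \<kappa> t (weight w l \<kappa> t)" for \<kappa> t
  proof
    fix c :: "bool \<times> bool"
    have e: "emb \<kappa> (fps_const d * fps_X ^ n) = fps_const (fps_const d) * vr \<kappa> ^ n" for \<kappa> n and d :: 'k
      by (auto simp: emb_mult emb_power vr_def) (auto simp: emb_def fps_eq_iff)
    have e1: "emb \<kappa> (fps_X ^ n) = (vr \<kappa> ^ n :: 'k ps2)" for \<kappa> n
      by (simp add: emb_power vr_def)
    show "rho (g \<kappa> t) c = (E * axial \<kappa> t (weight w l \<kappa> t)) c"
      using ge by (cases c; cases \<kappa>; cases t; cases "fst c"; cases "snd c")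
        (simp_all add: g_def E_def axial_def ax_def weight_def unit_part_def wd e e1 nat1 power_fun_apply
          comps_add comps_mult comps_power comps_var comps_const mult_ac)
  qed
  have gc: "j0 c \<in> carrier ringA" "g \<kappa> t \<in> carrier ringA" for c \<kappa> t
    by (auto simp: j0_def g_def)
  have KI: "ideal K ringA"
  proof (rule idealI[OF A.ring_axioms])
    show "subgroup K (add_monoid ringA)"
    proof (rule A.add.subgroupI)
      show "K \<subseteq> carrier ringA" by (auto simp: K_def)
      have "\<zero>\<^bsub>ringA\<^esub> \<in> K" using glue_0 by (force simp: K_def intro: bexI[of _ 0])
      then show "K \<noteq> {}" by blast
      show "\<ominus>\<^bsub>ringA\<^esub> a \<in> K" if "a \<in> K" for a
      proof -
        obtain f where f: "a \<in> carrier ringA" "f \<in> glue (weight w l)" "rho a = E * f"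
          using \<open>a \<in> K\<close> by (auto simp: K_def)
        then have "rho (\<ominus>\<^bsub>ringA\<^esub> a) = E * (0 - f)" "0 - f \<in> glue (weight w l)"
          using glue_diff[OF glue_0] by (simp_all add: fun_eq_iff)
        then show ?thesis using A.a_inv_closed[OF f(1)] unfolding K_def by blast
      qed
      show "a \<oplus>\<^bsub>ringA\<^esub> b \<in> K" if "a \<in> K" "b \<in> K" for a b
      proof -
        obtain f h where f: "a \<in> carrier ringA" "f \<in> glue (weight w l)" "rho a = E * f"
          "b \<in> carrier ringA" "h \<in> glue (weight w l)" "rho b = E * h"
          using \<open>a \<in> K\<close> \<open>b \<in> K\<close> by (auto simp: K_def)
        then have "rho (a \<oplus>\<^bsub>ringA\<^esub> b) = E * (f + h)" by (simp add: distrib_left)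
        then show ?thesis using f glue_add by (auto simp: K_def)
      qed
    qed
    show 1: "x \<otimes>\<^bsub>ringA\<^esub> a \<in> K" if ax: "a \<in> K" "x \<in> carrier ringA" for a x
    proof -
      obtain f where f: "a \<in> carrier ringA" "f \<in> glue (weight w l)" "rho a = E * f"
        using ax by (auto simp: K_def)
      then have "rho (x \<otimes>\<^bsub>ringA\<^esub> a) = E * (rho x * f)" using ax by (simp add: mult.left_commute)
      moreover have "rho x * f \<in> glue (weight w l)" "x \<otimes>\<^bsub>ringA\<^esub> a \<in> carrier ringA"
        using f ax glue_mult[OF rho_glue] by auto
      ultimately show ?thesis unfolding K_def by blast
    qed
    show "a \<otimes>\<^bsub>ringA\<^esub> x \<in> K" if "a \<in> K" "x \<in> carrier ringA" for a x
      using 1[OF that] that by (simp add: A.m_comm K_def)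
  qed
  have gw: "good_weight (weight w l)" using good_weight_weight w by blast
  have ag: "axial \<kappa> t (weight w l \<kappa> t) \<in> glue (weight w l)" for \<kappa> t
    using gw by (intro axial_glue) (auto simp: good_weight_def mult.commute)
  have sg: "single c edge \<in> glue (weight w l)" for c
    using single_edge_glue[of c 1] by simp
  have jgK: "j0 c \<in> K" "g \<kappa> t \<in> K" for c \<kappa> t
    using gc rj0 sg rg ag unfolding K_def by blast+
  have "idealJ \<subseteq> K"
    unfolding J by (rule A.genideal_minimal[OF KI]) (use jgK in blast)
  then have IK: "ideal_wl w l \<subseteq> K"
    unfolding I by (intro A.genideal_minimal[OF KI]) (use jgK \<open>idealJ \<subseteq> K\<close> in auto)
  have Jc: "(idealJ :: 'k ps4 set set) \<subseteq> carrier ringA"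
    using \<open>idealJ \<subseteq> K\<close> unfolding K_def by blast
  have Ii: "ideal (ideal_wl w l) ringA"
    unfolding I by (rule A.genideal_ideal) (use Jc gc in auto)
  have sub: "idealJ \<union> range (\<lambda>(\<kappa>, t). g \<kappa> t) \<subseteq> ideal_wl w l"
    unfolding I by (rule A.genideal_self) (use Jc gc in auto)
  have j0J: "range j0 \<subseteq> idealJ"
    unfolding J by (rule A.genideal_self) (use gc in auto)
  have gI: "j0 c \<in> ideal_wl w l" "g \<kappa> t \<in> ideal_wl w l" for c \<kappa> t
  proof -
    show "j0 c \<in> ideal_wl w l" using sub j0J by blast
    have "g \<kappa> t \<in> range (\<lambda>(\<kappa>, t). g \<kappa> t)" by (rule range_eqI[of _ _ "(\<kappa>, t)"]) simp
    then show "g \<kappa> t \<in> ideal_wl w l" by (rule subsetD[OF sub, OF UnI2])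
  qed
  \<comment> \<open>The quotient is unique where it exists, since \<open>edge\<close> is a
    nonzerodivisor; for other elements the chosen value is arbitrary.\<close>
  define j where "j a = (\<lambda>c. SOME q. rho a c = edge * q)" for a :: "'k ps4 set"
  have j: "j a = f" if "rho a = E * f" for a f
  proof
    fix c
    have 1: "rho a c = edge * f c" by (simp add: that E_def)
    have "rho a c = edge * j a c" unfolding j_def by (rule someI[of _ "f c"]) (rule 1)
    then have "edge * j a c = edge * f c" using 1 by simp
    then show "j a c = f c" using edge_neq_0 mult_left_cancel by blast
  qed
  have jK: "a \<in> carrier ringA" "rho a = E * j a" "j a \<in> glue (weight w l)" if "a \<in> ideal_wl w l" for a
  proof -
    obtain f where f: "a \<in> carrier ringA" "f \<in> glue (weight w l)" "rho a = E * f"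
      using IK \<open>a \<in> ideal_wl w l\<close> by (auto simp: K_def)
    then show "a \<in> carrier ringA" "rho a = E * j a" "j a \<in> glue (weight w l)"
      using j[OF f(3)] by auto
  qed
  have add: "additive_subgroup (ideal_wl w l) ringA" using Ii ideal.axioms(1) by blast
  have "frac_rep (ideal_mod ringA (ideal_wl w l)) j (weight w l)"
    unfolding frac_rep_def ideal_mod_def
  proof (simp only: partial_object.simps ring.simps module.simps, intro conjI ballI allI)
    fix x y assume xy: "x \<in> ideal_wl w l" "y \<in> ideal_wl w l"
    show "x \<oplus>\<^bsub>ringA\<^esub> y \<in> ideal_wl w l" using additive_subgroup.a_closed[OF add xy] .
    show "j (x \<oplus>\<^bsub>ringA\<^esub> y) = j x + j y"
      using jK[OF xy(1)] jK[OF xy(2)] by (intro j) (simp add: distrib_left)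
  next
    fix a x :: "'k ps4 set" assume ax: "a \<in> carrier ringA" "x \<in> ideal_wl w l"
    show "a \<otimes>\<^bsub>ringA\<^esub> x \<in> ideal_wl w l" by (rule ideal.I_l_closed[OF Ii ax(2,1)])
    show "j (a \<otimes>\<^bsub>ringA\<^esub> x) = rho a * j x"
      using ax jK[OF ax(2)] by (intro j) (simp add: mult.left_commute)
  next
    show "inj_on j (ideal_wl w l)"
    proof (rule inj_onI)
      fix x y assume xy: "x \<in> ideal_wl w l" "y \<in> ideal_wl w l" "j x = j y"
      then have "rho x = rho y" using jK(2) by metis
      then show "x = y" using jK(1) xy rho_inj by blast
    qed
    show "j ` ideal_wl w l \<subseteq> glue (weight w l)" using jK(3) by blast
    show "single c edge \<in> j ` ideal_wl w l" for c
      using j[OF rj0] gI(1) by (metis imageI)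
    show "axial \<kappa> t (weight w l \<kappa> t) \<in> j ` ideal_wl w l" for \<kappa> t
      using j[OF rg] gI(2) by (metis imageI)
  qed
  then show ?thesis using that by blast
qed

lemma mod_wl_frac_rep:
  fixes l :: "'k::field"
  assumes w: "admissible_weights w" "l \<noteq> 0"
  obtains j where "frac_rep (mod_wl w l) j (weight w l)" "j ` carrier (mod_wl w l) = glue (weight w l)"
proof -
  have g: "good_weight (weight w l)" by (rule good_weight_weight[OF w])
  obtain j where j: "frac_rep (ideal_mod ringA (ideal_wl w l)) j (weight w l)"
    by (rule ideal_wl_frac_rep[OF w])
  obtain j' where j': "frac_rep (dual_mod ringA (ideal_mod ringA (ideal_wl w l))) j' (swap_weight (weight w l))"
    by (rule frac_rep_dual[OF g j])
  show ?thesis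
    using frac_rep_dual[OF good_weight_swap[OF g] j'] that unfolding mod_wl_def swap_swap by blast
qed

text \<open>On each axis an isomorphism equates the differences of the two exponents, and minimum 1
  then fixes both. The constant terms of the unit quadruple agree across the axes of
  \<open>u\<close>, \<open>y\<close> and \<open>v\<close>, so on the axis of \<open>x\<close> they
  cancel and leave \<open>l = l'\<close>.\<close>

lemma mod_wl_iso_iff:
  fixes l l' :: "'k::field"
  assumes w: "admissible_weights w" "l \<noteq> 0" and w': "admissible_weights w'" "l' \<noteq> 0"
  shows "mod_iso ringA (mod_wl w l) (mod_wl w' l') \<longleftrightarrow> w = w' \<and> l = l'"
proof
  obtain j where j: "frac_rep (mod_wl w l) j (weight w l)" "j ` carrier (mod_wl w l) = glue (weight w l)"
    by (rule mod_wl_frac_rep[OF w])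
  {
    assume "w = w' \<and> l = l'"
    then show "mod_iso ringA (mod_wl w l) (mod_wl w' l')" using frac_rep_iso[OF j j] by simp
  }
  assume iso: "mod_iso ringA (mod_wl w l) (mod_wl w' l')"
  obtain j' where j': "frac_rep (mod_wl w' l') j' (weight w' l')"
    by (rule mod_wl_frac_rep[OF w'])
  obtain p where p: "\<And>c. p c $ 0 $ 0 \<noteq> 0"
    "\<And>\<kappa> t. res \<kappa> (p (cmp \<kappa> t False)) * (weight w l \<kappa> t False * weight w' l' \<kappa> t True) =
       res \<kappa> (p (cmp \<kappa> t True)) * (weight w l \<kappa> t True * weight w' l' \<kappa> t False)"
    by (rule frac_rep_iso_unit[OF good_weight_weight[OF w] good_weight_weight[OF w'] j(1) j' iso]) blast
  have cmpX: "m = n \<and> A $ 0 = B $ 0" if "A * fps_X ^ m = B * fps_X ^ n" "A $ 0 \<noteq> 0" "B $ 0 \<noteq> 0"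
    for A B :: "'k fps" and m n
  proof -
    have "m = n"
    proof (rule ccontr)
      assume "m \<noteq> n"
      moreover have "(A * fps_X ^ m) $ m = A $ 0" "(B * fps_X ^ n) $ n = B $ 0"
        by (simp_all add: fps_X_power_mult_right_nth)
      moreover have "(A * fps_X ^ m) $ n = 0" if "n < m" using that by (simp add: fps_X_power_mult_right_nth)
      moreover have "(B * fps_X ^ n) $ m = 0" if "m < n" using that by (simp add: fps_X_power_mult_right_nth)
      ultimately show False using that by (metis linorder_neqE_nat)
    qed
    then show ?thesis using that by simp
  qed
  have key: "expo w \<kappa> t s = expo w' \<kappa> t s \<and>
     p (cmp \<kappa> t False) $ 0 $ 0 * unit_part l' \<kappa> t True = p (cmp \<kappa> t True) $ 0 $ 0 * unit_part l \<kappa> t True" for \<kappa> t s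
  proof -
    have u: "unit_part l \<kappa> t s \<noteq> 0" "unit_part l' \<kappa> t s \<noteq> 0" for s
      using w w' by (simp_all add: unit_part_def)
    have uF: "unit_part d \<kappa> t False = 1" for d :: 'k by (simp add: unit_part_def)
    let ?e = "expo w \<kappa> t" and ?e' = "expo w' \<kappa> t"
    have "res \<kappa> (p (cmp \<kappa> t False)) * fps_const (unit_part l' \<kappa> t True) * fps_X ^ (nat (?e False) + nat (?e' True)) =
      res \<kappa> (p (cmp \<kappa> t True)) * fps_const (unit_part l \<kappa> t True) * fps_X ^ (nat (?e True) + nat (?e' False))"
      using p(2)[of \<kappa> t] by (simp add: weight_def uF power_add mult_ac)
    from cmpX[OF this] have *: "nat (?e False) + nat (?e' True) = nat (?e True) + nat (?e' False)"
      "p (cmp \<kappa> t False) $ 0 $ 0 * unit_part l' \<kappa> t True = p (cmp \<kappa> t True) $ 0 $ 0 * unit_part l \<kappa> t True"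
      using p(1) u by (simp_all add: res_nth_0)
    have "min (?e False) (?e True) = 1" "min (?e' False) (?e' True) = 1"
      using w(1) w'(1) unfolding admissible_iff by blast+
    then have "?e s = ?e' s" using *(1) by (cases s) (auto simp: min_def split: if_splits)
    then show ?thesis using *(2) by blast
  qed
  have "expo w = expo w'" using key by (intro ext) blast
  then have "w = w'" by (simp add: expo_inj)
  have "p (False, False) $ 0 $ 0 = p (True, False) $ 0 $ 0" "p (True, False) $ 0 $ 0 = p (True, True) $ 0 $ 0"
    "p (False, True) $ 0 $ 0 = p (True, True) $ 0 $ 0" "p (False, False) $ 0 $ 0 * l' = p (False, True) $ 0 $ 0 * l"
    using key[of True False] key[of False True] key[of True True] key[of False False]
    by (simp_all add: cmp_def unit_part_def)
  then have "l = l'" using p(1)[of "(True, True)"] by simp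
  with \<open>w = w'\<close> show "w = w' \<and> l = l'" by blast
qed


section \<open>Primes of the ring and regular sequences\<close>

context module
begin

lemma mod_span_minimal:
  "submodule N R M \<Longrightarrow> B \<subseteq> N \<Longrightarrow> mod_span R M B \<subseteq> N"
  by (auto simp: mod_span_def)

lemma mod_span_superset: "B \<subseteq> mod_span R M B"
  by (auto simp: mod_span_def)

lemma zero_in_mod_span: "\<zero>\<^bsub>M\<^esub> \<in> mod_span R M B"
  unfolding mod_span_def
  using subgroup.one_closed[OF submodule.axioms(1)] by fastforce

lemma multiples_submodule:
  assumes r: "r \<in> carrier R"
  shows "submodule {r \<odot>\<^bsub>M\<^esub> z |z. z \<in> carrier M} R M"
proof (rule submoduleI)
  show "{r \<odot>\<^bsub>M\<^esub> z |z. z \<in> carrier M} \<subseteq> carrier M" using r by auto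
  show "\<zero>\<^bsub>M\<^esub> \<in> {r \<odot>\<^bsub>M\<^esub> z |z. z \<in> carrier M}" using r by (auto intro!: exI[of _ "\<zero>\<^bsub>M\<^esub>"])
  show "\<ominus>\<^bsub>M\<^esub> a \<in> {r \<odot>\<^bsub>M\<^esub> z |z. z \<in> carrier M}" if "a \<in> {r \<odot>\<^bsub>M\<^esub> z |z. z \<in> carrier M}" for a
  proof -
    from that obtain z where "z \<in> carrier M" "a = r \<odot>\<^bsub>M\<^esub> z" by blast
    then have "\<ominus>\<^bsub>M\<^esub> a = r \<odot>\<^bsub>M\<^esub> (\<ominus>\<^bsub>M\<^esub> z)" "\<ominus>\<^bsub>M\<^esub> z \<in> carrier M" using r by (simp_all add: smult_r_minus)
    then show ?thesis by blast
  qed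
  show "a \<oplus>\<^bsub>M\<^esub> b \<in> {r \<odot>\<^bsub>M\<^esub> z |z. z \<in> carrier M}"
    if "a \<in> {r \<odot>\<^bsub>M\<^esub> z |z. z \<in> carrier M}" "b \<in> {r \<odot>\<^bsub>M\<^esub> z |z. z \<in> carrier M}" for a b
  proof -
    from that obtain y z where "y \<in> carrier M" "a = r \<odot>\<^bsub>M\<^esub> y" "z \<in> carrier M" "b = r \<odot>\<^bsub>M\<^esub> z" by blast
    then have "a \<oplus>\<^bsub>M\<^esub> b = r \<odot>\<^bsub>M\<^esub> (y \<oplus>\<^bsub>M\<^esub> z)" "y \<oplus>\<^bsub>M\<^esub> z \<in> carrier M" using r by (simp_all add: smult_r_distr)
    then show ?thesis by blast
  qed
  show "a \<odot>\<^bsub>M\<^esub> x \<in> {r \<odot>\<^bsub>M\<^esub> z |z. z \<in> carrier M}"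
    if "a \<in> carrier R" "x \<in> {r \<odot>\<^bsub>M\<^esub> z |z. z \<in> carrier M}" for a x
  proof -
    from that(2) obtain z where z: "z \<in> carrier M" "x = r \<odot>\<^bsub>M\<^esub> z" by blast
    then have "a \<odot>\<^bsub>M\<^esub> x = r \<odot>\<^bsub>M\<^esub> (a \<odot>\<^bsub>M\<^esub> z)" "a \<odot>\<^bsub>M\<^esub> z \<in> carrier M"
      using r that(1) by (simp_all add: smult_assoc1[symmetric] R.m_comm)
    then show ?thesis by blast
  qed
qed

text \<open>The submodule belonging to the empty initial segment is zero, and the one belonging to
  \<open>r1\<close> consists of its multiples. This states regularity of the first two entries
  without quotients.\<close>

lemma regular_seq_pair:
  assumes rs: "regular_seq R M rs" and len: "length rs \<ge> 2"
  obtains r1 r2 where "r1 \<in> set rs" "r2 \<in> set rs"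
    "\<And>z. z \<in> carrier M \<Longrightarrow> r1 \<odot>\<^bsub>M\<^esub> z = \<zero>\<^bsub>M\<^esub> \<Longrightarrow> z = \<zero>\<^bsub>M\<^esub>"
    "\<And>y z. y \<in> carrier M \<Longrightarrow> z \<in> carrier M \<Longrightarrow> r2 \<odot>\<^bsub>M\<^esub> z = r1 \<odot>\<^bsub>M\<^esub> y \<Longrightarrow> \<exists>y'\<in>carrier M. z = r1 \<odot>\<^bsub>M\<^esub> y'"
proof -
  define r1 r2 where "r1 = rs ! 0" and "r2 = rs ! 1"
  have "0 < length rs" "1 < length rs" using len by linarith+
  then have mem: "r1 \<in> set rs" "r2 \<in> set rs" unfolding r1_def r2_def by (metis nth_mem)+
  then have c: "r1 \<in> carrier R" "r2 \<in> carrier R" using rs by (auto simp: regular_seq_def)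
  have reg: "z \<in> seq_mult R M (take i rs)" if "i < length rs" "z \<in> carrier M" "(rs ! i) \<odot>\<^bsub>M\<^esub> z \<in> seq_mult R M (take i rs)" for i z
    using rs that by (auto simp: regular_seq_def)
  have 0: "seq_mult R M (take 0 rs) \<subseteq> {\<zero>\<^bsub>M\<^esub>}"
    unfolding seq_mult_def by (rule mod_span_minimal, rule submoduleI) auto
  have take1: "set (take 1 rs) = {r1}" using len by (cases rs) (auto simp: r1_def)
  have 1: "seq_mult R M (take 1 rs) \<subseteq> {r1 \<odot>\<^bsub>M\<^esub> z |z. z \<in> carrier M}"
    unfolding seq_mult_def take1 by (rule mod_span_minimal[OF multiples_submodule[OF c(1)]]) auto
  have m1: "r1 \<odot>\<^bsub>M\<^esub> z \<in> seq_mult R M (take 1 rs)" if "z \<in> carrier M" for z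
    unfolding seq_mult_def take1 by (rule subsetD[OF mod_span_superset]) (use that in auto)
  have "z = \<zero>\<^bsub>M\<^esub>" if "z \<in> carrier M" "r1 \<odot>\<^bsub>M\<^esub> z = \<zero>\<^bsub>M\<^esub>" for z
  proof -
    have in0: "(rs ! 0) \<odot>\<^bsub>M\<^esub> z \<in> seq_mult R M (take 0 rs)"
      using that(2) zero_in_mod_span by (simp add: r1_def seq_mult_def)
    have "0 < length rs" using len by linarith
    then have "z \<in> seq_mult R M (take 0 rs)" by (rule reg[OF _ that(1) in0])
    then show ?thesis using subsetD[OF 0] by simp
  qed
  moreover have "\<exists>y'\<in>carrier M. z = r1 \<odot>\<^bsub>M\<^esub> y'"
    if "y \<in> carrier M" "z \<in> carrier M" "r2 \<odot>\<^bsub>M\<^esub> z = r1 \<odot>\<^bsub>M\<^esub> y" for y z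
  proof -
    have "z \<in> seq_mult R M (take 1 rs)"
    proof (rule reg[OF _ that(2)])
      show "1 < length rs" using len by linarith
      show "rs ! 1 \<odot>\<^bsub>M\<^esub> z \<in> seq_mult R M (take 1 rs)"
        unfolding r2_def[symmetric] that(3) by (rule m1[OF that(1)])
    qed
    from subsetD[OF 1 this] show ?thesis by auto
  qed
  ultimately show ?thesis by (intro that[OF mem]) assumption+
qed

text \<open>A product of denominators works for finitely many generators at once, and the elements
  for which a fixed \<open>s\<close> works form a submodule.\<close>

lemma uniform_denominator:
  assumes p: "primeideal p R" and fg: "fin_gen_mod R M" and b: "b \<in> carrier M"
    and ex: "\<And>z. z \<in> carrier M \<Longrightarrow> \<exists>s\<in>carrier R - p. \<exists>a\<in>carrier R. s \<odot>\<^bsub>M\<^esub> z = a \<odot>\<^bsub>M\<^esub> b"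
  obtains s where "s \<in> carrier R - p" "\<And>z. z \<in> carrier M \<Longrightarrow> \<exists>a\<in>carrier R. s \<odot>\<^bsub>M\<^esub> z = a \<odot>\<^bsub>M\<^esub> b"
proof -
  interpret p: primeideal p R by (rule p)
  obtain B where B: "B \<subseteq> carrier M" "finite B" "mod_span R M B = carrier M"
    using fg by (auto simp: fin_gen_mod_def)
  have "\<exists>s\<in>carrier R - p. \<forall>z\<in>B. \<exists>a\<in>carrier R. s \<odot>\<^bsub>M\<^esub> z = a \<odot>\<^bsub>M\<^esub> b"
    using B(2,1)
  proof (induction B rule: finite_induct)
    case empty
    have "\<one> \<in> carrier R - p" using p.one_imp_carrier p.I_notcarr by auto
    then show ?case by blast
  next
    case (insert z B)
    then obtain s where s: "s \<in> carrier R" "s \<notin> p" "\<And>y. y \<in> B \<Longrightarrow> \<exists>a\<in>carrier R. s \<odot>\<^bsub>M\<^esub> y = a \<odot>\<^bsub>M\<^esub> b" by auto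
    from insert.prems have zc: "z \<in> carrier M" and Bc: "B \<subseteq> carrier M" by auto
    obtain t a where t: "t \<in> carrier R" "t \<notin> p" "a \<in> carrier R" "t \<odot>\<^bsub>M\<^esub> z = a \<odot>\<^bsub>M\<^esub> b"
      using ex[OF zc] by auto
    have "s \<otimes> t \<in> carrier R - p" using s t p.I_prime by auto
    moreover have "\<exists>a\<in>carrier R. (s \<otimes> t) \<odot>\<^bsub>M\<^esub> y = a \<odot>\<^bsub>M\<^esub> b" if "y \<in> insert z B" for y
    proof (cases "y = z")
      case True
      have "(s \<otimes> t) \<odot>\<^bsub>M\<^esub> z = (s \<otimes> a) \<odot>\<^bsub>M\<^esub> b"
        using s(1) t zc b by (simp add: smult_assoc1)
      then show ?thesis using True s(1) t(3) by blast
    next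
      case False
      with that have y: "y \<in> B" by simp
      obtain d where d: "d \<in> carrier R" "s \<odot>\<^bsub>M\<^esub> y = d \<odot>\<^bsub>M\<^esub> b" using s(3)[OF y] by blast
      have "(s \<otimes> t) \<odot>\<^bsub>M\<^esub> y = t \<odot>\<^bsub>M\<^esub> (s \<odot>\<^bsub>M\<^esub> y)"
        using s(1) t(1) y Bc by (auto simp: smult_assoc1[symmetric] R.m_comm)
      also have "\<dots> = (t \<otimes> d) \<odot>\<^bsub>M\<^esub> b" using d t(1) b by (simp add: smult_assoc1)
      finally show ?thesis using t(1) d(1) by blast
    qed
    ultimately show ?case by blast
  qed
  then obtain s where s: "s \<in> carrier R - p" "\<forall>z\<in>B. \<exists>a\<in>carrier R. s \<odot>\<^bsub>M\<^esub> z = a \<odot>\<^bsub>M\<^esub> b" by blast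
  have sc: "s \<in> carrier R" using s by blast
  let ?N = "{z \<in> carrier M. \<exists>a\<in>carrier R. s \<odot>\<^bsub>M\<^esub> z = a \<odot>\<^bsub>M\<^esub> b}"
  have subm: "submodule ?N R M"
  proof (rule submoduleI)
    show "\<zero>\<^bsub>M\<^esub> \<in> ?N" using b sc by (auto intro!: bexI[of _ \<zero>])
    show "\<ominus>\<^bsub>M\<^esub> y \<in> ?N" if yN: "y \<in> ?N" for y
    proof -
      obtain a where a: "y \<in> carrier M" "a \<in> carrier R" "s \<odot>\<^bsub>M\<^esub> y = a \<odot>\<^bsub>M\<^esub> b" using yN by blast
      have "s \<odot>\<^bsub>M\<^esub> (\<ominus>\<^bsub>M\<^esub> y) = (\<ominus> a) \<odot>\<^bsub>M\<^esub> b" using a b sc by (simp add: smult_r_minus smult_l_minus)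
      then show ?thesis using a by blast
    qed
    show "y \<oplus>\<^bsub>M\<^esub> z \<in> ?N" if yN: "y \<in> ?N" and zN: "z \<in> ?N" for y z
    proof -
      obtain a where a: "y \<in> carrier M" "a \<in> carrier R" "s \<odot>\<^bsub>M\<^esub> y = a \<odot>\<^bsub>M\<^esub> b" using yN by blast
      obtain d where d: "z \<in> carrier M" "d \<in> carrier R" "s \<odot>\<^bsub>M\<^esub> z = d \<odot>\<^bsub>M\<^esub> b" using zN by blast
      have "s \<odot>\<^bsub>M\<^esub> (y \<oplus>\<^bsub>M\<^esub> z) = (a \<oplus> d) \<odot>\<^bsub>M\<^esub> b" using a d b sc by (simp add: smult_r_distr smult_l_distr)
      then show ?thesis using a d by blast
    qed
    show "r \<odot>\<^bsub>M\<^esub> y \<in> ?N" if r: "r \<in> carrier R" "y \<in> ?N" for r y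
    proof -
      obtain a where a: "y \<in> carrier M" "a \<in> carrier R" "s \<odot>\<^bsub>M\<^esub> y = a \<odot>\<^bsub>M\<^esub> b" using r(2) by blast
      have "s \<odot>\<^bsub>M\<^esub> (r \<odot>\<^bsub>M\<^esub> y) = r \<odot>\<^bsub>M\<^esub> (s \<odot>\<^bsub>M\<^esub> y)"
        using a(1) r(1) sc by (simp add: smult_assoc1[symmetric] R.m_comm)
      also have "\<dots> = (r \<otimes> a) \<odot>\<^bsub>M\<^esub> b" using a r(1) b by (simp add: smult_assoc1)
      finally show ?thesis using a(1,2) r(1) by blast
    qed
  qed blast
  have "B \<subseteq> ?N" using s(2) B(1) by blast
  from mod_span_minimal[OF subm this] have N: "carrier M \<subseteq> ?N" by (simp only: B(3))
  then have "\<exists>a\<in>carrier R. s \<odot>\<^bsub>M\<^esub> z = a \<odot>\<^bsub>M\<^esub> b" if "z \<in> carrier M" for z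
    using subsetD[OF N that] by blast
  then show ?thesis using that s(1) by blast
qed

end

section \<open>The primes of the components, of the axes and of the closed point\<close>

lemma kernel_primeideal:
  fixes \<phi> :: "'k::field ps4 set \<Rightarrow> 'b::idom"
  assumes add: "\<And>a b. a \<in> carrier ringA \<Longrightarrow> b \<in> carrier ringA \<Longrightarrow> \<phi> (a \<oplus>\<^bsub>ringA\<^esub> b) = \<phi> a + \<phi> b"
    and mult: "\<And>a b. a \<in> carrier ringA \<Longrightarrow> b \<in> carrier ringA \<Longrightarrow> \<phi> (a \<otimes>\<^bsub>ringA\<^esub> b) = \<phi> a * \<phi> b"
    and one: "\<phi> \<one>\<^bsub>ringA\<^esub> = 1"
  shows "primeideal {a \<in> carrier ringA. \<phi> a = 0} ringA"
proof (rule primeidealI[OF _ A.is_cring])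
  have zero: "\<phi> \<zero>\<^bsub>ringA\<^esub> = 0" using add[of "\<zero>\<^bsub>ringA\<^esub>" "\<zero>\<^bsub>ringA\<^esub>"]
    by (metis A.l_zero A.zero_closed add_cancel_right_right)
  have minus: "\<phi> (\<ominus>\<^bsub>ringA\<^esub> a) = - \<phi> a" if "a \<in> carrier ringA" for a
    using add[of "\<ominus>\<^bsub>ringA\<^esub> a" a] that by (simp add: A.l_neg zero eq_neg_iff_add_eq_0)
  show "ideal {a \<in> carrier ringA. \<phi> a = 0} ringA"
    by (rule idealI[OF A.ring_axioms]; (rule A.add.subgroupI)?)
      (auto simp: add mult zero minus)
  show "carrier ringA \<noteq> {a \<in> carrier ringA. \<phi> a = 0}"
    using one A.one_closed by (metis (mono_tags, lifting) mem_Collect_eq zero_neq_one)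
qed (auto simp: mult)

definition comp_prime :: "bool \<times> bool \<Rightarrow> 'k::field ps4 set set" where
  "comp_prime c = {a \<in> carrier ringA. rho a c = 0}"

definition axis_prime :: "bool \<Rightarrow> bool \<Rightarrow> 'k::field ps4 set set" where
  "axis_prime \<kappa> t = {a \<in> carrier ringA. res \<kappa> (rho a (cmp \<kappa> t False)) = 0}"

definition nonunits :: "'k::field ps4 set set" where
  "nonunits = {a \<in> carrier ringA. rho a (False, False) $ 0 $ 0 = 0}"

lemma primes: "primeideal (comp_prime c :: 'k::field ps4 set set) ringA"
  "primeideal (axis_prime \<kappa> t :: 'k::field ps4 set set) ringA"
  "primeideal (nonunits :: 'k::field ps4 set set) ringA"
  unfolding comp_prime_def axis_prime_def nonunits_def by (rule kernel_primeideal; simp)+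

lemma nth_0_0: "rho a c $ 0 $ 0 = rho a c' $ 0 $ 0" if "a \<in> carrier ringA"
proof -
  have 1: "rho a (cmp \<kappa> t s) $ 0 $ 0 = rho a (cmp \<kappa> t s') $ 0 $ 0" for \<kappa> t s s'
    using glue_1D[OF rho_glue[OF that], of \<kappa> t s s'] by (metis res_nth_0)
  have "rho a (x, y) $ 0 $ 0 = rho a (x', y') $ 0 $ 0" for x y x' y'
    using 1[of False x y y'] 1[of True y' x x'] by (simp add: cmp_def)
  then show ?thesis by (cases c; cases c') simp
qed

lemma comp_prime_psubset: "comp_prime c \<subset> (axis_prime \<kappa> (ax \<kappa> c) :: 'k::field ps4 set set)"
proof -
  have eq: "res \<kappa> (rho a (cmp \<kappa> (ax \<kappa> c) False)) = res \<kappa> (rho a c)" if "a \<in> carrier ringA" for a :: "'k ps4 set"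
    using glue_1D[OF rho_glue[OF that], of \<kappa> "ax \<kappa> c" False "ax (\<not> \<kappa>) c"] by simp
  obtain e :: "'k ps4 set" where e: "e \<in> carrier ringA" "rho e = single c edge" by (rule single_in_A)
  have "res \<kappa> (rho e c) = 0" unfolding e(2) single_same by (rule res_edge)
  then have "e \<in> axis_prime \<kappa> (ax \<kappa> c)" using e(1) by (simp add: axis_prime_def eq)
  moreover have "e \<notin> comp_prime c" using e by (simp add: comp_prime_def)
  moreover have "comp_prime c \<subseteq> (axis_prime \<kappa> (ax \<kappa> c) :: 'k ps4 set set)"
    by (auto simp: comp_prime_def axis_prime_def eq)
  ultimately show ?thesis by blast
qed

lemma axis_prime_psubset: "axis_prime \<kappa> t \<subset> (nonunits :: 'k::field ps4 set set)"
proof -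
  have "axial \<kappa> t (\<lambda>_. fps_X :: 'k fps) \<in> glue 1" by (rule axial_glue) auto
  then obtain a :: "'k ps4 set" where a: "a \<in> carrier ringA" "rho a = axial \<kappa> t (\<lambda>_. fps_X)" by (rule rho_surj)
  have "res \<kappa> (rho a (cmp \<kappa> t False)) = fps_X" by (simp add: a axial_def)
  moreover from this have "rho a (cmp \<kappa> t False) $ 0 $ 0 = 0" by (metis res_nth_0 fps_X_nth zero_neq_one)
  ultimately have "a \<in> nonunits" "a \<notin> axis_prime \<kappa> t"
    using a(1) nth_0_0[OF a(1), of "(False, False)" "cmp \<kappa> t False"] by (auto simp: nonunits_def axis_prime_def)
  moreover have "axis_prime \<kappa> t \<subseteq> (nonunits :: 'k ps4 set set)"
  proof
    fix a :: "'k ps4 set" assume "a \<in> axis_prime \<kappa> t"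
    then have a: "a \<in> carrier ringA" "res \<kappa> (rho a (cmp \<kappa> t False)) = 0" by (auto simp: axis_prime_def)
    then have "rho a (cmp \<kappa> t False) $ 0 $ 0 = 0" by (metis res_nth_0 fps_zero_nth)
    then show "a \<in> nonunits"
      using a(1) nth_0_0[OF a(1), of "(False, False)" "cmp \<kappa> t False"] by (simp add: nonunits_def)
  qed
  ultimately show ?thesis by blast
qed

lemma not_maximal:
  fixes p :: "'k::field ps4 set set"
  assumes "p \<subset> nonunits" shows "\<not> maximalideal p ringA"
proof
  assume "maximalideal p ringA"
  then interpret maximalideal p ringA .
  interpret m: primeideal "nonunits :: 'k ps4 set set" ringA by (rule primes)
  show False
    using I_maximal[OF m.ideal_axioms] assms m.I_notcarr m.a_subset by auto
qed

text \<open>The chain runs from a component through an axis to the closed point. It makes the depth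
  of a nonzero maximal Cohen-Macaulay module at least two.\<close>

lemma krull_dim_ringA: "enat 2 \<le> krull_dim (ringA :: 'k::field ps4 set ring)"
proof -
  let ?ps = "[comp_prime (False, False), axis_prime False False, nonunits] :: 'k ps4 set set list"
  have "length ?ps = Suc 2 \<and> (\<forall>p\<in>set ?ps. primeideal p ringA) \<and> sorted_wrt (\<subset>) ?ps"
    using primes comp_prime_psubset[of "(False, False)" False] axis_prime_psubset[of False False]
    by (auto simp: ax_def)
  then have "enat 2 \<in> {enat n |n. \<exists>ps. length ps = Suc n \<and>
     (\<forall>p\<in>set ps. primeideal p (ringA :: 'k ps4 set ring)) \<and> sorted_wrt (\<subset>) ps}"
    by (intro CollectI exI[of _ 2] exI[of _ ?ps] conjI refl) (elim conjE; assumption)+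
  then show ?thesis unfolding krull_dim_def by (rule Sup_upper)
qed

lemma nonunits_iff: "a \<in> carrier ringA \<Longrightarrow> a \<notin> Units ringA \<Longrightarrow> a \<in> nonunits"
  using nonunit_ringA(1)[of a "(False, False)"] by (auto simp: nonunits_def)


section \<open>Modules of rank one\<close>

locale cm_rank_one =
  fixes M :: "('k::field ps4 set, 'm) module"
  assumes cm: "CM_lf_rank_one ringA M"
begin

sublocale module "ringA :: 'k ps4 set ring" M
  using cm by (simp add: CM_lf_rank_one_def CM_lf_def max_CM_def)

lemma free_at:
  assumes "primeideal p ringA" "\<not> maximalideal p ringA"
  obtains b where "b \<in> carrier M"
    "\<And>z. z \<in> carrier M \<Longrightarrow> \<exists>s\<in>carrier ringA - p. \<exists>a\<in>carrier ringA. s \<odot>\<^bsub>M\<^esub> z = a \<odot>\<^bsub>M\<^esub> b"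
    "\<And>a. a \<in> carrier ringA \<Longrightarrow> a \<odot>\<^bsub>M\<^esub> b = \<zero>\<^bsub>M\<^esub> \<Longrightarrow> \<exists>t\<in>carrier ringA - p. t \<otimes>\<^bsub>ringA\<^esub> a = \<zero>\<^bsub>ringA\<^esub>"
proof -
  have "free_of_rank (ring_at ringA p) (mod_at ringA p M) 1"
    using cm assms by (simp add: CM_lf_rank_one_def)
  from free_rank_one_at[OF assms(1) this] that show ?thesis by metis
qed

text \<open>\<open>max_CM\<close> admits the zero module, and rank one rules it out: its basis
  element would be annihilated by 1, so freeness at the prime of a component would place zero
  outside that prime.\<close>

lemma nonzero: "carrier M \<noteq> {\<zero>\<^bsub>M\<^esub>}"
proof
  assume 0: "carrier M = {\<zero>\<^bsub>M\<^esub>}"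
  let ?P = "comp_prime (False, False) :: 'k ps4 set set"
  have nm: "\<not> maximalideal ?P ringA"
    using not_maximal comp_prime_psubset axis_prime_psubset psubset_trans by metis
  obtain b where b: "b \<in> carrier M"
    "\<And>a. a \<in> carrier ringA \<Longrightarrow> a \<odot>\<^bsub>M\<^esub> b = \<zero>\<^bsub>M\<^esub> \<Longrightarrow> \<exists>t\<in>carrier ringA - ?P. t \<otimes>\<^bsub>ringA\<^esub> a = \<zero>\<^bsub>ringA\<^esub>"
    using free_at[OF primes(1) nm] by metis
  have "\<one>\<^bsub>ringA\<^esub> \<odot>\<^bsub>M\<^esub> b = \<zero>\<^bsub>M\<^esub>" using 0 b(1) by simp
  from b(2)[OF A.one_closed this] obtain t where
    t: "t \<in> carrier ringA - ?P" "t \<otimes>\<^bsub>ringA\<^esub> \<one>\<^bsub>ringA\<^esub> = \<zero>\<^bsub>ringA\<^esub>" by (rule bexE)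
  then have "t = \<zero>\<^bsub>ringA\<^esub>" by simp
  with t(1) show False by (simp add: comp_prime_def)
qed

text \<open>The depth is a supremum of lengths that exceeds 1, so some regular sequence of nonunits
  has length at least 2, whether or not the supremum is attained.\<close>

lemma regular_pair:
  obtains r1 r2 where "r1 \<in> carrier ringA - Units ringA" "r2 \<in> carrier ringA - Units ringA"
    "\<And>z. z \<in> carrier M \<Longrightarrow> r1 \<odot>\<^bsub>M\<^esub> z = \<zero>\<^bsub>M\<^esub> \<Longrightarrow> z = \<zero>\<^bsub>M\<^esub>"
    "\<And>y z. y \<in> carrier M \<Longrightarrow> z \<in> carrier M \<Longrightarrow> r2 \<odot>\<^bsub>M\<^esub> z = r1 \<odot>\<^bsub>M\<^esub> y \<Longrightarrow> \<exists>y'\<in>carrier M. z = r1 \<odot>\<^bsub>M\<^esub> y'"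
proof -
  have "depth_local ringA M = krull_dim (ringA :: 'k ps4 set ring)"
    using cm nonzero by (auto simp: CM_lf_rank_one_def CM_lf_def max_CM_def)
  then have "enat 1 < depth_local ringA M"
    using krull_dim_ringA order.strict_trans2[of "enat 1" "enat 2"] by simp
  then obtain rs where rs: "regular_seq ringA M rs" "set rs \<subseteq> carrier ringA - Units ringA" "enat 1 < enat (length rs)"
    unfolding depth_local_def less_Sup_iff by auto
  then have "length rs \<ge> 2" by simp
  show ?thesis
  proof (rule regular_seq_pair[OF rs(1) \<open>length rs \<ge> 2\<close>])
    fix r1 r2 assume r: "r1 \<in> set rs" "r2 \<in> set rs"
      "\<And>z. z \<in> carrier M \<Longrightarrow> r1 \<odot>\<^bsub>M\<^esub> z = \<zero>\<^bsub>M\<^esub> \<Longrightarrow> z = \<zero>\<^bsub>M\<^esub>"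
      "\<And>y z. y \<in> carrier M \<Longrightarrow> z \<in> carrier M \<Longrightarrow> r2 \<odot>\<^bsub>M\<^esub> z = r1 \<odot>\<^bsub>M\<^esub> y \<Longrightarrow> \<exists>y'\<in>carrier M. z = r1 \<odot>\<^bsub>M\<^esub> y'"
    show ?thesis
      by (rule that[OF subsetD[OF rs(2) r(1)] subsetD[OF rs(2) r(2)] r(3,4)])
  qed
qed

text \<open>If \<open>s m = 0\<close> with \<open>m \<noteq> 0\<close>, then no power of the regular element \<open>r\<close> annihilates \<open>m\<close>, so some
  prime without \<open>r\<close>, hence not maximal, contains the annihilator of \<open>m\<close>; but there the localization
  of \<open>M\<close> is free.\<close>

lemma torsion_free:
  assumes s: "s \<in> carrier ringA" "\<And>c. rho s c \<noteq> 0" and m: "m \<in> carrier M" "s \<odot>\<^bsub>M\<^esub> m = \<zero>\<^bsub>M\<^esub>"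
  shows "m = \<zero>\<^bsub>M\<^esub>"
proof -
  obtain r where r: "r \<in> carrier ringA" "r \<notin> Units ringA" "\<And>z. z \<in> carrier M \<Longrightarrow> r \<odot>\<^bsub>M\<^esub> z = \<zero>\<^bsub>M\<^esub> \<Longrightarrow> z = \<zero>\<^bsub>M\<^esub>"
    by (rule regular_pair) blast
  define I where "I = {a \<in> carrier ringA. a \<odot>\<^bsub>M\<^esub> m = \<zero>\<^bsub>M\<^esub>}"
  have I: "ideal I ringA"
  proof (rule idealI[OF A.ring_axioms])
    show "subgroup I (add_monoid ringA)"
    proof (rule A.add.subgroupI)
      have "\<zero>\<^bsub>ringA\<^esub> \<in> I" using m(1) by (simp add: I_def)
      then show "I \<noteq> {}" by blast
    qed (use m in \<open>auto simp: I_def smult_l_distr smult_l_minus\<close>)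
    show "x \<otimes>\<^bsub>ringA\<^esub> a \<in> I" if "a \<in> I" "x \<in> carrier ringA" for a x
      using that m(1) by (simp add: I_def smult_assoc1)
    then show "a \<otimes>\<^bsub>ringA\<^esub> x \<in> I" if "a \<in> I" "x \<in> carrier ringA" for a x
      using that by (simp add: A.m_comm I_def)
  qed
  show ?thesis
  proof (rule ccontr)
    assume m0: "m \<noteq> \<zero>\<^bsub>M\<^esub>"
    have "r [^]\<^bsub>ringA\<^esub> n \<odot>\<^bsub>M\<^esub> m \<noteq> \<zero>\<^bsub>M\<^esub>" for n :: nat
    proof (induction n)
      case (Suc n)
      have "r [^]\<^bsub>ringA\<^esub> Suc n \<odot>\<^bsub>M\<^esub> m = r \<odot>\<^bsub>M\<^esub> (r [^]\<^bsub>ringA\<^esub> n \<odot>\<^bsub>M\<^esub> m)"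
        using r(1) m(1) by (simp add: smult_assoc1[symmetric] A.m_comm)
      then show ?case using r(1) r(3)[of "r [^]\<^bsub>ringA\<^esub> n \<odot>\<^bsub>M\<^esub> m"] Suc m(1) by auto
    qed (use m0 m(1) in simp)
    then have "r [^]\<^bsub>ringA\<^esub> n \<notin> I" for n :: nat by (simp add: I_def)
    from A.exists_prime_avoiding_powers[OF I r(1) this]
    obtain P where P: "primeideal P ringA" "I \<subseteq> P" "r \<notin> P" .
    interpret P: primeideal P ringA by (rule P)
    have Pn: "P \<subseteq> nonunits"
    proof
      fix a assume a: "a \<in> P"
      have "a \<notin> Units ringA"
      proof
        assume "a \<in> Units ringA"
        then obtain x where "x \<in> carrier ringA" "a \<otimes>\<^bsub>ringA\<^esub> x = \<one>\<^bsub>ringA\<^esub>" unfolding Units_def by blast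
        then have "\<one>\<^bsub>ringA\<^esub> \<in> P" using P.I_r_closed[OF a] by metis
        then show False using P.one_imp_carrier P.I_notcarr by simp
      qed
      then show "a \<in> nonunits" using nonunits_iff P.a_subset a by blast
    qed
    moreover have "r \<in> nonunits" using nonunits_iff r by blast
    ultimately have "\<not> maximalideal P ringA" using not_maximal[of P] P(3) by blast
    from free_at[OF P(1) this] obtain b where b: "b \<in> carrier M"
      "\<And>z. z \<in> carrier M \<Longrightarrow> \<exists>s\<in>carrier ringA - P. \<exists>a\<in>carrier ringA. s \<odot>\<^bsub>M\<^esub> z = a \<odot>\<^bsub>M\<^esub> b"
      "\<And>a. a \<in> carrier ringA \<Longrightarrow> a \<odot>\<^bsub>M\<^esub> b = \<zero>\<^bsub>M\<^esub> \<Longrightarrow> \<exists>t\<in>carrier ringA - P. t \<otimes>\<^bsub>ringA\<^esub> a = \<zero>\<^bsub>ringA\<^esub>"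
      by metis
    obtain \<sigma> a where \<sigma>: "\<sigma> \<in> carrier ringA" "\<sigma> \<notin> P" "a \<in> carrier ringA" "\<sigma> \<odot>\<^bsub>M\<^esub> m = a \<odot>\<^bsub>M\<^esub> b"
      using b(2)[OF m(1)] by auto
    have "(s \<otimes>\<^bsub>ringA\<^esub> a) \<odot>\<^bsub>M\<^esub> b = s \<odot>\<^bsub>M\<^esub> (\<sigma> \<odot>\<^bsub>M\<^esub> m)"
      using s(1) \<sigma>(1,3) b(1) by (simp add: smult_assoc1 \<sigma>(4))
    also have "\<dots> = \<sigma> \<odot>\<^bsub>M\<^esub> (s \<odot>\<^bsub>M\<^esub> m)"
      using s(1) \<sigma>(1) m(1) by (simp add: smult_assoc1[symmetric] A.m_comm)
    finally have "(s \<otimes>\<^bsub>ringA\<^esub> a) \<odot>\<^bsub>M\<^esub> b = \<zero>\<^bsub>M\<^esub>" using m(2) \<sigma>(1) by simp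
    then obtain t where t: "t \<in> carrier ringA" "t \<notin> P" "t \<otimes>\<^bsub>ringA\<^esub> (s \<otimes>\<^bsub>ringA\<^esub> a) = \<zero>\<^bsub>ringA\<^esub>"
      using b(3)[of "s \<otimes>\<^bsub>ringA\<^esub> a"] s(1) \<sigma>(3) by auto
    \<comment> \<open>Being nonzero on every component, \<open>s\<close> is a nonzerodivisor in
      \<open>A\<close> and cancels.\<close>
    have "rho (t \<otimes>\<^bsub>ringA\<^esub> a) = rho \<zero>\<^bsub>ringA\<^esub>"
    proof
      fix c
      have "rho (t \<otimes>\<^bsub>ringA\<^esub> (s \<otimes>\<^bsub>ringA\<^esub> a)) c = 0" by (simp add: t(3))
      then show "rho (t \<otimes>\<^bsub>ringA\<^esub> a) c = rho \<zero>\<^bsub>ringA\<^esub> c"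
        using t(1) s(1) \<sigma>(3) s(2)[of c] by simp
    qed
    then have ta: "t \<otimes>\<^bsub>ringA\<^esub> a = \<zero>\<^bsub>ringA\<^esub>" using t(1) \<sigma>(3) by (intro rho_inj) simp_all
    \<comment> \<open>Thus \<open>t \<sigma>\<close> annihilates \<open>m\<close> and lies in the
      prime \<open>P\<close>, although neither factor does.\<close>
    have "(t \<otimes>\<^bsub>ringA\<^esub> \<sigma>) \<odot>\<^bsub>M\<^esub> m = (t \<otimes>\<^bsub>ringA\<^esub> a) \<odot>\<^bsub>M\<^esub> b"
      using t(1) \<sigma> m(1) b(1) by (simp add: smult_assoc1)
    then have "t \<otimes>\<^bsub>ringA\<^esub> \<sigma> \<in> I" using ta b(1) t(1) \<sigma>(1) by (simp add: I_def)
    then show False using P.I_prime[OF t(1) \<sigma>(1)] P(2) t(2) \<sigma>(2) by blast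
  qed
qed

text \<open>At the generic point of the component \<open>M\<close> has a basis \<open>b\<close>, and
  a uniform denominator \<open>s\<close> sends \<open>z\<close> to the numerator of
  \<open>s z\<close> over \<open>b\<close>. The numerator is ambiguous, but its value on
  \<open>c\<close> is not. The third clause prepares injectivity: an element supported on
  \<open>c\<close> annihilates the kernel.\<close>

lemma component_map:
  obtains \<psi> :: "'m \<Rightarrow> 'k ps2" where
    "\<And>x y. x \<in> carrier M \<Longrightarrow> y \<in> carrier M \<Longrightarrow> \<psi> (x \<oplus>\<^bsub>M\<^esub> y) = \<psi> x + \<psi> y"
    "\<And>a x. a \<in> carrier ringA \<Longrightarrow> x \<in> carrier M \<Longrightarrow> \<psi> (a \<odot>\<^bsub>M\<^esub> x) = rho a c * \<psi> x"
    "\<exists>e\<in>carrier ringA. (\<exists>g. g \<noteq> 0 \<and> rho e = single c g) \<and>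
      (\<forall>x\<in>carrier M. \<psi> x = 0 \<longrightarrow> e \<odot>\<^bsub>M\<^esub> x = \<zero>\<^bsub>M\<^esub>)"
    "\<exists>x\<in>carrier M. \<psi> x \<noteq> 0"
proof -
  let ?P = "comp_prime c :: 'k ps4 set set"
  have nm: "\<not> maximalideal ?P ringA"
    using not_maximal comp_prime_psubset axis_prime_psubset psubset_trans by metis
  obtain b where b: "b \<in> carrier M"
    "\<And>z. z \<in> carrier M \<Longrightarrow> \<exists>s\<in>carrier ringA - ?P. \<exists>a\<in>carrier ringA. s \<odot>\<^bsub>M\<^esub> z = a \<odot>\<^bsub>M\<^esub> b"
    "\<And>a. a \<in> carrier ringA \<Longrightarrow> a \<odot>\<^bsub>M\<^esub> b = \<zero>\<^bsub>M\<^esub> \<Longrightarrow> \<exists>t\<in>carrier ringA - ?P. t \<otimes>\<^bsub>ringA\<^esub> a = \<zero>\<^bsub>ringA\<^esub>"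
    using free_at[OF primes(1) nm] by metis
  have fg: "fin_gen_mod ringA M" using cm by (simp add: CM_lf_rank_one_def CM_lf_def max_CM_def)
  obtain s where s: "s \<in> carrier ringA - ?P" "\<And>z. z \<in> carrier M \<Longrightarrow> \<exists>a\<in>carrier ringA. s \<odot>\<^bsub>M\<^esub> z = a \<odot>\<^bsub>M\<^esub> b"
    using uniform_denominator[OF primes(1) fg b(1,2)] by metis
  have sc: "s \<in> carrier ringA" "rho s c \<noteq> 0" using s(1) by (auto simp: comp_prime_def)
  define num where "num z = (SOME a. a \<in> carrier ringA \<and> s \<odot>\<^bsub>M\<^esub> z = a \<odot>\<^bsub>M\<^esub> b)" for z
  have num: "num z \<in> carrier ringA" "s \<odot>\<^bsub>M\<^esub> z = num z \<odot>\<^bsub>M\<^esub> b" if z: "z \<in> carrier M" for z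
  proof -
    have "\<exists>a. a \<in> carrier ringA \<and> s \<odot>\<^bsub>M\<^esub> z = a \<odot>\<^bsub>M\<^esub> b" using s(2)[OF z] by blast
    from someI_ex[OF this] show "num z \<in> carrier ringA" "s \<odot>\<^bsub>M\<^esub> z = num z \<odot>\<^bsub>M\<^esub> b"
      by (simp_all add: num_def)
  qed
  have uniq: "rho a c = rho d c" if ad: "a \<in> carrier ringA" "d \<in> carrier ringA" "a \<odot>\<^bsub>M\<^esub> b = d \<odot>\<^bsub>M\<^esub> b" for a d
  proof -
    let ?x = "a \<oplus>\<^bsub>ringA\<^esub> \<ominus>\<^bsub>ringA\<^esub> d"
    have xc: "?x \<in> carrier ringA" using ad by simp
    have "?x \<odot>\<^bsub>M\<^esub> b = \<zero>\<^bsub>M\<^esub>"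
      using ad b(1) by (simp add: smult_l_distr smult_l_minus M.r_neg)
    then obtain t where t: "t \<in> carrier ringA" "t \<notin> ?P" "t \<otimes>\<^bsub>ringA\<^esub> ?x = \<zero>\<^bsub>ringA\<^esub>"
      using b(3)[OF xc] by auto
    have "rho (t \<otimes>\<^bsub>ringA\<^esub> ?x) c = 0" by (simp add: t(3))
    then have "rho t c * rho ?x c = 0" using t(1) xc by (simp only: rho_hom times_fun_apply)
    moreover have "rho t c \<noteq> 0" using t by (simp add: comp_prime_def)
    ultimately show ?thesis using ad by (simp add: fun_Compl_def)
  qed
  define \<psi> where "\<psi> z = rho (num z) c" for z
  have \<psi>: "\<psi> z = rho a c" if "z \<in> carrier M" "a \<in> carrier ringA" "s \<odot>\<^bsub>M\<^esub> z = a \<odot>\<^bsub>M\<^esub> b" for z a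
    unfolding \<psi>_def using that num[OF that(1)] by (intro uniq) simp_all
  have 1: "\<psi> (x \<oplus>\<^bsub>M\<^esub> y) = \<psi> x + \<psi> y" if xy: "x \<in> carrier M" "y \<in> carrier M" for x y
  proof -
    have "s \<odot>\<^bsub>M\<^esub> (x \<oplus>\<^bsub>M\<^esub> y) = (num x \<oplus>\<^bsub>ringA\<^esub> num y) \<odot>\<^bsub>M\<^esub> b"
      using xy num b(1) sc(1) by (simp add: smult_r_distr smult_l_distr)
    from \<psi>[OF _ _ this] show ?thesis using xy num by (simp add: \<psi>_def)
  qed
  have 2: "\<psi> (a \<odot>\<^bsub>M\<^esub> x) = rho a c * \<psi> x" if ax: "a \<in> carrier ringA" "x \<in> carrier M" for a x
  proof -
    have "s \<odot>\<^bsub>M\<^esub> (a \<odot>\<^bsub>M\<^esub> x) = a \<odot>\<^bsub>M\<^esub> (s \<odot>\<^bsub>M\<^esub> x)"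
      using ax sc(1) by (simp add: smult_assoc1[symmetric] A.m_comm)
    also have "\<dots> = (a \<otimes>\<^bsub>ringA\<^esub> num x) \<odot>\<^bsub>M\<^esub> b"
      using ax num[OF ax(2)] b(1) by (simp add: smult_assoc1)
    finally show ?thesis using \<psi>[of "a \<odot>\<^bsub>M\<^esub> x" "a \<otimes>\<^bsub>ringA\<^esub> num x"] ax num[OF ax(2)] by (simp add: \<psi>_def)
  qed
  obtain \<epsilon> :: "'k ps4 set" where \<epsilon>: "\<epsilon> \<in> carrier ringA" "rho \<epsilon> = single c edge" by (rule single_in_A)
  have 3: "\<exists>e\<in>carrier ringA. (\<exists>g. g \<noteq> 0 \<and> rho e = single c g) \<and>
      (\<forall>x\<in>carrier M. \<psi> x = 0 \<longrightarrow> e \<odot>\<^bsub>M\<^esub> x = \<zero>\<^bsub>M\<^esub>)"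
  proof (intro bexI conjI exI ballI impI)
    show "\<epsilon> \<otimes>\<^bsub>ringA\<^esub> s \<in> carrier ringA" using \<epsilon>(1) sc(1) by simp
    show "edge * rho s c \<noteq> 0" using sc(2) by simp
    show "rho (\<epsilon> \<otimes>\<^bsub>ringA\<^esub> s) = single c (edge * rho s c)" using \<epsilon> sc(1) by (simp only: rho_hom single_times)
    fix x assume x: "x \<in> carrier M" "\<psi> x = 0"
    \<comment> \<open>\<open>\<epsilon>\<close> removes every component but \<open>c\<close>, where
      the numerator of \<open>x\<close> is zero; hence \<open>\<epsilon> s\<close> annihilates
      \<open>x\<close>.\<close>
    have "rho (\<epsilon> \<otimes>\<^bsub>ringA\<^esub> num x) = rho \<zero>\<^bsub>ringA\<^esub>"
      using \<epsilon> num[OF x(1)] x(2) by (auto simp: \<psi>_def single_def)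
    then have "\<epsilon> \<otimes>\<^bsub>ringA\<^esub> num x = \<zero>\<^bsub>ringA\<^esub>" using \<epsilon>(1) num[OF x(1)] by (intro rho_inj) simp_all
    then show "(\<epsilon> \<otimes>\<^bsub>ringA\<^esub> s) \<odot>\<^bsub>M\<^esub> x = \<zero>\<^bsub>M\<^esub>"
      using \<epsilon>(1) sc(1) num[OF x(1)] x(1) b(1) by (simp add: smult_assoc1) (simp add: smult_assoc1[symmetric])
  qed
  have "\<psi> b = rho s c" by (rule \<psi>) (use b(1) sc(1) in auto)
  then have 4: "\<exists>x\<in>carrier M. \<psi> x \<noteq> 0" using b(1) sc(2) by (intro bexI[of _ b]) simp_all
  show ?thesis by (rule that[OF 1 2 3 4])
qed

text \<open>An element killed by all four component maps is annihilated by the sum of the four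
  elements that \<open>component_map\<close> supplies. The sum is nonzero on every component, so
  \<open>torsion_free\<close> applies.\<close>

lemma embedding:
  obtains j :: "'m \<Rightarrow> bool \<times> bool \<Rightarrow> 'k ps2" where
    "\<And>x y. x \<in> carrier M \<Longrightarrow> y \<in> carrier M \<Longrightarrow> j (x \<oplus>\<^bsub>M\<^esub> y) = j x + j y"
    "\<And>a x. a \<in> carrier ringA \<Longrightarrow> x \<in> carrier M \<Longrightarrow> j (a \<odot>\<^bsub>M\<^esub> x) = rho a * j x"
    "inj_on j (carrier M)" "\<And>c. \<exists>x\<in>carrier M. j x c \<noteq> 0"
proof -
  define Q where "Q c \<psi> \<longleftrightarrow>
    (\<forall>x\<in>carrier M. \<forall>y\<in>carrier M. \<psi> (x \<oplus>\<^bsub>M\<^esub> y) = \<psi> x + \<psi> y) \<and>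
    (\<forall>a\<in>carrier ringA. \<forall>x\<in>carrier M. \<psi> (a \<odot>\<^bsub>M\<^esub> x) = rho a c * \<psi> x) \<and>
    (\<exists>e\<in>carrier ringA. (\<exists>g. g \<noteq> 0 \<and> rho e = single c g) \<and>
      (\<forall>x\<in>carrier M. \<psi> x = 0 \<longrightarrow> e \<odot>\<^bsub>M\<^esub> x = \<zero>\<^bsub>M\<^esub>)) \<and>
    (\<exists>x\<in>carrier M. \<psi> x \<noteq> 0)" for c and \<psi> :: "'m \<Rightarrow> 'k ps2"
  have "\<exists>\<psi>. Q c \<psi>" for c
    by (rule component_map[of c]) (unfold Q_def, blast)
  then obtain \<psi> where Q: "\<And>c. Q c (\<psi> c)" by metis
  define j where "j x = (\<lambda>c. \<psi> c x)" for x
  have 1: "j (x \<oplus>\<^bsub>M\<^esub> y) = j x + j y" if "x \<in> carrier M" "y \<in> carrier M" for x y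
  proof
    fix c show "j (x \<oplus>\<^bsub>M\<^esub> y) c = (j x + j y) c" using Q[of c] that by (simp add: Q_def j_def)
  qed
  have 2: "j (a \<odot>\<^bsub>M\<^esub> x) = rho a * j x" if "a \<in> carrier ringA" "x \<in> carrier M" for a x
  proof
    fix c show "j (a \<odot>\<^bsub>M\<^esub> x) c = (rho a * j x) c" using Q[of c] that by (simp add: Q_def j_def)
  qed
  have "\<exists>e. e \<in> carrier ringA \<and> (\<exists>g. g \<noteq> 0 \<and> rho e = single c g) \<and>
      (\<forall>x\<in>carrier M. \<psi> c x = 0 \<longrightarrow> e \<odot>\<^bsub>M\<^esub> x = \<zero>\<^bsub>M\<^esub>)" for c
    using Q[of c] unfolding Q_def by blast
  then obtain e where e: "\<And>c. e c \<in> carrier ringA" "\<And>c. \<exists>g. g \<noteq> 0 \<and> rho (e c) = single c g"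
     "\<And>c x. x \<in> carrier M \<Longrightarrow> \<psi> c x = 0 \<Longrightarrow> e c \<odot>\<^bsub>M\<^esub> x = \<zero>\<^bsub>M\<^esub>"
    by metis
  have 3: "x = \<zero>\<^bsub>M\<^esub>" if x: "x \<in> carrier M" "j x = 0" for x
  proof -
    have ex: "e c \<odot>\<^bsub>M\<^esub> x = \<zero>\<^bsub>M\<^esub>" for c
    proof (rule e(3)[OF x(1)])
      have "j x c = 0" by (simp add: x(2))
      then show "\<psi> c x = 0" by (simp add: j_def)
    qed
    let ?s = "e (False, False) \<oplus>\<^bsub>ringA\<^esub> (e (False, True) \<oplus>\<^bsub>ringA\<^esub> (e (True, False) \<oplus>\<^bsub>ringA\<^esub> e (True, True)))"
    have sc: "?s \<in> carrier ringA" using e(1) by simp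
    have "?s \<odot>\<^bsub>M\<^esub> x = \<zero>\<^bsub>M\<^esub>" using e(1) x(1) by (simp add: smult_l_distr ex)
    moreover have "rho ?s c \<noteq> 0" for c
    proof -
      obtain g where g: "\<And>c. g c \<noteq> 0" "\<And>c. rho (e c) = single c (g c)" using e(2) by metis
      have "rho ?s c = g c"
        by (cases c; cases "fst c"; cases "snd c") (auto simp: e(1) g(2) single_def)
      then show ?thesis using g(1) by simp
    qed
    ultimately show ?thesis using torsion_free[OF sc _ x(1)] by blast
  qed
  have 5: "inj_on j (carrier M)"
  proof (rule inj_onI)
    fix x y assume xy: "x \<in> carrier M" "y \<in> carrier M" "j x = j y"
    have "j (x \<oplus>\<^bsub>M\<^esub> (\<ominus>\<^bsub>ringA\<^esub> \<one>\<^bsub>ringA\<^esub>) \<odot>\<^bsub>M\<^esub> y) = 0"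
      using xy by (simp add: 1 2)
    then have "x \<oplus>\<^bsub>M\<^esub> (\<ominus>\<^bsub>ringA\<^esub> \<one>\<^bsub>ringA\<^esub>) \<odot>\<^bsub>M\<^esub> y = \<zero>\<^bsub>M\<^esub>" using xy by (intro 3) simp_all
    then have "x \<oplus>\<^bsub>M\<^esub> \<ominus>\<^bsub>M\<^esub> y = \<zero>\<^bsub>M\<^esub>" using xy by (simp add: smult_l_minus)
    then show "x = y" using xy M.minus_equality M.minus_minus by (metis M.a_inv_closed)
  qed
  have 6: "\<exists>x\<in>carrier M. j x c \<noteq> 0" for c
    using Q[of c] unfolding Q_def j_def by blast
  show ?thesis by (rule that[OF 1 2 5 6])
qed

text \<open>\<open>line\<close> comes from freeness at the prime of the axis. For
  \<open>sat\<close>, a regular pair gives \<open>r1 f = y1\<close> and \<open>r2 f = y2\<close> in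
  the image; then \<open>r2 y1 = r1 y2\<close>, so \<open>y1\<close> is \<open>r1\<close> times an
  element of the image, and cancelling \<open>r1\<close> identifies that element with
  \<open>f\<close>.\<close>

lemma saturated_image:
  assumes add: "\<And>x y. x \<in> carrier M \<Longrightarrow> y \<in> carrier M \<Longrightarrow> j (x \<oplus>\<^bsub>M\<^esub> y) = j x + j y"
    and smult: "\<And>a x. a \<in> carrier ringA \<Longrightarrow> x \<in> carrier M \<Longrightarrow> j (a \<odot>\<^bsub>M\<^esub> x) = rho a * j x"
    and inj: "inj_on j (carrier M)" and nz: "\<And>c. \<exists>x\<in>carrier M. j x c \<noteq> 0"
  shows "saturated_submodule (j ` carrier M :: (bool \<times> bool \<Rightarrow> 'k ps2) set)"
proof
  show Gadd: "f + g \<in> j ` carrier M" if "f \<in> j ` carrier M" "g \<in> j ` carrier M" for f g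
    using that by (auto simp flip: add)
  show Gmult: "a * f \<in> j ` carrier M" if af: "a \<in> glue 1" "f \<in> j ` carrier M" for a f
  proof -
    obtain a' x where "a' \<in> carrier ringA" "rho a' = a" "x \<in> carrier M" "f = j x"
      using rho_surj[OF af(1)] af(2) by (metis imageE)
    then have "a * f = j (a' \<odot>\<^bsub>M\<^esub> x)" "a' \<odot>\<^bsub>M\<^esub> x \<in> carrier M" by (simp_all add: smult)
    then show ?thesis by blast
  qed
  show "\<exists>b\<in>j ` carrier M. \<forall>z\<in>j ` carrier M. \<exists>s\<in>glue 1. \<exists>a\<in>glue 1.
      res \<kappa> (s (cmp \<kappa> t False)) \<noteq> 0 \<and> s * z = a * b" for \<kappa> t
  proof -
    let ?P = "axis_prime \<kappa> t :: 'k ps4 set set"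
    have nm: "\<not> maximalideal ?P ringA" using not_maximal axis_prime_psubset by metis
    obtain b where b: "b \<in> carrier M"
      "\<And>z. z \<in> carrier M \<Longrightarrow> \<exists>s\<in>carrier ringA - ?P. \<exists>a\<in>carrier ringA. s \<odot>\<^bsub>M\<^esub> z = a \<odot>\<^bsub>M\<^esub> b"
      using free_at[OF primes(2) nm] by metis
    show ?thesis
    proof (rule bexI[of _ "j b"], rule ballI)
      fix f assume "f \<in> j ` carrier M"
      then obtain z where z: "z \<in> carrier M" "f = j z" by blast
      obtain s a where s: "s \<in> carrier ringA" "s \<notin> ?P" "a \<in> carrier ringA" "s \<odot>\<^bsub>M\<^esub> z = a \<odot>\<^bsub>M\<^esub> b"
        using b(2)[OF z(1)] by auto
      have "rho s * f = j (s \<odot>\<^bsub>M\<^esub> z)" using smult[OF s(1) z(1)] z(2) by simp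
      also have "\<dots> = rho a * j b" unfolding s(4) by (rule smult[OF s(3) b(1)])
      finally have "rho s * f = rho a * j b" .
      moreover have "res \<kappa> (rho s (cmp \<kappa> t False)) \<noteq> 0" using s(1,2) by (simp add: axis_prime_def)
      ultimately show "\<exists>s\<in>glue 1. \<exists>a\<in>glue 1. res \<kappa> (s (cmp \<kappa> t False)) \<noteq> 0 \<and> s * f = a * j b"
        using rho_glue[OF s(1)] rho_glue[OF s(3)] by blast
    qed (use b(1) in blast)
  qed
  fix f :: "bool \<times> bool \<Rightarrow> 'k ps2"
  assume f: "\<And>\<kappa> t. axial \<kappa> t (\<lambda>_. fps_X) * f \<in> j ` carrier M"
  have inG: "rho r * f \<in> j ` carrier M" if r: "r \<in> carrier ringA - Units ringA" for r
  proof -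
    obtain b where b: "\<And>\<kappa> t. b \<kappa> t \<in> glue 1"
      "rho r = (\<Sum>\<kappa>\<in>UNIV. \<Sum>t\<in>UNIV. axial \<kappa> t (\<lambda>_. fps_X) * b \<kappa> t)"
      using nonunit_ringA(2)[OF r] by blast
    have t: "b \<kappa> t * (axial \<kappa> t (\<lambda>_. fps_X) * f) \<in> j ` carrier M" for \<kappa> t
      by (rule Gmult[OF b(1) f])
    have "rho r * f = (b False False * (axial False False (\<lambda>_. fps_X) * f) + b False True * (axial False True (\<lambda>_. fps_X) * f))
       + (b True False * (axial True False (\<lambda>_. fps_X) * f) + b True True * (axial True True (\<lambda>_. fps_X) * f))"
      unfolding b(2) UNIV_bool by (simp add: distrib_left distrib_right mult_ac)
    also have "\<dots> \<in> j ` carrier M" by (intro Gadd t)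
    finally show ?thesis .
  qed
  obtain r1 r2 where r: "r1 \<in> carrier ringA - Units ringA" "r2 \<in> carrier ringA - Units ringA"
    "\<And>z. z \<in> carrier M \<Longrightarrow> r1 \<odot>\<^bsub>M\<^esub> z = \<zero>\<^bsub>M\<^esub> \<Longrightarrow> z = \<zero>\<^bsub>M\<^esub>"
    "\<And>y z. y \<in> carrier M \<Longrightarrow> z \<in> carrier M \<Longrightarrow> r2 \<odot>\<^bsub>M\<^esub> z = r1 \<odot>\<^bsub>M\<^esub> y \<Longrightarrow> \<exists>y'\<in>carrier M. z = r1 \<odot>\<^bsub>M\<^esub> y'"
    by (rule regular_pair, rule that)
  have rc: "r1 \<in> carrier ringA" "r2 \<in> carrier ringA" using r by auto
  \<comment> \<open>If \<open>r1\<close> vanished on a component, it would annihilate a nonzero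
    element of \<open>M\<close> supported on that component.\<close>
  have nzd: "rho r1 c \<noteq> 0" for c
  proof
    assume 0: "rho r1 c = 0"
    obtain x where x: "x \<in> carrier M" "j x c \<noteq> 0" using nz by blast
    obtain \<epsilon> :: "'k ps4 set" where \<epsilon>: "\<epsilon> \<in> carrier ringA" "rho \<epsilon> = single c edge" by (rule single_in_A)
    have jz: "j \<zero>\<^bsub>M\<^esub> = 0" using add[of "\<zero>\<^bsub>M\<^esub>" "\<zero>\<^bsub>M\<^esub>"] by simp
    have "j (r1 \<odot>\<^bsub>M\<^esub> (\<epsilon> \<odot>\<^bsub>M\<^esub> x)) = j \<zero>\<^bsub>M\<^esub>"
      using rc(1) \<epsilon> x(1) 0 by (auto simp: smult jz single_def fun_eq_iff)
    then have "r1 \<odot>\<^bsub>M\<^esub> (\<epsilon> \<odot>\<^bsub>M\<^esub> x) = \<zero>\<^bsub>M\<^esub>" using inj rc(1) \<epsilon>(1) x(1) by (auto simp: inj_on_def)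
    then have "\<epsilon> \<odot>\<^bsub>M\<^esub> x = \<zero>\<^bsub>M\<^esub>" using r(3) \<epsilon>(1) x(1) by simp
    then have "j (\<epsilon> \<odot>\<^bsub>M\<^esub> x) c = 0" by (simp add: jz)
    then show False using \<epsilon> x by (simp add: smult)
  qed
  obtain y1 where y1: "y1 \<in> carrier M" "rho r1 * f = j y1" using inG[OF r(1)] by (rule imageE)
  obtain y2 where y2: "y2 \<in> carrier M" "rho r2 * f = j y2" using inG[OF r(2)] by (rule imageE)
  have "j (r2 \<odot>\<^bsub>M\<^esub> y1) = j (r1 \<odot>\<^bsub>M\<^esub> y2)"
    using rc y1(1) y2(1) by (simp add: smult y1(2)[symmetric] y2(2)[symmetric] mult.left_commute)
  then have "r2 \<odot>\<^bsub>M\<^esub> y1 = r1 \<odot>\<^bsub>M\<^esub> y2" using inj rc y1(1) y2(1) by (auto simp: inj_on_def)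
  then obtain y where y: "y \<in> carrier M" "y1 = r1 \<odot>\<^bsub>M\<^esub> y" using r(4)[OF y2(1) y1(1)] by blast
  have "f = j y"
  proof
    fix c
    have "(rho r1 * f) c = (rho r1 * j y) c" using y1(2) y rc(1) by (simp add: smult)
    then show "f c = j y c" using nzd[of c] by simp
  qed
  then show "f \<in> j ` carrier M" using y(1) by blast
qed

text \<open>Division by \<open>h\<close> and by the unit \<open>\<epsilon>\<close> carries the image
  of \<open>M\<close> onto \<open>glue (weight w l)\<close>, which also represents the bidual of the
  ideal.\<close>

lemma iso_mod_wl:
  obtains w and l :: 'k where "admissible_weights w" "l \<noteq> 0" "mod_iso ringA M (mod_wl w l)"
proof -
  obtain j :: "'m \<Rightarrow> bool \<times> bool \<Rightarrow> 'k ps2" where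
    j: "\<And>x y. x \<in> carrier M \<Longrightarrow> y \<in> carrier M \<Longrightarrow> j (x \<oplus>\<^bsub>M\<^esub> y) = j x + j y"
    "\<And>a x. a \<in> carrier ringA \<Longrightarrow> x \<in> carrier M \<Longrightarrow> j (a \<odot>\<^bsub>M\<^esub> x) = rho a * j x"
    "inj_on j (carrier M)" "\<And>c. \<exists>x\<in>carrier M. j x c \<noteq> 0"
    by (rule embedding) (rule that)
  interpret G: saturated_submodule "j ` carrier M" by (rule saturated_image[OF j])
  obtain h \<beta> where h: "\<And>c. h c \<noteq> 0" "\<And>\<kappa> t s. \<beta> \<kappa> t s \<noteq> 0" "j ` carrier M = (\<lambda>f. h * f) ` glue \<beta>"
    by (rule G.scaled_glue) (use j(4) in blast)+
  obtain w l \<epsilon> where w: "admissible_weights w" "l \<noteq> 0" "\<And>c. \<epsilon> c $ 0 $ 0 \<noteq> 0"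
    "\<And>f. \<epsilon> * f \<in> glue \<beta> \<longleftrightarrow> f \<in> glue (weight w l)"
    by (rule normalize_weight[OF h(2)], rule that)
  have "\<exists>g. \<epsilon> c * g = 1" for c using unit_ps2[OF w(3)] by metis
  then obtain \<epsilon>' where "\<And>c. \<epsilon> c * \<epsilon>' c = 1" by metis
  then have \<epsilon>': "\<epsilon> * \<epsilon>' = 1" by (simp add: fun_eq_iff)
  have cancel: "f = g" if "h * (\<epsilon> * f) = h * (\<epsilon> * g)" for f g
  proof
    fix c
    have "h c * (\<epsilon> c * f c) = h c * (\<epsilon> c * g c)" using fun_cong[OF that, of c] by simp
    then show "f c = g c" using h(1)[of c] w(3)[of c] by auto
  qed
  have ex: "\<exists>f. f \<in> glue (weight w l) \<and> j x = h * (\<epsilon> * f)" if x: "x \<in> carrier M" for x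
  proof -
    obtain f where f: "f \<in> glue \<beta>" "j x = h * f" using x h(3) by blast
    have "\<epsilon> * (\<epsilon>' * f) = f" using \<epsilon>' by (simp add: mult.assoc[symmetric])
    then show ?thesis using f w(4)[of "\<epsilon>' * f"] by (intro exI[of _ "\<epsilon>' * f"]) simp
  qed
  define J where "J x = (SOME f. f \<in> glue (weight w l) \<and> j x = h * (\<epsilon> * f))" for x
  have J: "J x \<in> glue (weight w l)" "j x = h * (\<epsilon> * J x)" if x: "x \<in> carrier M" for x
    using someI_ex[OF ex[OF x]] by (simp_all add: J_def)
  have img: "J ` carrier M = glue (weight w l)"
  proof
    show "glue (weight w l) \<subseteq> J ` carrier M"
    proof
      fix f assume "f \<in> glue (weight w l)"
      then have "h * (\<epsilon> * f) \<in> j ` carrier M" using w(4) h(3) by blast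
      then obtain x where x: "x \<in> carrier M" "h * (\<epsilon> * f) = j x" by blast
      have "f = J x" by (rule cancel) (use x J(2)[OF x(1)] in simp)
      then show "f \<in> J ` carrier M" using x(1) by blast
    qed
  qed (use J in blast)
  have gw: "good_weight (weight w l)" by (rule good_weight_weight[OF w(1,2)])
  have rep: "frac_rep M J (weight w l)"
    unfolding frac_rep_def img
  proof (intro conjI ballI allI)
    fix x y assume xy: "x \<in> carrier M" "y \<in> carrier M"
    show "x \<oplus>\<^bsub>M\<^esub> y \<in> carrier M" using xy by simp
    show "J (x \<oplus>\<^bsub>M\<^esub> y) = J x + J y"
      by (rule cancel) (use xy J j(1) in \<open>simp add: distrib_left flip: J(2)\<close>)
  next
    fix a :: "'k ps4 set" and x assume ax: "a \<in> carrier ringA" "x \<in> carrier M"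
    show "a \<odot>\<^bsub>M\<^esub> x \<in> carrier M" using ax by simp
    have "h * (\<epsilon> * J (a \<odot>\<^bsub>M\<^esub> x)) = rho a * (h * (\<epsilon> * J x))"
      using ax J(2)[OF ax(2)] J(2)[of "a \<odot>\<^bsub>M\<^esub> x"] j(2)[OF ax] by simp
    also have "\<dots> = h * (\<epsilon> * (rho a * J x))" by (simp only: mult.left_commute)
    finally show "J (a \<odot>\<^bsub>M\<^esub> x) = rho a * J x" by (rule cancel)
  next
    show "inj_on J (carrier M)"
    proof (rule inj_onI)
      fix x y assume xy: "x \<in> carrier M" "y \<in> carrier M" "J x = J y"
      then have "j x = j y" using J(2) by metis
      then show "x = y" using j(3) xy by (simp add: inj_on_def)
    qed
    show "single c edge \<in> glue (weight w l)" for c using single_edge_glue[of c 1] by simp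
    show "axial \<kappa> t (weight w l \<kappa> t) \<in> glue (weight w l)" for \<kappa> t
      using gw by (intro axial_glue) (auto simp: good_weight_def mult.commute)
  qed blast
  obtain j' where j': "frac_rep (mod_wl w l) j' (weight w l)" "j' ` carrier (mod_wl w l) = glue (weight w l)"
    by (rule mod_wl_frac_rep[OF w(1,2)])
  from frac_rep_iso[OF rep img j'] show ?thesis by (rule that[OF w(1,2)])
qed

end

theorem proposition8p9:
  shows "(\<forall>M :: ('k::field ps4 set, 'm) module. CM_lf_rank_one ringA M \<longrightarrow>
            (\<exists>w (l::'k). admissible_weights w \<and> l \<noteq> 0 \<and> mod_iso ringA M (mod_wl w l)))
       \<and> (\<forall>w w' (l::'k) l'. admissible_weights w \<and> admissible_weights w' \<and> l \<noteq> 0 \<and> l' \<noteq> 0 \<longrightarrow>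
            (mod_iso ringA (mod_wl w l) (mod_wl w' l') \<longleftrightarrow> w = w' \<and> l = l'))"
proof (intro conjI allI impI)
  fix M :: "('k ps4 set, 'm) module"
  assume "CM_lf_rank_one ringA M"
  then interpret cm_rank_one M by unfold_locales
  show "\<exists>w (l::'k). admissible_weights w \<and> l \<noteq> 0 \<and> mod_iso ringA M (mod_wl w l)"
    by (rule iso_mod_wl) blast
qed (use mod_wl_iso_iff in blast)

end
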